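(* Let $A$ be a commutative ring, let $F(X)$ be a monic polynomial in $A[X]$ of positive degree $n$, and let $U\subseteq A[X]$ be a multiplicatively closed subset. The following three assertions are equivalent. (1) The canonical map $A[X]/(F(X))\to A[X]_U/(F(X))$ is an isomorphism. (2) The residue classes of $1,X,\ldots,X^{n-1}$ modulo $F(X)A[X]_U$ form a basis for the $A$-module $A[X]_U/(F(X))$. (3) The norm $N_F(f(X))$ with respect to $F(X)$ is a unit in $A$ for all $f(X)$ in $U\subseteq A[X]$.
   Context: $A[X]_U$ is the fraction ring (localization) of $A[X]$ with respect to $U$, and $A[X]_U/(F(X))$ denotes $A[X]_U/F(X)A[X]_U$. Norm function: let $\otimes_A^nA[X]$ be the $n$-fold tensor product over $A$, let $X_i=1\otimes\cdots\otimes X\otimes\cdots\otimes1$ ($X$ in the $i$'th place), and let $\otimes_A^{(n)}A[X]$ be the subring of tensors invariant under permutation of the factors, which is the polynomial ring over $A$ in the elementary symmetric functions $s_{1,n}(X),\ldots,s_{n,n}(X)$ in $X_1,\ldots,X_n$. For a monic polynomial $F(X)=X^n-u_1X^{n-1}+\dots+(-1)^nu_n$ in $A[X]$, let $u_F:\otimes_A^{(n)}A[X]\to A$ be the unique $A$-algebra homomorphism with $u_F(s_{i,n}(X))=u_i$ for $i=1,\ldots,n$. The norm of $f(X)\in A[X]$ with respect to $F(X)$ is $N_F(f(X)):=u_F(f(X)\otimes\cdots\otimes f(X))$. *)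

theory Defs
  imports "HOL-Algebra.UnivPoly" "HOL-Algebra.QuotRing" "HOL-Algebra.Product_Groups"
    "HOL-Combinatorics.Permutations"
begin

text \<open>
  Algebras over a ring \<open>R\<close> are \<open>module\<close> records, as in the locale \<^locale>\<open>algebra\<close>; the
  polynomial ring \<open>R[X]\<close> is \<^term>\<open>UP R\<close>.
\<close>

section \<open>Residue algebras and bases\<close>

definition quotient_algebra ::
  "('a, 'b, 'm) module_scheme \<Rightarrow> 'b set \<Rightarrow> ('a, 'b set) module" where
  "quotient_algebra B I =
    \<lparr>carrier = carrier (B Quot I),
     monoid.mult = (\<otimes>\<^bsub>B Quot I\<^esub>),
     one = \<one>\<^bsub>B Quot I\<^esub>,
     zero = \<zero>\<^bsub>B Quot I\<^esub>,
     add = (\<oplus>\<^bsub>B Quot I\<^esub>),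
     smult = (\<lambda>a C. \<Union>x\<in>C. I +>\<^bsub>B\<^esub> (a \<odot>\<^bsub>B\<^esub> x))\<rparr>"

text \<open>
  A basis is an indexed family rather than a set, so that independence also forces the members of
  the family to be pairwise distinct (unless \<open>R\<close> is the zero ring).
\<close>

definition module_basis ::
  "('a, 'r) ring_scheme \<Rightarrow> ('a, 'b, 'm) module_scheme \<Rightarrow> 'i set \<Rightarrow> ('i \<Rightarrow> 'b) \<Rightarrow> bool" where
  "module_basis R M I b \<longleftrightarrow>
    finite I \<and> b \<in> I \<rightarrow> carrier M \<and>
    (\<forall>x\<in>carrier M. \<exists>c \<in> I \<rightarrow> carrier R. x = (\<Oplus>\<^bsub>M\<^esub>i\<in>I. c i \<odot>\<^bsub>M\<^esub> b i)) \<and>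
    (\<forall>c \<in> I \<rightarrow> carrier R. (\<Oplus>\<^bsub>M\<^esub>i\<in>I. c i \<odot>\<^bsub>M\<^esub> b i) = \<zero>\<^bsub>M\<^esub> \<longrightarrow> (\<forall>i\<in>I. c i = \<zero>\<^bsub>R\<^esub>))"


section \<open>Localization\<close>

text \<open>
  The set \<open>S\<close> may contain zero divisors, and even zero, hence the factor \<open>t\<close>.
\<close>

definition loc_rel ::
  "('b, 'm) ring_scheme \<Rightarrow> 'b set \<Rightarrow> (('b \<times> 'b) \<times> ('b \<times> 'b)) set" where
  "loc_rel B S = {((x, s), (y, t)).
     x \<in> carrier B \<and> s \<in> S \<and> y \<in> carrier B \<and> t \<in> S \<and>
     (\<exists>u\<in>S. u \<otimes>\<^bsub>B\<^esub> (x \<otimes>\<^bsub>B\<^esub> t) = u \<otimes>\<^bsub>B\<^esub> (y \<otimes>\<^bsub>B\<^esub> s))}"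

definition loc_frac ::
  "('b, 'm) ring_scheme \<Rightarrow> 'b set \<Rightarrow> 'b \<Rightarrow> 'b \<Rightarrow> ('b \<times> 'b) set" where
  "loc_frac B S x s = loc_rel B S `` {(x, s)}"

definition localization ::
  "('a, 'b, 'm) module_scheme \<Rightarrow> 'b set \<Rightarrow> ('a, ('b \<times> 'b) set) module" where
  "localization B S =
    \<lparr>carrier = (carrier B \<times> S) // loc_rel B S,
     monoid.mult = (\<lambda>Y Z. \<Union>(y, s)\<in>Y. \<Union>(z, t)\<in>Z. loc_frac B S (y \<otimes>\<^bsub>B\<^esub> z) (s \<otimes>\<^bsub>B\<^esub> t)),
     one = loc_frac B S \<one>\<^bsub>B\<^esub> \<one>\<^bsub>B\<^esub>,
     zero = loc_frac B S \<zero>\<^bsub>B\<^esub> \<one>\<^bsub>B\<^esub>,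
     add = (\<lambda>Y Z. \<Union>(y, s)\<in>Y. \<Union>(z, t)\<in>Z.
              loc_frac B S ((y \<otimes>\<^bsub>B\<^esub> t) \<oplus>\<^bsub>B\<^esub> (z \<otimes>\<^bsub>B\<^esub> s)) (s \<otimes>\<^bsub>B\<^esub> t)),
     smult = (\<lambda>a Y. \<Union>(y, s)\<in>Y. loc_frac B S (a \<odot>\<^bsub>B\<^esub> y) s)\<rparr>"

text \<open>The ideal \<open>F(X) A[X]\<^sub>U\<close>, the \<open>A\<close>-algebra \<open>A[X]\<^sub>U/(F(X))\<close>, and the map
  \<open>A[X] \<rightarrow> A[X]\<^sub>U/(F(X))\<close>.\<close>

definition loc_ideal ::
  "('a, 'm) ring_scheme \<Rightarrow> (nat \<Rightarrow> 'a) set \<Rightarrow> (nat \<Rightarrow> 'a) \<Rightarrow>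
     ((nat \<Rightarrow> 'a) \<times> (nat \<Rightarrow> 'a)) set set" where
  "loc_ideal A U F = PIdl\<^bsub>localization (UP A) U\<^esub> (loc_frac (UP A) U F \<one>\<^bsub>UP A\<^esub>)"

definition loc_residue_ring ::
  "('a, 'm) ring_scheme \<Rightarrow> (nat \<Rightarrow> 'a) set \<Rightarrow> (nat \<Rightarrow> 'a) \<Rightarrow>
     ('a, ((nat \<Rightarrow> 'a) \<times> (nat \<Rightarrow> 'a)) set set) module" where
  "loc_residue_ring A U F = quotient_algebra (localization (UP A) U) (loc_ideal A U F)"

definition loc_residue ::
  "('a, 'm) ring_scheme \<Rightarrow> (nat \<Rightarrow> 'a) set \<Rightarrow> (nat \<Rightarrow> 'a) \<Rightarrow> (nat \<Rightarrow> 'a) \<Rightarrow>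
     ((nat \<Rightarrow> 'a) \<times> (nat \<Rightarrow> 'a)) set set" where
  "loc_residue A U F f =
     loc_ideal A U F +>\<^bsub>localization (UP A) U\<^esub> loc_frac (UP A) U f \<one>\<^bsub>UP A\<^esub>"

text \<open>The map induced by \<open>loc_residue\<close> on the classes of \<open>A[X]/(F(X))\<close>, on each of which
  \<open>loc_residue\<close> is constant.\<close>

definition canonical_map ::
  "('a, 'm) ring_scheme \<Rightarrow> (nat \<Rightarrow> 'a) set \<Rightarrow> (nat \<Rightarrow> 'a) \<Rightarrow> (nat \<Rightarrow> 'a) set \<Rightarrow>
     ((nat \<Rightarrow> 'a) \<times> (nat \<Rightarrow> 'a)) set set" where
  "canonical_map A U F C = the_elem (loc_residue A U F ` C)"


section \<open>Tensor powers\<close>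

definition monoid_algebra ::
  "('a, 'm) ring_scheme \<Rightarrow> ('g, 'k) monoid_scheme \<Rightarrow> ('a, 'g \<Rightarrow> 'a) module" where
  "monoid_algebra R G =
    \<lparr>carrier = {f. range f \<subseteq> carrier R \<and> finite {x. f x \<noteq> \<zero>\<^bsub>R\<^esub>} \<and> {x. f x \<noteq> \<zero>\<^bsub>R\<^esub>} \<subseteq> carrier G},
     monoid.mult = (\<lambda>f g x.
       \<Oplus>\<^bsub>R\<^esub>p \<in> {p \<in> {y. f y \<noteq> \<zero>\<^bsub>R\<^esub>} \<times> {z. g z \<noteq> \<zero>\<^bsub>R\<^esub>}. fst p \<otimes>\<^bsub>G\<^esub> snd p = x}.
         f (fst p) \<otimes>\<^bsub>R\<^esub> g (snd p)),
     one = (\<lambda>x. if x = \<one>\<^bsub>G\<^esub> then \<one>\<^bsub>R\<^esub> else \<zero>\<^bsub>R\<^esub>),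
     zero = (\<lambda>_. \<zero>\<^bsub>R\<^esub>),
     add = (\<lambda>f g x. f x \<oplus>\<^bsub>R\<^esub> g x),
     smult = (\<lambda>a f x. a \<otimes>\<^bsub>R\<^esub> f x)\<rparr>"

text \<open>
  The \<open>n\<close>-fold tensor power of an \<open>R\<close>-algebra \<open>B\<close>: the free \<open>R\<close>-module on the \<open>n\<close>-tuples
  (indexed by \<open>{1..n}\<close>) of elements of \<open>B\<close> modulo the relations of \<open>R\<close>-multilinearity. The free
  module is the algebra of the multiplicative monoid of \<open>n\<close>-tuples, so that the product of the
  quotient is \<open>(b\<^sub>1 \<otimes> \<dots> \<otimes> b\<^sub>n)(c\<^sub>1 \<otimes> \<dots> \<otimes> c\<^sub>n) = b\<^sub>1c\<^sub>1 \<otimes> \<dots> \<otimes> b\<^sub>nc\<^sub>n\<close>. A product of a relation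
  with a tuple is again a relation, so the relations span the ideal they generate.
\<close>

definition tuple_algebra ::
  "('a, 'r) ring_scheme \<Rightarrow> ('a, 'b, 'm) module_scheme \<Rightarrow> nat \<Rightarrow>
     ('a, (nat \<Rightarrow> 'b) \<Rightarrow> 'a) module" where
  "tuple_algebra R B n = monoid_algebra R (product_group {1..n} (\<lambda>_. B))"

definition tuple_single ::
  "('a, 'r) ring_scheme \<Rightarrow> (nat \<Rightarrow> 'b) \<Rightarrow> ((nat \<Rightarrow> 'b) \<Rightarrow> 'a)" where
  "tuple_single R t = (\<lambda>x. if x = t then \<one>\<^bsub>R\<^esub> else \<zero>\<^bsub>R\<^esub>)"

definition tensor_relations ::
  "('a, 'r) ring_scheme \<Rightarrow> ('a, 'b, 'm) module_scheme \<Rightarrow> nat \<Rightarrow> ((nat \<Rightarrow> 'b) \<Rightarrow> 'a) set" where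
  "tensor_relations R B n =
    {tuple_single R (t(i := b \<oplus>\<^bsub>B\<^esub> c)) \<ominus>\<^bsub>tuple_algebra R B n\<^esub>
       (tuple_single R (t(i := b)) \<oplus>\<^bsub>tuple_algebra R B n\<^esub> tuple_single R (t(i := c)))
     | t i b c. t \<in> (\<Pi>\<^sub>E j\<in>{1..n}. carrier B) \<and> i \<in> {1..n} \<and> b \<in> carrier B \<and> c \<in> carrier B} \<union>
    {tuple_single R (t(i := a \<odot>\<^bsub>B\<^esub> b)) \<ominus>\<^bsub>tuple_algebra R B n\<^esub>
       (a \<odot>\<^bsub>tuple_algebra R B n\<^esub> tuple_single R (t(i := b)))
     | t i a b. t \<in> (\<Pi>\<^sub>E j\<in>{1..n}. carrier B) \<and> i \<in> {1..n} \<and> a \<in> carrier R \<and> b \<in> carrier B}"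

definition tensor_ideal ::
  "('a, 'r) ring_scheme \<Rightarrow> ('a, 'b, 'm) module_scheme \<Rightarrow> nat \<Rightarrow> ((nat \<Rightarrow> 'b) \<Rightarrow> 'a) set" where
  "tensor_ideal R B n = Idl\<^bsub>tuple_algebra R B n\<^esub> (tensor_relations R B n)"

definition tensor_power ::
  "('a, 'r) ring_scheme \<Rightarrow> ('a, 'b, 'm) module_scheme \<Rightarrow> nat \<Rightarrow>
     ('a, ((nat \<Rightarrow> 'b) \<Rightarrow> 'a) set) module" where
  "tensor_power R B n = quotient_algebra (tuple_algebra R B n) (tensor_ideal R B n)"

definition pure_tensor ::
  "('a, 'r) ring_scheme \<Rightarrow> ('a, 'b, 'm) module_scheme \<Rightarrow> nat \<Rightarrow> (nat \<Rightarrow> 'b) \<Rightarrow>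
     ((nat \<Rightarrow> 'b) \<Rightarrow> 'a) set" where
  "pure_tensor R B n t = tensor_ideal R B n +>\<^bsub>tuple_algebra R B n\<^esub> tuple_single R t"

text \<open>
  For \<open>p\<close> permuting \<open>{1..n}\<close>, the map \<open>\<lambda>f t. f (t \<circ> p)\<close> is the automorphism of the tuple algebra
  that permutes the factors. It preserves \<open>tensor_ideal\<close>, so the automorphism it induces on the
  tensor power sends a coset to its image.
\<close>

definition symmetric_tensors ::
  "('a, 'r) ring_scheme \<Rightarrow> ('a, 'b, 'm) module_scheme \<Rightarrow> nat \<Rightarrow> ((nat \<Rightarrow> 'b) \<Rightarrow> 'a) set set" where
  "symmetric_tensors R B n =
    {C \<in> carrier (tensor_power R B n).
       \<forall>p. p permutes {1..n} \<longrightarrow> (\<lambda>f t. f (t \<circ> p)) ` C = C}"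


section \<open>Norms\<close>

text \<open>
  Over a nonzero ring, \<open>monic_of_degree A F n\<close> says that \<open>deg A F = n\<close> and that the leading
  coefficient is one; over the zero ring, where \<^term>\<open>deg A F = 0\<close>, it holds for all \<open>n\<close>.
\<close>

definition monic_of_degree :: "('a, 'm) ring_scheme \<Rightarrow> (nat \<Rightarrow> 'a) \<Rightarrow> nat \<Rightarrow> bool" where
  "monic_of_degree A F n \<longleftrightarrow>
    F \<in> carrier (UP A) \<and> coeff (UP A) F n = \<one>\<^bsub>A\<^esub> \<and> (\<forall>m>n. coeff (UP A) F m = \<zero>\<^bsub>A\<^esub>)"

definition tensor_var ::
  "('a, 'm) ring_scheme \<Rightarrow> nat \<Rightarrow> nat \<Rightarrow> ((nat \<Rightarrow> (nat \<Rightarrow> 'a)) \<Rightarrow> 'a) set" where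
  "tensor_var A n i =
    pure_tensor A (UP A) n (\<lambda>j\<in>{1..n}. if j = i then monom (UP A) \<one>\<^bsub>A\<^esub> 1 else \<one>\<^bsub>UP A\<^esub>)"

definition elem_sym_tensor ::
  "('a, 'm) ring_scheme \<Rightarrow> nat \<Rightarrow> nat \<Rightarrow> ((nat \<Rightarrow> (nat \<Rightarrow> 'a)) \<Rightarrow> 'a) set" where
  "elem_sym_tensor A n i =
    (\<Oplus>\<^bsub>tensor_power A (UP A) n\<^esub>I \<in> {I. I \<subseteq> {1..n} \<and> card I = i}.
       \<Otimes>\<^bsub>tensor_power A (UP A) n\<^esub>j\<in>I. tensor_var A n j)"

text \<open>\<open>u\<^sub>i\<close> in \<open>F(X) = X\<^sup>n - u\<^sub>1X\<^sup>n\<^sup>-\<^sup>1 + \<dots> + (-1)\<^sup>nu\<^sub>n\<close>\<close>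

definition signed_coeff :: "('a, 'm) ring_scheme \<Rightarrow> (nat \<Rightarrow> 'a) \<Rightarrow> nat \<Rightarrow> nat \<Rightarrow> 'a" where
  "signed_coeff A F n i = ((\<ominus>\<^bsub>A\<^esub> \<one>\<^bsub>A\<^esub>) [^]\<^bsub>A\<^esub> i) \<otimes>\<^bsub>A\<^esub> coeff (UP A) F (n - i)"

definition norm_hom ::
  "('a, 'm) ring_scheme \<Rightarrow> (nat \<Rightarrow> 'a) \<Rightarrow> nat \<Rightarrow> ((nat \<Rightarrow> (nat \<Rightarrow> 'a)) \<Rightarrow> 'a) set \<Rightarrow> 'a" where
  "norm_hom A F n =
    (let T = tensor_power A (UP A) n; S = symmetric_tensors A (UP A) n in
     THE u. u \<in> extensional S \<and> u \<in> ring_hom (T\<lparr>carrier := S\<rparr>) A \<and>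
       (\<forall>a\<in>carrier A. \<forall>x\<in>S. u (a \<odot>\<^bsub>T\<^esub> x) = a \<otimes>\<^bsub>A\<^esub> u x) \<and>
       (\<forall>i\<in>{1..n}. u (elem_sym_tensor A n i) = signed_coeff A F n i))"

definition poly_norm ::
  "('a, 'm) ring_scheme \<Rightarrow> (nat \<Rightarrow> 'a) \<Rightarrow> nat \<Rightarrow> (nat \<Rightarrow> 'a) \<Rightarrow> 'a" where
  "poly_norm A F n f = norm_hom A F n (pure_tensor A (UP A) n (\<lambda>j\<in>{1..n}. f))"

end

theory Submission
  imports Defs
begin

text \<open>
  Write \<open>B = A[X]/(F)\<close>. Division with remainder by the monic polynomial \<open>F\<close> makes \<open>B\<close> a free
  \<open>A\<close>-module with basis \<open>1, X, \<dots>, X\<^sup>n\<^sup>-\<^sup>1\<close>. Each of the three assertions says that every \<open>f \<in> U\<close>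
  is invertible modulo \<open>F\<close>; this is the predicate \<open>unit_mod\<close> below.

  For the first two assertions, consider the map \<open>\<theta>\<close> from \<open>A[X]\<close> to \<open>A[X]\<^sub>U/(F)\<close>. It sends \<open>U\<close> to
  units, every element of the target has the form \<open>\<theta>(s)\<^sup>-\<^sup>1 \<theta>(f)\<close> with \<open>s \<in> U\<close>, and \<open>\<theta>(f) = 0\<close> means
  that \<open>F\<close> divides \<open>s f\<close> for some \<open>s \<in> U\<close>. If the elements of \<open>U\<close> are invertible modulo \<open>F\<close>, then
  \<open>\<theta>\<close> is therefore surjective with kernel \<open>(F)\<close>. Conversely, if \<open>\<theta>\<close> is surjective with kernel \<open>(F)\<close>
  and \<open>s \<in> U\<close>, then the inverse of \<open>\<theta>(s)\<close> is some \<open>\<theta>(g)\<close>, and \<open>s g - 1\<close> lies in the kernel. This gives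
  \<open>canonical_iso_iff_unit_mod\<close> and, as \<open>1, X, \<dots>, X\<^sup>n\<^sup>-\<^sup>1\<close> is a basis of \<open>B\<close>, also \<open>basis_iff_unit_mod\<close>.

  For the third assertion, the norm of \<open>f\<close> is shown to be the determinant of multiplication by \<open>f\<close> on
  \<open>B\<close>, and the adjugate matrix then produces an inverse of \<open>f\<close> modulo \<open>F\<close> from an inverse of the norm
  (\<open>poly_norm_unit_iff\<close>). The point is to describe the homomorphism \<open>u\<^sub>F\<close>. The \<open>n\<close>-fold tensor power of
  \<open>A[X]\<close> acts on that of \<open>B\<close>. A symmetric tensor commutes with the permutations of the factors, so it
  also acts on the \<open>n\<close>-th exterior power of \<open>B\<close>, which is free of rank one; let \<open>ext_det\<close> be the scalar
  by which it acts. Then \<open>ext_det\<close> is an algebra homomorphism (\<open>ext_det_mult\<close>) whose value at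
  \<open>f \<otimes> \<dots> \<otimes> f\<close> is the determinant of multiplication by \<open>f\<close>, and whose value at the elementary symmetric
  function \<open>s\<^sub>i\<close> is \<open>u\<^sub>i\<close>: raising the exponents of \<open>i\<close> of the vectors \<open>1, X, \<dots>, X\<^sup>n\<^sup>-\<^sup>1\<close> by one repeats a
  vector, unless these are the last \<open>i\<close> ones (\<open>ext_det_elem_sym\<close>). Since the elementary symmetric
  functions generate all symmetric tensors (\<open>symmetric_generated\<close>), \<open>ext_det\<close> is \<open>u\<^sub>F\<close>.

  The exterior power itself is not constructed: \<open>ext_det\<close> is an alternating sum of matrix entries of
  the action on the tensor power of \<open>B\<close>, and these entries are values of linear forms on the tensor
  power of \<open>A[X]\<close>.
\<close>

section \<open>Finite sums and products\<close>

lemma (in comm_monoid) finprod_Sigma: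
  assumes "finite A" "\<And>a. a \<in> A \<Longrightarrow> finite (B a)"
    and f: "\<And>a b. a \<in> A \<Longrightarrow> b \<in> B a \<Longrightarrow> f a b \<in> carrier G"
  shows "(\<Otimes>a\<in>A. \<Otimes>b\<in>B a. f a b) = (\<Otimes>p\<in>Sigma A B. f (fst p) (snd p))"
proof -
  have "(\<Otimes>p\<in>(\<Union>a\<in>A. {a} \<times> B a). f (fst p) (snd p))
      = (\<Otimes>a\<in>A. \<Otimes>p\<in>{a} \<times> B a. f (fst p) (snd p))"
    using assms by (intro finprod_UN_disjoint) (auto simp: pairwise_def disjnt_def)
  also have "\<dots> = (\<Otimes>a\<in>A. \<Otimes>b\<in>B a. f a b)"
  proof (rule finprod_cong')
    fix a assume a: "a \<in> A"
    have "(\<Otimes>p\<in>Pair a ` B a. f (fst p) (snd p)) = (\<Otimes>b\<in>B a. f (fst (a, b)) (snd (a, b)))"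
      using f a by (intro finprod_reindex) (auto simp: inj_on_def)
    moreover have "Pair a ` B a = {a} \<times> B a" by auto
    ultimately show "(\<Otimes>p\<in>{a} \<times> B a. f (fst p) (snd p)) = (\<Otimes>b\<in>B a. f a b)" by simp
  qed (use f in \<open>auto intro!: finprod_closed\<close>)
  also have "(\<Union>a\<in>A. {a} \<times> B a) = Sigma A B" by auto
  finally show ?thesis by simp
qed

lemma (in comm_monoid) finprod_swap:
  assumes "finite A" "finite B" "\<And>a b. a \<in> A \<Longrightarrow> b \<in> B \<Longrightarrow> f a b \<in> carrier G"
  shows "(\<Otimes>a\<in>A. \<Otimes>b\<in>B. f a b) = (\<Otimes>b\<in>B. \<Otimes>a\<in>A. f a b)"
proof -
  have "(\<Otimes>p\<in>prod.swap ` (B \<times> A). f (fst p) (snd p))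
      = (\<Otimes>p\<in>B \<times> A. f (fst (prod.swap p)) (snd (prod.swap p)))"
    using assms by (intro finprod_reindex) auto
  moreover have "prod.swap ` (B \<times> A) = A \<times> B" by (simp add: product_swap)
  ultimately show ?thesis
    using assms by (simp add: finprod_Sigma)
qed

lemma (in comm_monoid) finprod_fibres:
  assumes "finite A" "\<And>a. a \<in> A \<Longrightarrow> f a \<in> carrier G"
  shows "(\<Otimes>y\<in>h ` A. \<Otimes>a\<in>{a \<in> A. h a = y}. f a) = (\<Otimes>a\<in>A. f a)"
proof -
  have "(\<Otimes>a\<in>(\<Union>y\<in>h ` A. {a \<in> A. h a = y}). f a) = (\<Otimes>y\<in>h ` A. \<Otimes>a\<in>{a \<in> A. h a = y}. f a)"
    using assms by (intro finprod_UN_disjoint) (auto simp: pairwise_def disjnt_def)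
  moreover have "(\<Union>y\<in>h ` A. {a \<in> A. h a = y}) = A" by auto
  ultimately show ?thesis by simp
qed

lemma (in comm_monoid) finprod_reindex_bij:
  assumes "bij_betw h A B" "\<And>b. b \<in> B \<Longrightarrow> f b \<in> carrier G"
  shows "(\<Otimes>b\<in>B. f b) = (\<Otimes>a\<in>A. f (h a))"
proof -
  have "h ` A = B" "inj_on h A" using assms by (auto simp: bij_betw_def)
  then show ?thesis using finprod_reindex[of f h A] assms by auto
qed

lemma (in comm_monoid) finprod_remove:
  assumes "finite A" "i \<in> A" "\<And>a. a \<in> A \<Longrightarrow> f a \<in> carrier G"
  shows "(\<Otimes>a\<in>A. f a) = f i \<otimes> (\<Otimes>a\<in>A - {i}. f a)"
proof -
  have "finprod G f (insert i (A - {i})) = f i \<otimes> finprod G f (A - {i})"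
    using assms by (intro finprod_insert) auto
  with assms(2) show ?thesis by (simp add: insert_absorb)
qed

text \<open>The functions that pick a member of \<open>I j\<close> for every \<open>j \<in> J\<close> and agree with \<open>d\<close> elsewhere.
  The default \<open>d\<close> varies: exponents vanish outside their index set, permutations fix all else.\<close>

definition choices :: "'i set \<Rightarrow> ('i \<Rightarrow> 'b set) \<Rightarrow> ('i \<Rightarrow> 'b) \<Rightarrow> ('i \<Rightarrow> 'b) set" where
  "choices J I d = {h. (\<forall>j\<in>J. h j \<in> I j) \<and> (\<forall>j. j \<notin> J \<longrightarrow> h j = d j)}"

lemma choices_empty: "choices {} I d = {d}"
  by (auto simp: choices_def)

lemma choices_insert:
  assumes "j \<notin> J"
  shows "bij_betw (\<lambda>(i, h). h(j := i)) (I j \<times> choices J I d) (choices (insert j J) I d)"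
proof (rule bij_betw_byWitness[where f' = "\<lambda>h. (h j, h(j := d j))"])
  show "(\<lambda>(i, h). h(j := i)) ` (I j \<times> choices J I d) \<subseteq> choices (insert j J) I d"
    using assms by (auto simp: choices_def)
qed (use assms in \<open>auto simp: choices_def\<close>)

lemma finite_choices: "finite J \<Longrightarrow> (\<And>j. j \<in> J \<Longrightarrow> finite (I j)) \<Longrightarrow> finite (choices J I d)"
proof (induction J rule: finite_induct)
  case (insert j J)
  then show ?case
    using bij_betw_finite[OF choices_insert[of j J I d]] by auto
qed (simp add: choices_empty)

lemma (in cring) finprod_finsum:
  assumes "finite J" "\<And>j. j \<in> J \<Longrightarrow> finite (I j)"
    and "\<And>j i. j \<in> J \<Longrightarrow> i \<in> I j \<Longrightarrow> a j i \<in> carrier R"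
  shows "(\<Otimes>j\<in>J. \<Oplus>i\<in>I j. a j i) = (\<Oplus>h\<in>choices J I d. \<Otimes>j\<in>J. a j (h j))"
  using assms
proof (induction J rule: finite_induct)
  case empty
  then show ?case by (simp add: choices_empty)
next
  case (insert j J)
  let ?C = "choices J I d"
  have fin: "finite ?C" "finite (I j)" using insert by (auto intro: finite_choices)
  have mem: "h i \<in> I i" if "h \<in> ?C" "i \<in> J" for h i using that by (auto simp: choices_def)
  have cl: "(\<Otimes>i\<in>J. a i (h i)) \<in> carrier R" if "h \<in> ?C" for h
    using insert.prems mem that by (auto intro!: finprod_closed)
  have "(\<Otimes>i\<in>insert j J. \<Oplus>k\<in>I i. a i k)
      = (\<Oplus>k\<in>I j. a j k) \<otimes> (\<Otimes>i\<in>J. \<Oplus>k\<in>I i. a i k)"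
    using insert by (intro finprod_insert) (auto intro!: finsum_closed)
  also have "\<dots> = (\<Oplus>k\<in>I j. a j k) \<otimes> (\<Oplus>h\<in>?C. \<Otimes>i\<in>J. a i (h i))"
    using insert by simp
  also have "\<dots> = (\<Oplus>k\<in>I j. \<Oplus>h\<in>?C. a j k \<otimes> (\<Otimes>i\<in>J. a i (h i)))"
  proof -
    have "(\<Oplus>k\<in>I j. a j k) \<otimes> (\<Oplus>h\<in>?C. \<Otimes>i\<in>J. a i (h i))
        = (\<Oplus>k\<in>I j. a j k \<otimes> (\<Oplus>h\<in>?C. \<Otimes>i\<in>J. a i (h i)))"
      using insert.prems cl fin by (intro finsum_ldistr) (auto intro!: finsum_closed)
    also have "\<dots> = (\<Oplus>k\<in>I j. \<Oplus>h\<in>?C. a j k \<otimes> (\<Otimes>i\<in>J. a i (h i)))"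
      using insert.prems cl fin by (intro finsum_cong' finsum_rdistr) (auto intro!: finsum_closed)
    finally show ?thesis .
  qed
  also have "\<dots> = (\<Oplus>p\<in>I j \<times> ?C. a j (fst p) \<otimes> (\<Otimes>i\<in>J. a i (snd p i)))"
    using insert.prems cl fin by (subst add.finprod_Sigma) auto
  also have "\<dots> = (\<Oplus>p\<in>I j \<times> ?C. \<Otimes>i\<in>insert j J. a i (((snd p)(j := fst p)) i))"
  proof (rule add.finprod_cong')
    fix p assume p: "p \<in> I j \<times> ?C"
    have "(\<Otimes>i\<in>insert j J. a i (((snd p)(j := fst p)) i))
        = a j (fst p) \<otimes> (\<Otimes>i\<in>J. a i (((snd p)(j := fst p)) i))"
      using insert p mem by (subst finprod_insert) auto
    also have "(\<Otimes>i\<in>J. a i (((snd p)(j := fst p)) i)) = (\<Otimes>i\<in>J. a i (snd p i))"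
      using insert p mem by (intro finprod_cong') auto
    finally show "a j (fst p) \<otimes> (\<Otimes>i\<in>J. a i (snd p i))
        = (\<Otimes>i\<in>insert j J. a i (((snd p)(j := fst p)) i))" by simp
  next
    show "(\<lambda>p. \<Otimes>i\<in>insert j J. a i (((snd p)(j := fst p)) i)) \<in> I j \<times> ?C \<rightarrow> carrier R"
      using insert.prems mem by (auto intro!: finprod_closed)
  qed simp
  also have "\<dots> = (\<Oplus>h\<in>choices (insert j J) I d. \<Otimes>i\<in>insert j J. a i (h i))"
    using insert.prems
    by (subst add.finprod_reindex_bij[OF choices_insert[OF insert.hyps(2)]])
      (auto simp: case_prod_beta choices_def intro!: finprod_closed)
  finally show ?case .
qed

lemma (in cring) finprod_zero:
  assumes "finite J" "j \<in> J" "f j = \<zero>" "\<And>i. i \<in> J \<Longrightarrow> f i \<in> carrier R"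
  shows "(\<Otimes>i\<in>J. f i) = \<zero>"
  using assms by (subst finprod_remove[of _ j]) (auto intro!: l_null finprod_closed)

lemma (in abelian_monoid) finsum_single:
  assumes "i \<in> A" "finite A" "f i \<in> carrier G" "\<And>j. j \<in> A \<Longrightarrow> j \<noteq> i \<Longrightarrow> f j = \<zero>"
  shows "finsum G f A = f i"
proof -
  have cl: "\<And>a. a \<in> A \<Longrightarrow> f a \<in> carrier G" using assms by (metis zero_closed)
  have "finsum G f A = f i \<oplus> finsum G f (A - {i})"
    using assms cl by (intro add.finprod_remove) auto
  also have "finsum G f (A - {i}) = \<zero>"
    using assms by (intro add.finprod_one_eqI) auto
  finally show ?thesis using assms by simp
qed

section \<open>Monoid algebras\<close>

text \<open>The value at \<open>f\<close> of the linear form that extends the function \<open>w\<close> on the monoid. These linear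
  forms separate the elements of the algebra, and forms on its residue algebras come from them.\<close>

definition pairing :: "('a, 'm) ring_scheme \<Rightarrow> ('g \<Rightarrow> 'a) \<Rightarrow> ('g \<Rightarrow> 'a) \<Rightarrow> 'a" where
  "pairing R f w = (\<Oplus>\<^bsub>R\<^esub>x\<in>{x. f x \<noteq> \<zero>\<^bsub>R\<^esub>}. f x \<otimes>\<^bsub>R\<^esub> w x)"

locale monoid_ring = R?: cring R + G?: comm_monoid G for R (structure) and G (structure) +
  fixes M (structure)
  defines M_def: "M \<equiv> monoid_algebra R G"
begin

lemma carrier_iff:
  "f \<in> carrier M \<longleftrightarrow> (\<forall>x. f x \<in> carrier R) \<and> finite {x. f x \<noteq> \<zero>} \<and> (\<forall>x. f x \<noteq> \<zero> \<longrightarrow> x \<in> carrier G)"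
  by (auto simp: M_def monoid_algebra_def)

lemma add_eq: "f \<oplus>\<^bsub>M\<^esub> g = (\<lambda>x. f x \<oplus> g x)"
  and zero_eq: "\<zero>\<^bsub>M\<^esub> = (\<lambda>x. \<zero>)"
  and one_eq: "\<one>\<^bsub>M\<^esub> = (\<lambda>x. if x = \<one>\<^bsub>G\<^esub> then \<one> else \<zero>)"
  and smult_eq: "a \<odot>\<^bsub>M\<^esub> f = (\<lambda>x. a \<otimes> f x)"
  by (auto simp: M_def monoid_algebra_def)

lemma pairing_eq:
  assumes "f \<in> carrier M" "w \<in> carrier G \<rightarrow> carrier R" "finite P" "{x. f x \<noteq> \<zero>} \<subseteq> P" "P \<subseteq> carrier G"
  shows "pairing R f w = (\<Oplus>x\<in>P. f x \<otimes> w x)"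
  unfolding pairing_def using assms
  by (intro add.finprod_mono_neutral_cong_left) (auto simp: carrier_iff Pi_iff subset_iff)

lemma pairing_closed:
  assumes "f \<in> carrier M" "w \<in> carrier G \<rightarrow> carrier R"
  shows "pairing R f w \<in> carrier R"
  unfolding pairing_def using assms by (intro finsum_closed) (auto simp: carrier_iff Pi_iff)

lemma pairing_cong:
  assumes "f \<in> carrier M" "w' \<in> carrier G \<rightarrow> carrier R" "\<And>x. x \<in> carrier G \<Longrightarrow> w x = w' x"
  shows "pairing R f w = pairing R f w'"
  unfolding pairing_def using assms by (intro finsum_cong') (auto simp: carrier_iff Pi_iff)

lemma single_closed:
  "x \<in> carrier G \<Longrightarrow> (\<lambda>y. if y = x then \<one> else \<zero>) \<in> carrier M"
  by (auto simp: carrier_iff)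

lemma pairing_single:
  assumes "x \<in> carrier G" "w \<in> carrier G \<rightarrow> carrier R"
  shows "pairing R (\<lambda>y. if y = x then \<one> else \<zero>) w = w x"
proof -
  have "pairing R (\<lambda>y. if y = x then \<one> else \<zero>) w = (\<Oplus>y\<in>{x}. (if y = x then \<one> else \<zero>) \<otimes> w y)"
    using assms by (intro pairing_eq single_closed) auto
  then show ?thesis using assms by (auto simp: Pi_iff)
qed

lemma add_closed: "f \<in> carrier M \<Longrightarrow> g \<in> carrier M \<Longrightarrow> f \<oplus>\<^bsub>M\<^esub> g \<in> carrier M"
  unfolding carrier_iff add_eq
  by (auto intro!: finite_subset[of "{x. f x \<oplus> g x \<noteq> \<zero>}" "{x. f x \<noteq> \<zero>} \<union> {x. g x \<noteq> \<zero>}"]) force+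

lemma smult_closed': "a \<in> carrier R \<Longrightarrow> f \<in> carrier M \<Longrightarrow> a \<odot>\<^bsub>M\<^esub> f \<in> carrier M"
  unfolding carrier_iff smult_eq
  by (auto intro!: finite_subset[of "{x. a \<otimes> f x \<noteq> \<zero>}" "{x. f x \<noteq> \<zero>}"]) force+

lemma pairing_add:
  assumes "f \<in> carrier M" "g \<in> carrier M" "w \<in> carrier G \<rightarrow> carrier R"
  shows "pairing R (f \<oplus>\<^bsub>M\<^esub> g) w = pairing R f w \<oplus> pairing R g w"
proof -
  let ?P = "{x. f x \<noteq> \<zero>} \<union> {x. g x \<noteq> \<zero>}"
  have P: "finite ?P" "?P \<subseteq> carrier G" using assms by (auto simp: carrier_iff)
  have v: "f x \<in> carrier R" "g x \<in> carrier R" "x \<in> ?P \<Longrightarrow> w x \<in> carrier R" for x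
    using assms P by (auto simp: carrier_iff Pi_iff)
  have "pairing R (f \<oplus>\<^bsub>M\<^esub> g) w = (\<Oplus>x\<in>?P. (f x \<oplus> g x) \<otimes> w x)"
    using P assms by (subst pairing_eq[where P = ?P]) (auto simp: add_closed, auto simp: add_eq)
  also have "\<dots> = (\<Oplus>x\<in>?P. f x \<otimes> w x \<oplus> g x \<otimes> w x)"
    using v by (intro finsum_cong') (auto simp: l_distr)
  also have "\<dots> = (\<Oplus>x\<in>?P. f x \<otimes> w x) \<oplus> (\<Oplus>x\<in>?P. g x \<otimes> w x)"
    using v by (intro finsum_addf) auto
  also have "\<dots> = pairing R f w \<oplus> pairing R g w"
    using P assms by (subst (1 2) pairing_eq[where P = ?P]) auto
  finally show ?thesis .
qed

lemma pairing_smult: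
  assumes "f \<in> carrier M" "a \<in> carrier R" "w \<in> carrier G \<rightarrow> carrier R"
  shows "pairing R (a \<odot>\<^bsub>M\<^esub> f) w = a \<otimes> pairing R f w"
proof -
  let ?P = "{x. f x \<noteq> \<zero>}"
  have P: "finite ?P" "?P \<subseteq> carrier G" using assms by (auto simp: carrier_iff)
  have v: "f x \<in> carrier R" "x \<in> ?P \<Longrightarrow> w x \<in> carrier R" for x
    using assms P by (auto simp: carrier_iff Pi_iff)
  have "pairing R (a \<odot>\<^bsub>M\<^esub> f) w = (\<Oplus>x\<in>?P. (a \<otimes> f x) \<otimes> w x)"
    using P assms by (subst pairing_eq[where P = ?P]) (auto simp: smult_closed', auto simp: smult_eq)
  also have "\<dots> = (\<Oplus>x\<in>?P. a \<otimes> (f x \<otimes> w x))"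
    using v assms by (intro finsum_cong') (auto simp: R.m_assoc)
  also have "\<dots> = a \<otimes> pairing R f w"
    unfolding pairing_def using v P assms by (subst finsum_rdistr) auto
  finally show ?thesis .
qed

lemma pairing_swap:
  assumes "f \<in> carrier M" "g \<in> carrier M" "\<And>x y. x \<in> carrier G \<Longrightarrow> y \<in> carrier G \<Longrightarrow> w x y \<in> carrier R"
  shows "pairing R f (\<lambda>x. pairing R g (\<lambda>y. w x y)) = pairing R g (\<lambda>y. pairing R f (\<lambda>x. w x y))"
proof -
  let ?P = "{x. f x \<noteq> \<zero>}" and ?Q = "{x. g x \<noteq> \<zero>}"
  have P: "finite ?P" "?P \<subseteq> carrier G" "finite ?Q" "?Q \<subseteq> carrier G"
    using assms by (auto simp: carrier_iff)
  have v: "f x \<in> carrier R" "g y \<in> carrier R" "x \<in> ?P \<Longrightarrow> y \<in> ?Q \<Longrightarrow> w x y \<in> carrier R" for x y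
    using assms P by (auto simp: carrier_iff)
  have "pairing R f (\<lambda>x. pairing R g (\<lambda>y. w x y)) = (\<Oplus>x\<in>?P. \<Oplus>y\<in>?Q. f x \<otimes> (g y \<otimes> w x y))"
    unfolding pairing_def using v P
    by (intro finsum_cong' finsum_rdistr) (auto intro!: finsum_closed)
  also have "\<dots> = (\<Oplus>y\<in>?Q. \<Oplus>x\<in>?P. f x \<otimes> (g y \<otimes> w x y))"
    using v P by (intro add.finprod_swap) auto
  also have "\<dots> = (\<Oplus>y\<in>?Q. \<Oplus>x\<in>?P. g y \<otimes> (f x \<otimes> w x y))"
    using v P by (intro finsum_cong') (auto intro!: finsum_closed finsum_cong' simp: R.m_lcomm)
  also have "\<dots> = pairing R g (\<lambda>y. pairing R f (\<lambda>x. w x y))"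
    unfolding pairing_def using v P
    by (intro finsum_cong' finsum_rdistr[symmetric]) (auto intro!: finsum_closed)
  finally show ?thesis .
qed

lemma mult_eq:
  "f \<otimes>\<^bsub>M\<^esub> g = (\<lambda>x. \<Oplus>p\<in>{p \<in> {y. f y \<noteq> \<zero>} \<times> {z. g z \<noteq> \<zero>}. fst p \<otimes>\<^bsub>G\<^esub> snd p = x}. f (fst p) \<otimes> g (snd p))"
  by (simp add: M_def monoid_algebra_def)

lemma mult_closed':
  assumes "f \<in> carrier M" "g \<in> carrier M" shows "f \<otimes>\<^bsub>M\<^esub> g \<in> carrier M"
proof -
  let ?Z = "(\<lambda>p. fst p \<otimes>\<^bsub>G\<^esub> snd p) ` ({y. f y \<noteq> \<zero>} \<times> {z. g z \<noteq> \<zero>})"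
  have Z: "finite ?Z" "?Z \<subseteq> carrier G" using assms by (auto simp: carrier_iff)
  have "{p \<in> {y. f y \<noteq> \<zero>} \<times> {z. g z \<noteq> \<zero>}. fst p \<otimes>\<^bsub>G\<^esub> snd p = x} = {}" if "x \<notin> ?Z" for x
    using that by blast
  then have "{x. (f \<otimes>\<^bsub>M\<^esub> g) x \<noteq> \<zero>} \<subseteq> ?Z"
    unfolding mult_eq by (smt (verit) finsum_empty mem_Collect_eq subsetI)
  moreover have "(f \<otimes>\<^bsub>M\<^esub> g) x \<in> carrier R" for x
    unfolding mult_eq using assms by (intro finsum_closed) (auto simp: carrier_iff)
  ultimately show ?thesis unfolding carrier_iff using Z by (auto intro: finite_subset)
qed

text \<open>The convolution product is dual to the comultiplication of functions on the monoid. As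
  elements are determined by their pairings, this reduces the ring axioms to those of the monoid.\<close>

lemma pairing_mult:
  assumes "f \<in> carrier M" "g \<in> carrier M" "w \<in> carrier G \<rightarrow> carrier R"
  shows "pairing R (f \<otimes>\<^bsub>M\<^esub> g) w = pairing R f (\<lambda>x. pairing R g (\<lambda>y. w (x \<otimes>\<^bsub>G\<^esub> y)))"
proof -
  let ?P = "{x. f x \<noteq> \<zero>}" and ?Q = "{x. g x \<noteq> \<zero>}"
  let ?m = "\<lambda>p. fst p \<otimes>\<^bsub>G\<^esub> snd p"
  let ?Z = "?m ` (?P \<times> ?Q)"
  have P: "finite ?P" "?P \<subseteq> carrier G" "finite ?Q" "?Q \<subseteq> carrier G"
    using assms by (auto simp: carrier_iff)
  have v: "f x \<in> carrier R" "g y \<in> carrier R" "x \<in> ?P \<Longrightarrow> y \<in> ?Q \<Longrightarrow> w (x \<otimes>\<^bsub>G\<^esub> y) \<in> carrier R" for x y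
    using assms P by (auto simp: carrier_iff)
  have Z: "finite ?Z" "?Z \<subseteq> carrier G" using P by (auto simp: subset_iff)
  have "{p \<in> ?P \<times> ?Q. ?m p = x} = {}" if "x \<notin> ?Z" for x using that by blast
  then have s: "{x. (f \<otimes>\<^bsub>M\<^esub> g) x \<noteq> \<zero>} \<subseteq> ?Z"
    unfolding mult_eq by (smt (verit) finsum_empty mem_Collect_eq subsetI)
  have "pairing R (f \<otimes>\<^bsub>M\<^esub> g) w = (\<Oplus>x\<in>?Z. (f \<otimes>\<^bsub>M\<^esub> g) x \<otimes> w x)"
    using Z s assms by (intro pairing_eq mult_closed') auto
  also have "\<dots> = (\<Oplus>x\<in>?Z. \<Oplus>p\<in>{p \<in> ?P \<times> ?Q. ?m p = x}. f (fst p) \<otimes> (g (snd p) \<otimes> w (?m p)))"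
  proof (rule finsum_cong')
    fix x assume x: "x \<in> ?Z"
    then have wx: "w x \<in> carrier R" using Z assms by auto
    have "(f \<otimes>\<^bsub>M\<^esub> g) x \<otimes> w x = (\<Oplus>p\<in>{p \<in> ?P \<times> ?Q. ?m p = x}. f (fst p) \<otimes> g (snd p) \<otimes> w x)"
      unfolding mult_eq using P v wx by (intro finsum_ldistr) auto
    also have "\<dots> = (\<Oplus>p\<in>{p \<in> ?P \<times> ?Q. ?m p = x}. f (fst p) \<otimes> (g (snd p) \<otimes> w (?m p)))"
      using v wx by (intro finsum_cong') (auto simp: R.m_assoc)
    finally show "(f \<otimes>\<^bsub>M\<^esub> g) x \<otimes> w x = \<dots>" .
  qed (use v in \<open>auto intro!: finsum_closed\<close>)
  also have "\<dots> = (\<Oplus>p\<in>?P \<times> ?Q. f (fst p) \<otimes> (g (snd p) \<otimes> w (?m p)))"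
    using P v by (intro add.finprod_fibres) auto
  also have "\<dots> = (\<Oplus>x\<in>?P. \<Oplus>y\<in>?Q. f x \<otimes> (g y \<otimes> w (x \<otimes>\<^bsub>G\<^esub> y)))"
    using P v by (subst add.finprod_Sigma) auto
  also have "\<dots> = pairing R f (\<lambda>x. pairing R g (\<lambda>y. w (x \<otimes>\<^bsub>G\<^esub> y)))"
    unfolding pairing_def using v P
    by (intro finsum_cong' finsum_rdistr[symmetric]) (auto intro!: finsum_closed)
  finally show ?thesis .
qed

lemma pairing_ext:
  assumes "f \<in> carrier M" "g \<in> carrier M"
    and "\<And>w. w \<in> carrier G \<rightarrow> carrier R \<Longrightarrow> pairing R f w = pairing R g w"
  shows "f = g"
proof
  fix x
  show "f x = g x"
  proof (cases "x \<in> carrier G")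
    case True
    have "pairing R h (\<lambda>y. if y = x then \<one> else \<zero>) = h x" if h: "h \<in> carrier M" for h
    proof -
      have "pairing R h (\<lambda>y. if y = x then \<one> else \<zero>)
          = (\<Oplus>y\<in>insert x {y. h y \<noteq> \<zero>}. h y \<otimes> (if y = x then \<one> else \<zero>))"
        using True h by (intro pairing_eq) (auto simp: carrier_iff)
      also have "\<dots> = h x \<otimes> (if x = x then \<one> else \<zero>)"
        using h by (intro finsum_single) (auto simp: carrier_iff)
      finally show ?thesis using h by (auto simp: carrier_iff)
    qed
    from this[OF assms(1)] this[OF assms(2)] show ?thesis
      using assms(3)[of "\<lambda>y. if y = x then \<one> else \<zero>"] by simp
  next
    case False
    then show ?thesis using assms(1,2) unfolding carrier_iff by metis
  qed
qed

lemma algebra: "algebra R M"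
proof -
  have z: "\<zero>\<^bsub>M\<^esub> \<in> carrier M" by (auto simp: carrier_iff zero_eq)
  have o: "\<one>\<^bsub>M\<^esub> \<in> carrier M" unfolding one_eq by (rule single_closed) simp
  have cl: "(\<lambda>x. pairing R g (\<lambda>y. w (x \<otimes>\<^bsub>G\<^esub> y))) \<in> carrier G \<rightarrow> carrier R"
    if "g \<in> carrier M" "w \<in> carrier G \<rightarrow> carrier R" for g w
    using that by (auto intro!: pairing_closed)
  have ab: "abelian_group M"
  proof (rule abelian_groupI)
    fix x assume x: "x \<in> carrier M"
    have "(\<ominus> \<one>) \<odot>\<^bsub>M\<^esub> x \<oplus>\<^bsub>M\<^esub> x = \<zero>\<^bsub>M\<^esub>"
      using x by (auto simp: add_eq smult_eq zero_eq carrier_iff l_minus l_neg)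
    then show "\<exists>y\<in>carrier M. y \<oplus>\<^bsub>M\<^esub> x = \<zero>\<^bsub>M\<^esub>"
      using smult_closed'[OF _ x, of "\<ominus> \<one>"] by blast
  qed (auto simp: add_closed z, auto simp: add_eq zero_eq carrier_iff a_ac)
  have assoc: "f \<otimes>\<^bsub>M\<^esub> g \<otimes>\<^bsub>M\<^esub> h = f \<otimes>\<^bsub>M\<^esub> (g \<otimes>\<^bsub>M\<^esub> h)"
    if "f \<in> carrier M" "g \<in> carrier M" "h \<in> carrier M" for f g h
  proof (rule pairing_ext)
    fix w assume w: "w \<in> carrier G \<rightarrow> carrier R"
    have "pairing R (f \<otimes>\<^bsub>M\<^esub> g \<otimes>\<^bsub>M\<^esub> h) w
       = pairing R f (\<lambda>x. pairing R g (\<lambda>y. pairing R h (\<lambda>z. w (x \<otimes>\<^bsub>G\<^esub> y \<otimes>\<^bsub>G\<^esub> z))))"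
      using that w by (simp add: pairing_mult mult_closed' cl)
    also have "\<dots> = pairing R f (\<lambda>x. pairing R g (\<lambda>y. pairing R h (\<lambda>z. w (x \<otimes>\<^bsub>G\<^esub> (y \<otimes>\<^bsub>G\<^esub> z)))))"
      using that w by (intro pairing_cong) (auto intro!: pairing_closed simp: G.m_assoc)
    also have "\<dots> = pairing R (f \<otimes>\<^bsub>M\<^esub> (g \<otimes>\<^bsub>M\<^esub> h)) w"
    proof -
      have "pairing R (g \<otimes>\<^bsub>M\<^esub> h) (\<lambda>y. w (x \<otimes>\<^bsub>G\<^esub> y))
         = pairing R g (\<lambda>y. pairing R h (\<lambda>z. w (x \<otimes>\<^bsub>G\<^esub> (y \<otimes>\<^bsub>G\<^esub> z))))" if "x \<in> carrier G" for x
        using that w \<open>g \<in> carrier M\<close> \<open>h \<in> carrier M\<close> by (intro pairing_mult) auto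
      then show ?thesis
        using that w by (simp add: pairing_mult mult_closed')
          (intro pairing_cong, auto intro!: pairing_closed mult_closed')
    qed
    finally show "pairing R (f \<otimes>\<^bsub>M\<^esub> g \<otimes>\<^bsub>M\<^esub> h) w = pairing R (f \<otimes>\<^bsub>M\<^esub> (g \<otimes>\<^bsub>M\<^esub> h)) w" .
  qed (use that in \<open>auto intro: mult_closed'\<close>)
  have comm: "f \<otimes>\<^bsub>M\<^esub> g = g \<otimes>\<^bsub>M\<^esub> f" if "f \<in> carrier M" "g \<in> carrier M" for f g
  proof (rule pairing_ext)
    fix w assume w: "w \<in> carrier G \<rightarrow> carrier R"
    have "pairing R (f \<otimes>\<^bsub>M\<^esub> g) w = pairing R g (\<lambda>y. pairing R f (\<lambda>x. w (x \<otimes>\<^bsub>G\<^esub> y)))"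
      using that w by (simp add: pairing_mult) (rule pairing_swap, auto)
    also have "\<dots> = pairing R g (\<lambda>y. pairing R f (\<lambda>x. w (y \<otimes>\<^bsub>G\<^esub> x)))"
      using that w by (intro pairing_cong) (auto intro!: pairing_closed simp: G.m_comm)
    finally show "pairing R (f \<otimes>\<^bsub>M\<^esub> g) w = pairing R (g \<otimes>\<^bsub>M\<^esub> f) w"
      using that w by (simp add: pairing_mult)
  qed (use that in \<open>auto intro: mult_closed'\<close>)
  have one: "\<one>\<^bsub>M\<^esub> \<otimes>\<^bsub>M\<^esub> f = f" if "f \<in> carrier M" for f
  proof (rule pairing_ext)
    fix w assume w: "w \<in> carrier G \<rightarrow> carrier R"
    have "pairing R (\<one>\<^bsub>M\<^esub> \<otimes>\<^bsub>M\<^esub> f) w = pairing R \<one>\<^bsub>M\<^esub> (\<lambda>x. pairing R f (\<lambda>y. w (x \<otimes>\<^bsub>G\<^esub> y)))"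
      using that w o by (simp add: pairing_mult)
    also have "\<dots> = pairing R f (\<lambda>y. w (\<one>\<^bsub>G\<^esub> \<otimes>\<^bsub>G\<^esub> y))"
      unfolding one_eq using that w by (intro pairing_single) (auto intro!: pairing_closed)
    also have "\<dots> = pairing R f w" using that w by (intro pairing_cong) auto
    finally show "pairing R (\<one>\<^bsub>M\<^esub> \<otimes>\<^bsub>M\<^esub> f) w = pairing R f w" .
  qed (use that o in \<open>auto intro: mult_closed'\<close>)
  have distr: "(f \<oplus>\<^bsub>M\<^esub> g) \<otimes>\<^bsub>M\<^esub> h = f \<otimes>\<^bsub>M\<^esub> h \<oplus>\<^bsub>M\<^esub> g \<otimes>\<^bsub>M\<^esub> h"
    if "f \<in> carrier M" "g \<in> carrier M" "h \<in> carrier M" for f g h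
    by (rule pairing_ext) (use that in \<open>auto simp: pairing_mult pairing_add mult_closed' add_closed cl\<close>)
  have assoc2: "(a \<odot>\<^bsub>M\<^esub> f) \<otimes>\<^bsub>M\<^esub> g = a \<odot>\<^bsub>M\<^esub> (f \<otimes>\<^bsub>M\<^esub> g)"
    if "a \<in> carrier R" "f \<in> carrier M" "g \<in> carrier M" for a f g
    by (rule pairing_ext) (use that in \<open>auto simp: pairing_mult pairing_smult mult_closed' smult_closed' cl\<close>)
  have cring: "cring M"
    by (rule cringI) (auto intro!: comm_monoidI ab assoc comm simp: mult_closed' o one distr)
  show ?thesis
    by (rule algebraI) (auto intro: R.cring_axioms cring assoc2 simp: smult_closed',
      auto simp: smult_eq add_eq l_distr r_distr R.m_assoc carrier_iff)
qed

end

section \<open>Residue algebras\<close>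

text \<open>The ring axioms do not see the scalar multiplication, which is what distinguishes a residue algebra
  from the factor ring.\<close>

lemma cring_cong:
  assumes "cring K" "carrier L = carrier K" "(\<otimes>\<^bsub>L\<^esub>) = (\<otimes>\<^bsub>K\<^esub>)" "\<one>\<^bsub>L\<^esub> = \<one>\<^bsub>K\<^esub>" "\<zero>\<^bsub>L\<^esub> = \<zero>\<^bsub>K\<^esub>" "(\<oplus>\<^bsub>L\<^esub>) = (\<oplus>\<^bsub>K\<^esub>)"
  shows "cring L"
proof -
  interpret K: cring K by fact
  show ?thesis
    by (rule cringI; (rule abelian_groupI comm_monoidI)?; simp add: assms(2-)
      K.a_ac K.m_ac K.l_distr K.r_distr K.add.l_inv_ex)
qed

context
  fixes R :: "('a, 'r) ring_scheme" and B :: "('a, 'b, 'm) module_scheme" and I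
  assumes alg: "algebra R B" and ideal: "ideal I B"
begin

interpretation algebra R B by (fact alg)
interpretation ideal I B by (fact ideal)

lemma quotient_algebra_carrier:
  "carrier (quotient_algebra B I) = (\<lambda>x. I +>\<^bsub>B\<^esub> x) ` carrier B"
  by (auto simp: quotient_algebra_def FactRing_def A_RCOSETS_def RCOSETS_def a_r_coset_def)

lemma quotient_algebra_mult:
  "x \<in> carrier B \<Longrightarrow> y \<in> carrier B \<Longrightarrow>
   (I +>\<^bsub>B\<^esub> x) \<otimes>\<^bsub>quotient_algebra B I\<^esub> (I +>\<^bsub>B\<^esub> y) = I +>\<^bsub>B\<^esub> (x \<otimes>\<^bsub>B\<^esub> y)"
  by (simp add: quotient_algebra_def FactRing_def rcoset_mult_add)

lemma quotient_algebra_add: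
  "x \<in> carrier B \<Longrightarrow> y \<in> carrier B \<Longrightarrow>
   (I +>\<^bsub>B\<^esub> x) \<oplus>\<^bsub>quotient_algebra B I\<^esub> (I +>\<^bsub>B\<^esub> y) = I +>\<^bsub>B\<^esub> (x \<oplus>\<^bsub>B\<^esub> y)"
  by (simp add: quotient_algebra_def FactRing_def a_rcos_sum)

lemma quotient_algebra_one: "\<one>\<^bsub>quotient_algebra B I\<^esub> = I +>\<^bsub>B\<^esub> \<one>\<^bsub>B\<^esub>"
  by (simp add: quotient_algebra_def FactRing_def)

lemma quotient_algebra_zero: "\<zero>\<^bsub>quotient_algebra B I\<^esub> = I +>\<^bsub>B\<^esub> \<zero>\<^bsub>B\<^esub>"
  by (simp add: quotient_algebra_def FactRing_def)
    (metis M.a_coset_add_zero a_subset)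

lemma coset_eq_iff:
  "x \<in> carrier B \<Longrightarrow> y \<in> carrier B \<Longrightarrow> I +>\<^bsub>B\<^esub> x = I +>\<^bsub>B\<^esub> y \<longleftrightarrow> x \<ominus>\<^bsub>B\<^esub> y \<in> I"
  using quotient_eq_iff_same_a_r_cos[OF ideal] by blast

lemma coset_mem_iff:
  assumes "x \<in> carrier B" shows "y \<in> I +>\<^bsub>B\<^esub> x \<longleftrightarrow> y \<in> carrier B \<and> I +>\<^bsub>B\<^esub> y = I +>\<^bsub>B\<^esub> x"
  using assms a_elemrcos_carrier[of x y] a_repr_independence'[of y x]
    a_repr_independenceD[of y x] by auto

text \<open>An ideal of an algebra is stable under scalars because \<open>a x = (a 1) x\<close>. So the cosets in the union
  that defines the scalar multiplication all coincide.\<close>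

lemma quotient_algebra_smult:
  assumes "a \<in> carrier R" "x \<in> carrier B"
  shows "a \<odot>\<^bsub>quotient_algebra B I\<^esub> (I +>\<^bsub>B\<^esub> x) = I +>\<^bsub>B\<^esub> (a \<odot>\<^bsub>B\<^esub> x)"
proof -
  have eq: "I +>\<^bsub>B\<^esub> (a \<odot>\<^bsub>B\<^esub> y) = I +>\<^bsub>B\<^esub> (a \<odot>\<^bsub>B\<^esub> x)" if "y \<in> I +>\<^bsub>B\<^esub> x" for y
  proof -
    have y: "y \<in> carrier B" "y \<ominus>\<^bsub>B\<^esub> x \<in> I"
      using that assms coset_mem_iff[of x y] coset_eq_iff[of y x] by simp_all
    have "a \<odot>\<^bsub>B\<^esub> y \<ominus>\<^bsub>B\<^esub> a \<odot>\<^bsub>B\<^esub> x = a \<odot>\<^bsub>B\<^esub> (y \<ominus>\<^bsub>B\<^esub> x)"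
      using assms y by (simp add: M.minus_eq smult_r_distr smult_r_minus)
    also have "\<dots> = (a \<odot>\<^bsub>B\<^esub> \<one>\<^bsub>B\<^esub>) \<otimes>\<^bsub>B\<^esub> (y \<ominus>\<^bsub>B\<^esub> x)"
      using assms y by (simp add: smult_assoc2)
    also have "\<dots> \<in> I" using assms y by (intro I_l_closed) auto
    finally show ?thesis using assms y by (simp add: coset_eq_iff)
  qed
  have "x \<in> I +>\<^bsub>B\<^esub> x" using assms by (simp add: coset_mem_iff)
  then have "(\<Union>y\<in>I +>\<^bsub>B\<^esub> x. I +>\<^bsub>B\<^esub> (a \<odot>\<^bsub>B\<^esub> y)) = I +>\<^bsub>B\<^esub> (a \<odot>\<^bsub>B\<^esub> x)"
    by (intro SUP_eq_const) (blast, rule eq)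
  then show ?thesis by (simp add: quotient_algebra_def)
qed

lemma quotient_algebra_algebra: "algebra R (quotient_algebra B I)"
proof -
  have "cring (quotient_algebra B I)"
    using quotient_is_cring[OF M_cring]
    by (rule cring_cong) (auto simp: quotient_algebra_def)
  then show ?thesis
    by (intro algebraI R_cring)
      (auto simp: quotient_algebra_carrier quotient_algebra_smult quotient_algebra_add
        quotient_algebra_mult smult_l_distr smult_r_distr smult_assoc1 smult_assoc2)
qed

lemma coset_ring_hom: "(\<lambda>x. I +>\<^bsub>B\<^esub> x) \<in> ring_hom B (quotient_algebra B I)"
  by (rule ring_hom_memI)
    (auto simp: quotient_algebra_carrier quotient_algebra_mult quotient_algebra_add quotient_algebra_one)

end

section \<open>Localizations\<close>

locale localization_ring = algebra R B for R (structure) and B (structure) +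
  fixes S
  assumes submonoid: "submonoid S B"
begin

lemma S_carrier: "s \<in> S \<Longrightarrow> s \<in> carrier B"
  and S_mult: "s \<in> S \<Longrightarrow> t \<in> S \<Longrightarrow> s \<otimes>\<^bsub>B\<^esub> t \<in> S"
  and S_one: "\<one>\<^bsub>B\<^esub> \<in> S"
  using submonoid by (auto simp: submonoid_def)

lemma smult_assoc2':
  "a \<in> carrier R \<Longrightarrow> x \<in> carrier B \<Longrightarrow> y \<in> carrier B \<Longrightarrow>
    x \<otimes>\<^bsub>B\<^esub> (a \<odot>\<^bsub>B\<^esub> y) = a \<odot>\<^bsub>B\<^esub> (x \<otimes>\<^bsub>B\<^esub> y)"
  by (metis m_comm smult_assoc2 smult_closed)

lemma loc_rel_equiv: "equiv (carrier B \<times> S) (loc_rel B S)"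
proof (rule equivI)
  show "loc_rel B S \<subseteq> (carrier B \<times> S) \<times> carrier B \<times> S"
    by (auto simp: loc_rel_def)
  show "refl_on (carrier B \<times> S) (loc_rel B S)"
    using S_one by (auto simp: loc_rel_def refl_on_def)
  show "sym (loc_rel B S)"
    by (auto simp: loc_rel_def sym_def) metis
  \<comment> \<open>The product of the two witnesses with the middle denominator is a witness for the outer pair.\<close>
  show "trans (loc_rel B S)"
  proof (rule transI)
    fix p q r assume pq: "(p, q) \<in> loc_rel B S" and qr: "(q, r) \<in> loc_rel B S"
    obtain x s where p: "p = (x, s)" by (cases p)
    obtain y t where q: "q = (y, t)" by (cases q)
    obtain z w where r: "r = (z, w)" by (cases r)
    from pq obtain u where u: "u \<in> S" "u \<otimes>\<^bsub>B\<^esub> (x \<otimes>\<^bsub>B\<^esub> t) = u \<otimes>\<^bsub>B\<^esub> (y \<otimes>\<^bsub>B\<^esub> s)"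
      and m: "x \<in> carrier B" "s \<in> S" "y \<in> carrier B" "t \<in> S" by (auto simp: loc_rel_def p q)
    from qr obtain v where v: "v \<in> S" "v \<otimes>\<^bsub>B\<^esub> (y \<otimes>\<^bsub>B\<^esub> w) = v \<otimes>\<^bsub>B\<^esub> (z \<otimes>\<^bsub>B\<^esub> t)"
      and m': "z \<in> carrier B" "w \<in> S" by (auto simp: loc_rel_def q r)
    note c = m m' u(1) v(1) S_carrier
    have "(u \<otimes>\<^bsub>B\<^esub> v \<otimes>\<^bsub>B\<^esub> t) \<otimes>\<^bsub>B\<^esub> (x \<otimes>\<^bsub>B\<^esub> w) = (v \<otimes>\<^bsub>B\<^esub> w) \<otimes>\<^bsub>B\<^esub> (u \<otimes>\<^bsub>B\<^esub> (x \<otimes>\<^bsub>B\<^esub> t))"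
      using c by (simp add: m_ac)
    also have "\<dots> = (u \<otimes>\<^bsub>B\<^esub> s) \<otimes>\<^bsub>B\<^esub> (v \<otimes>\<^bsub>B\<^esub> (y \<otimes>\<^bsub>B\<^esub> w))"
      unfolding u(2) using c by (simp add: m_ac)
    also have "\<dots> = (u \<otimes>\<^bsub>B\<^esub> v \<otimes>\<^bsub>B\<^esub> t) \<otimes>\<^bsub>B\<^esub> (z \<otimes>\<^bsub>B\<^esub> s)"
      unfolding v(2) using c by (simp add: m_ac)
    finally show "(p, r) \<in> loc_rel B S"
      using c S_mult by (auto simp: loc_rel_def p r)
  qed
qed

lemma frac_eq_iff:
  assumes "x \<in> carrier B" "s \<in> S" "y \<in> carrier B" "t \<in> S"
  shows "loc_frac B S x s = loc_frac B S y t \<longleftrightarrow>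
    (\<exists>u\<in>S. u \<otimes>\<^bsub>B\<^esub> (x \<otimes>\<^bsub>B\<^esub> t) = u \<otimes>\<^bsub>B\<^esub> (y \<otimes>\<^bsub>B\<^esub> s))"
  unfolding loc_frac_def using assms
  by (subst eq_equiv_class_iff[OF loc_rel_equiv]) (auto simp: loc_rel_def)

lemma frac_mem_iff:
  assumes "x \<in> carrier B" "s \<in> S"
  shows "p \<in> loc_frac B S x s \<longleftrightarrow> fst p \<in> carrier B \<and> snd p \<in> S \<and>
    (\<exists>u\<in>S. u \<otimes>\<^bsub>B\<^esub> (x \<otimes>\<^bsub>B\<^esub> snd p) = u \<otimes>\<^bsub>B\<^esub> (fst p \<otimes>\<^bsub>B\<^esub> s))"
  using assms by (cases p) (auto simp: loc_frac_def loc_rel_def)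

abbreviation L where "L \<equiv> localization B S"
abbreviation frac (infixl "\<oslash>" 75) where "x \<oslash> s \<equiv> loc_frac B S x s"

lemma loc_carrier: "carrier L = (\<lambda>(x, s). x \<oslash> s) ` (carrier B \<times> S)"
  by (auto simp: localization_def quotient_def loc_frac_def)

lemma loc_cases:
  assumes "X \<in> carrier L" obtains x s where "X = x \<oslash> s" "x \<in> carrier B" "s \<in> S"
  using assms by (auto simp: loc_carrier)

lemma frac_closed: "x \<in> carrier B \<Longrightarrow> s \<in> S \<Longrightarrow> x \<oslash> s \<in> carrier L"
  by (auto simp: loc_carrier)

text \<open>The operations on fractions are unions over all representatives. Each union collapses to a single
  class, because the product of the witnesses for two changes of representatives is a witness for the
  results.\<close>

lemma loc_mult:
  assumes "x \<in> carrier B" "s \<in> S" "y \<in> carrier B" "t \<in> S"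
  shows "(x \<oslash> s) \<otimes>\<^bsub>L\<^esub> (y \<oslash> t) = (x \<otimes>\<^bsub>B\<^esub> y) \<oslash> (s \<otimes>\<^bsub>B\<^esub> t)"
proof -
  have eq: "(fst p \<otimes>\<^bsub>B\<^esub> fst q) \<oslash> (snd p \<otimes>\<^bsub>B\<^esub> snd q) = (x \<otimes>\<^bsub>B\<^esub> y) \<oslash> (s \<otimes>\<^bsub>B\<^esub> t)"
    if pq: "p \<in> x \<oslash> s" "q \<in> y \<oslash> t" for p q
  proof -
    obtain x' s' y' t' where pq': "p = (x', s')" "q = (y', t')" by (metis prod.exhaust)
    obtain u v where u: "u \<in> S" "u \<otimes>\<^bsub>B\<^esub> (x \<otimes>\<^bsub>B\<^esub> s') = u \<otimes>\<^bsub>B\<^esub> (x' \<otimes>\<^bsub>B\<^esub> s)" "x' \<in> carrier B" "s' \<in> S"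
      and v: "v \<in> S" "v \<otimes>\<^bsub>B\<^esub> (y \<otimes>\<^bsub>B\<^esub> t') = v \<otimes>\<^bsub>B\<^esub> (y' \<otimes>\<^bsub>B\<^esub> t)" "y' \<in> carrier B" "t' \<in> S"
      using pq assms by (auto simp: frac_mem_iff pq')
    note c = assms u(1,3,4) v(1,3,4) S_carrier S_mult
    have "(u \<otimes>\<^bsub>B\<^esub> v) \<otimes>\<^bsub>B\<^esub> ((x' \<otimes>\<^bsub>B\<^esub> y') \<otimes>\<^bsub>B\<^esub> (s \<otimes>\<^bsub>B\<^esub> t))
        = (u \<otimes>\<^bsub>B\<^esub> (x' \<otimes>\<^bsub>B\<^esub> s)) \<otimes>\<^bsub>B\<^esub> (v \<otimes>\<^bsub>B\<^esub> (y' \<otimes>\<^bsub>B\<^esub> t))"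
      using c by (simp add: m_ac)
    also have "\<dots> = (u \<otimes>\<^bsub>B\<^esub> v) \<otimes>\<^bsub>B\<^esub> ((x \<otimes>\<^bsub>B\<^esub> y) \<otimes>\<^bsub>B\<^esub> (s' \<otimes>\<^bsub>B\<^esub> t'))"
      unfolding u(2)[symmetric] v(2)[symmetric] using c by (simp add: m_ac)
    finally show ?thesis using c by (auto simp: pq' frac_eq_iff)
  qed
  have ne: "(x, s) \<in> x \<oslash> s" "(y, t) \<in> y \<oslash> t"
    using assms S_one by (auto simp: frac_mem_iff)
  have "(x \<oslash> s) \<otimes>\<^bsub>L\<^esub> (y \<oslash> t)
      = (\<Union>p\<in>x \<oslash> s. \<Union>q\<in>y \<oslash> t. (fst p \<otimes>\<^bsub>B\<^esub> fst q) \<oslash> (snd p \<otimes>\<^bsub>B\<^esub> snd q))"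
    by (simp add: localization_def case_prod_beta)
  then show ?thesis using eq ne by blast
qed

lemma loc_add:
  assumes "x \<in> carrier B" "s \<in> S" "y \<in> carrier B" "t \<in> S"
  shows "(x \<oslash> s) \<oplus>\<^bsub>L\<^esub> (y \<oslash> t) = (x \<otimes>\<^bsub>B\<^esub> t \<oplus>\<^bsub>B\<^esub> y \<otimes>\<^bsub>B\<^esub> s) \<oslash> (s \<otimes>\<^bsub>B\<^esub> t)"
proof -
  have eq: "(fst p \<otimes>\<^bsub>B\<^esub> snd q \<oplus>\<^bsub>B\<^esub> fst q \<otimes>\<^bsub>B\<^esub> snd p) \<oslash> (snd p \<otimes>\<^bsub>B\<^esub> snd q)
      = (x \<otimes>\<^bsub>B\<^esub> t \<oplus>\<^bsub>B\<^esub> y \<otimes>\<^bsub>B\<^esub> s) \<oslash> (s \<otimes>\<^bsub>B\<^esub> t)"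
    if pq: "p \<in> x \<oslash> s" "q \<in> y \<oslash> t" for p q
  proof -
    obtain x' s' y' t' where pq': "p = (x', s')" "q = (y', t')" by (metis prod.exhaust)
    obtain u v where u: "u \<in> S" "u \<otimes>\<^bsub>B\<^esub> (x \<otimes>\<^bsub>B\<^esub> s') = u \<otimes>\<^bsub>B\<^esub> (x' \<otimes>\<^bsub>B\<^esub> s)" "x' \<in> carrier B" "s' \<in> S"
      and v: "v \<in> S" "v \<otimes>\<^bsub>B\<^esub> (y \<otimes>\<^bsub>B\<^esub> t') = v \<otimes>\<^bsub>B\<^esub> (y' \<otimes>\<^bsub>B\<^esub> t)" "y' \<in> carrier B" "t' \<in> S"
      using pq assms by (auto simp: frac_mem_iff pq')
    note c = assms u(1,3,4) v(1,3,4) S_carrier S_mult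
    have "(u \<otimes>\<^bsub>B\<^esub> v) \<otimes>\<^bsub>B\<^esub> ((x' \<otimes>\<^bsub>B\<^esub> t' \<oplus>\<^bsub>B\<^esub> y' \<otimes>\<^bsub>B\<^esub> s') \<otimes>\<^bsub>B\<^esub> (s \<otimes>\<^bsub>B\<^esub> t))
        = (u \<otimes>\<^bsub>B\<^esub> (x' \<otimes>\<^bsub>B\<^esub> s)) \<otimes>\<^bsub>B\<^esub> (v \<otimes>\<^bsub>B\<^esub> t \<otimes>\<^bsub>B\<^esub> t')
          \<oplus>\<^bsub>B\<^esub> (v \<otimes>\<^bsub>B\<^esub> (y' \<otimes>\<^bsub>B\<^esub> t)) \<otimes>\<^bsub>B\<^esub> (u \<otimes>\<^bsub>B\<^esub> s \<otimes>\<^bsub>B\<^esub> s')"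
      using c by (simp add: m_ac l_distr r_distr)
    also have "\<dots> = (u \<otimes>\<^bsub>B\<^esub> v) \<otimes>\<^bsub>B\<^esub> ((x \<otimes>\<^bsub>B\<^esub> t \<oplus>\<^bsub>B\<^esub> y \<otimes>\<^bsub>B\<^esub> s) \<otimes>\<^bsub>B\<^esub> (s' \<otimes>\<^bsub>B\<^esub> t'))"
      unfolding u(2)[symmetric] v(2)[symmetric] using c by (simp add: m_ac l_distr r_distr)
    finally show ?thesis using c by (auto simp: pq' frac_eq_iff)
  qed
  have ne: "(x, s) \<in> x \<oslash> s" "(y, t) \<in> y \<oslash> t"
    using assms S_one by (auto simp: frac_mem_iff)
  have "(x \<oslash> s) \<oplus>\<^bsub>L\<^esub> (y \<oslash> t)
      = (\<Union>p\<in>x \<oslash> s. \<Union>q\<in>y \<oslash> t. (fst p \<otimes>\<^bsub>B\<^esub> snd q \<oplus>\<^bsub>B\<^esub> fst q \<otimes>\<^bsub>B\<^esub> snd p) \<oslash> (snd p \<otimes>\<^bsub>B\<^esub> snd q))"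
    by (simp add: localization_def case_prod_beta)
  then show ?thesis using eq ne by blast
qed

lemma loc_smult:
  assumes "a \<in> carrier R" "x \<in> carrier B" "s \<in> S"
  shows "a \<odot>\<^bsub>L\<^esub> (x \<oslash> s) = (a \<odot>\<^bsub>B\<^esub> x) \<oslash> s"
proof -
  have eq: "(a \<odot>\<^bsub>B\<^esub> fst p) \<oslash> snd p = (a \<odot>\<^bsub>B\<^esub> x) \<oslash> s" if p: "p \<in> x \<oslash> s" for p
  proof -
    obtain x' s' where p': "p = (x', s')" by (cases p)
    obtain u where u: "u \<in> S" "u \<otimes>\<^bsub>B\<^esub> (x \<otimes>\<^bsub>B\<^esub> s') = u \<otimes>\<^bsub>B\<^esub> (x' \<otimes>\<^bsub>B\<^esub> s)" "x' \<in> carrier B" "s' \<in> S"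
      using p assms by (auto simp: frac_mem_iff p')
    note c = assms u(1,3,4) S_carrier S_mult
    have "u \<otimes>\<^bsub>B\<^esub> ((a \<odot>\<^bsub>B\<^esub> x') \<otimes>\<^bsub>B\<^esub> s) = a \<odot>\<^bsub>B\<^esub> (u \<otimes>\<^bsub>B\<^esub> (x' \<otimes>\<^bsub>B\<^esub> s))"
      using c by (simp add: smult_assoc2 smult_assoc2')
    also have "\<dots> = u \<otimes>\<^bsub>B\<^esub> ((a \<odot>\<^bsub>B\<^esub> x) \<otimes>\<^bsub>B\<^esub> s')"
      unfolding u(2)[symmetric] using c by (simp add: smult_assoc2 smult_assoc2')
    finally show ?thesis using c by (auto simp: p' frac_eq_iff)
  qed
  have ne: "(x, s) \<in> x \<oslash> s" using assms S_one by (auto simp: frac_mem_iff)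
  have "a \<odot>\<^bsub>L\<^esub> (x \<oslash> s) = (\<Union>p\<in>x \<oslash> s. (a \<odot>\<^bsub>B\<^esub> fst p) \<oslash> snd p)"
    by (simp add: localization_def case_prod_beta)
  then show ?thesis using eq ne by blast
qed

lemma loc_one: "\<one>\<^bsub>L\<^esub> = \<one>\<^bsub>B\<^esub> \<oslash> \<one>\<^bsub>B\<^esub>" and loc_zero: "\<zero>\<^bsub>L\<^esub> = \<zero>\<^bsub>B\<^esub> \<oslash> \<one>\<^bsub>B\<^esub>"
  by (simp_all add: localization_def)

lemma frac_eqI:
  assumes "x \<in> carrier B" "s \<in> S" "y \<in> carrier B" "t \<in> S" "x \<otimes>\<^bsub>B\<^esub> t = y \<otimes>\<^bsub>B\<^esub> s"
  shows "x \<oslash> s = y \<oslash> t"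
  using assms S_one by (auto simp: frac_eq_iff)

lemma loc_cring: "cring L"
proof -
  note c = S_carrier S_mult S_one frac_closed
  note ops = loc_mult loc_add loc_one loc_zero
  have neg: "\<exists>y\<in>carrier L. y \<oplus>\<^bsub>L\<^esub> x \<oslash> s = \<zero>\<^bsub>L\<^esub>" if "x \<in> carrier B" "s \<in> S" for x s
  proof
    have "((\<ominus>\<^bsub>B\<^esub> x) \<otimes>\<^bsub>B\<^esub> s \<oplus>\<^bsub>B\<^esub> x \<otimes>\<^bsub>B\<^esub> s) = \<zero>\<^bsub>B\<^esub>"
      using that c by (simp add: l_minus M.l_neg)
    then show "(\<ominus>\<^bsub>B\<^esub> x) \<oslash> s \<oplus>\<^bsub>L\<^esub> x \<oslash> s = \<zero>\<^bsub>L\<^esub>"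
      using that c by (simp add: ops) (rule frac_eqI, auto)
  qed (use that c in auto)
  show ?thesis
  proof (rule cringI)
    show "abelian_group L"
      by (rule abelian_groupI; ((erule loc_cases)+)?)
        (auto del: equalityI subsetI intro!: frac_eqI neg[unfolded loc_zero] simp: ops c m_ac M.a_ac l_distr r_distr)
    show "comm_monoid L"
      by (rule comm_monoidI; ((erule loc_cases)+)?)
        (auto del: equalityI subsetI intro!: frac_eqI simp: ops c m_ac)
  qed ((erule loc_cases)+, auto del: equalityI subsetI intro!: frac_eqI simp: ops c m_ac M.a_ac l_distr r_distr)
qed

lemma loc_algebra: "algebra R L"
proof -
  note c = S_carrier S_mult S_one frac_closed
  note ops = loc_mult loc_add loc_one loc_zero loc_smult
  note sm = smult_l_distr smult_r_distr smult_assoc1 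
  show ?thesis
    by (rule algebraI; ((erule loc_cases)+)?)
      (auto del: equalityI subsetI intro!: R_cring loc_cring frac_eqI simp: ops c sm smult_assoc2 smult_assoc2' m_ac M.a_ac l_distr r_distr)
qed

lemma frac_one_hom: "(\<lambda>x. x \<oslash> \<one>\<^bsub>B\<^esub>) \<in> ring_hom B L"
  by (rule ring_hom_memI) (auto simp: S_one frac_closed loc_mult loc_add loc_one)

end

section \<open>Division by a monic polynomial\<close>

lemma (in abelian_group) minus_zero_imp_eq:
  "a \<in> carrier G \<Longrightarrow> b \<in> carrier G \<Longrightarrow> a \<ominus> b = \<zero> \<Longrightarrow> a = b"
  by (metis a_inv_closed minus_eq minus_equality minus_minus)

lemma (in UP_cring) coeff_mult_monom:
  assumes "f \<in> carrier P" "a \<in> carrier R"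
  shows "coeff P (f \<otimes>\<^bsub>P\<^esub> monom P a d) m = (if d \<le> m then coeff P f (m - d) \<otimes> a else \<zero>)"
proof -
  have "coeff P (f \<otimes>\<^bsub>P\<^esub> monom P a d) m = (\<Oplus>i\<in>{..m}. coeff P f i \<otimes> (if d = m - i then a else \<zero>))"
    using assms by simp
  also have "\<dots> = (if d \<le> m then coeff P f (m - d) \<otimes> a else \<zero>)"
  proof (cases "d \<le> m")
    case True
    have "(\<Oplus>i\<in>{..m}. coeff P f i \<otimes> (if d = m - i then a else \<zero>))
        = coeff P f (m - d) \<otimes> (if d = m - (m - d) then a else \<zero>)"
      using assms True by (intro R.finsum_single) auto
    with True show ?thesis by simp
  next
    case False
    then show ?thesis using assms by (auto intro!: R.add.finprod_one_eqI)
  qed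
  finally show ?thesis .
qed

lemma (in UP_cring) eventually_coeff_zero:
  assumes "f \<in> carrier P" obtains N where "\<And>m. m \<ge> N \<Longrightarrow> coeff P f m = \<zero>"
  using deg_aboveD[OF _ assms] by (meson Suc_le_eq)

abbreviation (in UP_cring) X where "X i \<equiv> monom P \<one> i"

locale monic_polynomial = UP_cring R P for R (structure) and P (structure) +
  fixes F n
  assumes F_closed [simp]: "F \<in> carrier P"
    and F_lead: "coeff P F n = \<one>"
    and F_above: "m > n \<Longrightarrow> coeff P F m = \<zero>"
begin

text \<open>Degree less than \<open>n\<close>, in terms of coefficients because the degree of the zero polynomial is \<open>0\<close>.\<close>

definition low :: "_ \<Rightarrow> bool" where
  "low r \<longleftrightarrow> r \<in> carrier P \<and> (\<forall>m\<ge>n. coeff P r m = \<zero>)"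

lemma low_closed: "low r \<Longrightarrow> r \<in> carrier P"
  by (simp add: low_def)

text \<open>Subtracting \<open>F\<close> times a monomial removes the leading coefficient. The induction is on a bound for
  the degree.\<close>

lemma division_exists:
  assumes "f \<in> carrier P"
  shows "\<exists>q\<in>carrier P. \<exists>r. low r \<and> f = F \<otimes>\<^bsub>P\<^esub> q \<oplus>\<^bsub>P\<^esub> r"
proof -
  obtain N where "\<And>m. m \<ge> N \<Longrightarrow> coeff P f m = \<zero>" using eventually_coeff_zero[OF assms] by blast
  with assms show ?thesis
  proof (induction N arbitrary: f)
    case 0
    then show ?case by (intro bexI[of _ "\<zero>\<^bsub>P\<^esub>"] exI[of _ f]) (auto simp: low_def)
  next
    case (Suc k)
    show ?case
    proof (cases "k < n")
      case True
      then show ?thesis using Suc.prems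
        by (intro bexI[of _ "\<zero>\<^bsub>P\<^esub>"] exI[of _ f]) (auto simp: low_def)
    next
      case False
      let ?t = "monom P (coeff P f k) (k - n)"
      have t: "?t \<in> carrier P" using Suc.prems by simp
      have "coeff P (f \<ominus>\<^bsub>P\<^esub> F \<otimes>\<^bsub>P\<^esub> ?t) m = \<zero>" if m: "m \<ge> k" for m
      proof -
        have "coeff P (f \<ominus>\<^bsub>P\<^esub> F \<otimes>\<^bsub>P\<^esub> ?t) m = coeff P f m \<ominus> coeff P F (m - (k - n)) \<otimes> coeff P f k"
          using Suc.prems(1) t m False le_trans[OF diff_le_self m, of n]
          by (simp add: P.minus_eq R.minus_eq coeff_mult_monom del: coeff_mult)
        also have "\<dots> = \<zero>"
        proof (cases "m = k")
          case True
          then show ?thesis using False Suc.prems(1) by (simp add: F_lead R.r_neg R.minus_eq)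
        next
          case neq: False
          then have "m - (k - n) > n" "m \<ge> Suc k" using m False by auto
          then show ?thesis using Suc.prems by (simp add: F_above R.minus_eq)
        qed
        finally show ?thesis .
      qed
      then obtain q r where qr: "q \<in> carrier P" "low r" "f \<ominus>\<^bsub>P\<^esub> F \<otimes>\<^bsub>P\<^esub> ?t = F \<otimes>\<^bsub>P\<^esub> q \<oplus>\<^bsub>P\<^esub> r"
        using Suc.IH[of "f \<ominus>\<^bsub>P\<^esub> F \<otimes>\<^bsub>P\<^esub> ?t"] Suc.prems t by auto
      have "f = (f \<ominus>\<^bsub>P\<^esub> F \<otimes>\<^bsub>P\<^esub> ?t) \<oplus>\<^bsub>P\<^esub> F \<otimes>\<^bsub>P\<^esub> ?t"
        using Suc.prems(1) t by (simp add: P.minus_eq P.a_assoc P.l_neg)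
      also have "\<dots> = F \<otimes>\<^bsub>P\<^esub> (q \<oplus>\<^bsub>P\<^esub> ?t) \<oplus>\<^bsub>P\<^esub> r"
        unfolding qr(3) using qr(1) low_closed[OF qr(2)] t by (simp add: P.r_distr P.a_ac)
      finally show ?thesis using qr t by blast
    qed
  qed
qed

text \<open>As \<open>F\<close> is monic, the leading coefficient of \<open>q\<close> reappears in \<open>F q\<close>, shifted by \<open>n\<close>.\<close>

lemma low_multiple_zero:
  assumes "q \<in> carrier P" "low (F \<otimes>\<^bsub>P\<^esub> q)"
  shows "q = \<zero>\<^bsub>P\<^esub>"
proof -
  obtain N where "\<And>m. m \<ge> N \<Longrightarrow> coeff P q m = \<zero>" using eventually_coeff_zero[OF assms(1)] by blast
  then show ?thesis
  proof (induction N)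
    case 0
    then show ?case using assms by (intro up_eqI) auto
  next
    case (Suc k)
    have "coeff P (F \<otimes>\<^bsub>P\<^esub> q) (n + k) = (\<Oplus>i\<in>{..n + k}. coeff P F i \<otimes> coeff P q (n + k - i))"
      using assms by simp
    also have "\<dots> = coeff P F n \<otimes> coeff P q (n + k - n)"
    proof (rule R.finsum_single)
      fix j assume j: "j \<in> {..n + k}" "j \<noteq> n"
      show "coeff P F j \<otimes> coeff P q (n + k - j) = \<zero>"
        using j assms Suc.prems F_above by (cases "j < n") auto
    qed (use assms in auto)
    also have "\<dots> = coeff P q k" using assms by (simp add: F_lead)
    finally have "coeff P q k = \<zero>" using assms by (simp add: low_def)
    then have "\<And>m. m \<ge> k \<Longrightarrow> coeff P q m = \<zero>" using Suc.prems by (metis le_antisym not_less_eq_eq)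
    then show ?case by (rule Suc.IH)
  qed
qed

lemma low_add: "low r \<Longrightarrow> low s \<Longrightarrow> low (r \<oplus>\<^bsub>P\<^esub> s)"
  and low_smult: "a \<in> carrier R \<Longrightarrow> low r \<Longrightarrow> low (a \<odot>\<^bsub>P\<^esub> r)"
  and low_uminus: "low r \<Longrightarrow> low (\<ominus>\<^bsub>P\<^esub> r)"
  by (auto simp: low_def)

definition remainder where
  "remainder f = (SOME r. low r \<and> (\<exists>q\<in>carrier P. f = F \<otimes>\<^bsub>P\<^esub> q \<oplus>\<^bsub>P\<^esub> r))"

lemma remainder_props:
  assumes "f \<in> carrier P"
  shows "low (remainder f)" "\<exists>q\<in>carrier P. f = F \<otimes>\<^bsub>P\<^esub> q \<oplus>\<^bsub>P\<^esub> remainder f"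
  using someI_ex[of "\<lambda>r. low r \<and> (\<exists>q\<in>carrier P. f = F \<otimes>\<^bsub>P\<^esub> q \<oplus>\<^bsub>P\<^esub> r)"] division_exists[OF assms]
  unfolding remainder_def by blast+

lemma remainder_closed [simp]: "f \<in> carrier P \<Longrightarrow> remainder f \<in> carrier P"
  using remainder_props(1) low_closed by blast

lemma remainder_unique:
  assumes "q \<in> carrier P" "low r"
  shows "remainder (F \<otimes>\<^bsub>P\<^esub> q \<oplus>\<^bsub>P\<^esub> r) = r"
proof -
  let ?f = "F \<otimes>\<^bsub>P\<^esub> q \<oplus>\<^bsub>P\<^esub> r"
  have r: "r \<in> carrier P" "?f \<in> carrier P" using assms low_closed by auto
  obtain p where p: "p \<in> carrier P" "?f = F \<otimes>\<^bsub>P\<^esub> p \<oplus>\<^bsub>P\<^esub> remainder ?f" "low (remainder ?f)"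
    using remainder_props r by blast
  let ?s = "remainder ?f"
  have s: "?s \<in> carrier P" using p(3) low_closed by blast
  have "F \<otimes>\<^bsub>P\<^esub> (p \<ominus>\<^bsub>P\<^esub> q) = (F \<otimes>\<^bsub>P\<^esub> p \<oplus>\<^bsub>P\<^esub> ?s) \<ominus>\<^bsub>P\<^esub> ?s \<ominus>\<^bsub>P\<^esub> F \<otimes>\<^bsub>P\<^esub> q"
    using p(1) assms(1) s
    by (simp add: P.minus_eq P.r_distr P.r_minus P.a_assoc P.r_neg)
  also have "\<dots> = r \<ominus>\<^bsub>P\<^esub> ?s"
    unfolding p(2)[symmetric] using assms(1) r s
    by (simp add: P.minus_eq P.a_ac P.r_neg1 P.r_neg2)
  finally have e: "F \<otimes>\<^bsub>P\<^esub> (p \<ominus>\<^bsub>P\<^esub> q) = r \<ominus>\<^bsub>P\<^esub> ?s" .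
  then have "low (F \<otimes>\<^bsub>P\<^esub> (p \<ominus>\<^bsub>P\<^esub> q))"
    using assms p(3) by (simp add: P.minus_eq low_add low_uminus)
  then have "p \<ominus>\<^bsub>P\<^esub> q = \<zero>\<^bsub>P\<^esub>" using p assms by (intro low_multiple_zero) auto
  with e have "r \<ominus>\<^bsub>P\<^esub> ?s = \<zero>\<^bsub>P\<^esub>" by simp
  then show ?thesis using r s by (metis P.minus_zero_imp_eq)
qed

lemma remainder_low: "low r \<Longrightarrow> remainder r = r"
  using remainder_unique[of "\<zero>\<^bsub>P\<^esub>" r] by (simp add: low_closed)

lemma remainder_add:
  assumes "f \<in> carrier P" "g \<in> carrier P"
  shows "remainder (f \<oplus>\<^bsub>P\<^esub> g) = remainder f \<oplus>\<^bsub>P\<^esub> remainder g"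
proof -
  obtain p q where pq: "p \<in> carrier P" "f = F \<otimes>\<^bsub>P\<^esub> p \<oplus>\<^bsub>P\<^esub> remainder f"
    "q \<in> carrier P" "g = F \<otimes>\<^bsub>P\<^esub> q \<oplus>\<^bsub>P\<^esub> remainder g"
    using remainder_props assms by metis
  have "f \<oplus>\<^bsub>P\<^esub> g = (F \<otimes>\<^bsub>P\<^esub> p \<oplus>\<^bsub>P\<^esub> remainder f) \<oplus>\<^bsub>P\<^esub> (F \<otimes>\<^bsub>P\<^esub> q \<oplus>\<^bsub>P\<^esub> remainder g)"
    using pq by simp
  also have "\<dots> = F \<otimes>\<^bsub>P\<^esub> (p \<oplus>\<^bsub>P\<^esub> q) \<oplus>\<^bsub>P\<^esub> (remainder f \<oplus>\<^bsub>P\<^esub> remainder g)"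
    using pq(1,3) assms by (simp add: P.r_distr P.a_ac)
  finally show ?thesis
    using remainder_unique[of "p \<oplus>\<^bsub>P\<^esub> q" "remainder f \<oplus>\<^bsub>P\<^esub> remainder g"] pq(1,3) remainder_props(1) assms
    by (simp add: low_add)
qed

lemma remainder_smult:
  assumes "a \<in> carrier R" "f \<in> carrier P"
  shows "remainder (a \<odot>\<^bsub>P\<^esub> f) = a \<odot>\<^bsub>P\<^esub> remainder f"
proof -
  obtain p where p: "p \<in> carrier P" "f = F \<otimes>\<^bsub>P\<^esub> p \<oplus>\<^bsub>P\<^esub> remainder f"
    using remainder_props assms by metis
  have "a \<odot>\<^bsub>P\<^esub> f = a \<odot>\<^bsub>P\<^esub> (F \<otimes>\<^bsub>P\<^esub> p \<oplus>\<^bsub>P\<^esub> remainder f)" using p by simp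
  also have "\<dots> = F \<otimes>\<^bsub>P\<^esub> (a \<odot>\<^bsub>P\<^esub> p) \<oplus>\<^bsub>P\<^esub> a \<odot>\<^bsub>P\<^esub> remainder f"
    using p(1) assms by (simp add: UP_smult_r_distr P.m_comm[of F] UP_smult_assoc2)
  finally show ?thesis
    using remainder_unique[of "a \<odot>\<^bsub>P\<^esub> p" "a \<odot>\<^bsub>P\<^esub> remainder f"] p(1) remainder_props(1) assms
    by (simp add: low_smult)
qed

lemma remainder_multiple: "q \<in> carrier P \<Longrightarrow> remainder (F \<otimes>\<^bsub>P\<^esub> q) = \<zero>\<^bsub>P\<^esub>"
  using remainder_unique[of q "\<zero>\<^bsub>P\<^esub>"] by (simp add: low_def)

lemma remainder_mult:
  assumes "f \<in> carrier P" "g \<in> carrier P"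
  shows "remainder (f \<otimes>\<^bsub>P\<^esub> remainder g) = remainder (f \<otimes>\<^bsub>P\<^esub> g)"
proof -
  obtain q where q: "q \<in> carrier P" "g = F \<otimes>\<^bsub>P\<^esub> q \<oplus>\<^bsub>P\<^esub> remainder g"
    using remainder_props assms by metis
  have "f \<otimes>\<^bsub>P\<^esub> g = f \<otimes>\<^bsub>P\<^esub> (F \<otimes>\<^bsub>P\<^esub> q \<oplus>\<^bsub>P\<^esub> remainder g)" using q by simp
  also have "\<dots> = F \<otimes>\<^bsub>P\<^esub> (f \<otimes>\<^bsub>P\<^esub> q) \<oplus>\<^bsub>P\<^esub> f \<otimes>\<^bsub>P\<^esub> remainder g"
    using q(1) assms by (simp add: P.r_distr P.m_ac)
  finally show ?thesis
    using q(1) assms by (simp add: remainder_add remainder_multiple)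
qed

lemma mem_PIdl_iff: "f \<in> carrier P \<Longrightarrow> f \<in> PIdl\<^bsub>P\<^esub> F \<longleftrightarrow> remainder f = \<zero>\<^bsub>P\<^esub>"
proof
  assume "f \<in> PIdl\<^bsub>P\<^esub> F"
  then show "remainder f = \<zero>\<^bsub>P\<^esub>"
    unfolding cgenideal_def using P.m_comm remainder_multiple by auto
next
  assume f: "f \<in> carrier P" "remainder f = \<zero>\<^bsub>P\<^esub>"
  then obtain q where "q \<in> carrier P" "f = F \<otimes>\<^bsub>P\<^esub> q \<oplus>\<^bsub>P\<^esub> \<zero>\<^bsub>P\<^esub>" using remainder_props by metis
  then show "f \<in> PIdl\<^bsub>P\<^esub> F" unfolding cgenideal_def using P.m_comm[OF F_closed] by auto
qed

lemma PIdl_closed: "f \<in> PIdl\<^bsub>P\<^esub> F \<Longrightarrow> f \<in> carrier P"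
  by (auto simp: cgenideal_def)

lemma PIdl_ideal: "ideal (PIdl\<^bsub>P\<^esub> F) P"
  by (rule P.cgenideal_ideal) simp

definition comb where "comb c = (\<Oplus>\<^bsub>P\<^esub>i\<in>{..<n}. c i \<odot>\<^bsub>P\<^esub> X i)"

lemma comb_closed: "c \<in> {..<n} \<rightarrow> carrier R \<Longrightarrow> comb c \<in> carrier P"
  unfolding comb_def by (intro P.finsum_closed) auto

lemma coeff_comb:
  assumes "c \<in> {..<n} \<rightarrow> carrier R"
  shows "coeff P (comb c) m = (if m < n then c m else \<zero>)"
proof -
  have "coeff P (comb c) m = (\<Oplus>i\<in>{..<n}. coeff P (c i \<odot>\<^bsub>P\<^esub> X i) m)"
    unfolding comb_def using assms by (intro coeff_finsum) auto
  also have "\<dots> = (\<Oplus>i\<in>{..<n}. if i = m then c i else \<zero>)"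
    using assms by (intro R.finsum_cong') (auto simp: Pi_iff)
  also have "\<dots> = (if m < n then c m else \<zero>)"
  proof (cases "m < n")
    case True
    have "(\<Oplus>i\<in>{..<n}. if i = m then c i else \<zero>) = (if m = m then c m else \<zero>)"
      using True assms by (intro R.finsum_single) (auto simp: Pi_iff)
    then show ?thesis using True by simp
  qed (auto intro!: R.add.finprod_one_eqI)
  finally show ?thesis .
qed

lemma low_comb: "c \<in> {..<n} \<rightarrow> carrier R \<Longrightarrow> low (comb c)"
  by (simp add: low_def comb_closed coeff_comb)

lemma comb_coeff: "low r \<Longrightarrow> comb (coeff P r) = r"
  by (intro up_eqI) (auto simp: low_def coeff_comb comb_closed)

text \<open>Invertibility of the residue class of \<open>f\<close> in \<open>R[X]/(F)\<close>.\<close>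

definition unit_mod where
  "unit_mod f \<longleftrightarrow> (\<exists>g\<in>carrier P. f \<otimes>\<^bsub>P\<^esub> g \<ominus>\<^bsub>P\<^esub> \<one>\<^bsub>P\<^esub> \<in> PIdl\<^bsub>P\<^esub> F)"

section \<open>The residue algebra of the localization\<close>

context
  fixes U
  assumes U: "submonoid U P"
begin

interpretation LR: localization_ring R P U
  by (intro localization_ring.intro UP_algebra localization_ring_axioms.intro U)

abbreviation "LA \<equiv> localization P U"
abbreviation "IF \<equiv> PIdl\<^bsub>LA\<^esub> (loc_frac P U F \<one>\<^bsub>P\<^esub>)"
abbreviation "Q \<equiv> loc_residue_ring R U F"
abbreviation "\<theta> \<equiv> loc_residue R U F"

lemma Q_eq: "Q = quotient_algebra LA IF"
  by (simp add: loc_residue_ring_def loc_ideal_def P_def)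

lemma theta_eq: "\<theta> f = IF +>\<^bsub>LA\<^esub> loc_frac P U f \<one>\<^bsub>P\<^esub>"
  by (simp add: loc_residue_def loc_ideal_def P_def)

lemma IF_ideal: "ideal IF LA"
  by (intro cring.cgenideal_ideal LR.loc_cring LR.frac_closed LR.S_one F_closed)

lemma Q_algebra: "algebra R Q"
  unfolding Q_eq by (intro quotient_algebra_algebra[OF LR.loc_algebra IF_ideal])

interpretation Q: algebra R Q by (rule Q_algebra)

lemma theta_hom: "\<theta> \<in> ring_hom P Q"
proof -
  have "\<theta> = (\<lambda>x. IF +>\<^bsub>LA\<^esub> x) \<circ> (\<lambda>f. loc_frac P U f \<one>\<^bsub>P\<^esub>)" by (auto simp: theta_eq)
  then show ?thesis
    using ring_hom_trans[OF LR.frac_one_hom coset_ring_hom[OF LR.loc_algebra IF_ideal]]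
    by (simp add: Q_eq)
qed

interpretation theta: ring_hom_cring P Q \<theta>
  by (intro ring_hom_cring.intro ring_hom_cring_axioms.intro P.cring_axioms Q.M_cring theta_hom)

lemma theta_smult: "a \<in> carrier R \<Longrightarrow> f \<in> carrier P \<Longrightarrow> \<theta> (a \<odot>\<^bsub>P\<^esub> f) = a \<odot>\<^bsub>Q\<^esub> \<theta> f"
  by (simp add: theta_eq Q_eq quotient_algebra_smult[OF LR.loc_algebra IF_ideal] LR.loc_smult
      LR.frac_closed LR.S_one)

text \<open>An element of the ideal generated by \<open>F/1\<close> is a fraction \<open>g F / s\<close>, and its equality with \<open>f/1\<close>
  involves one more factor from \<open>U\<close>.\<close>

lemma theta_zero_iff:
  assumes "f \<in> carrier P"
  shows "\<theta> f = \<zero>\<^bsub>Q\<^esub> \<longleftrightarrow> (\<exists>s\<in>U. s \<otimes>\<^bsub>P\<^esub> f \<in> PIdl\<^bsub>P\<^esub> F)"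
proof -
  note c = assms LR.S_carrier LR.S_mult LR.S_one LR.frac_closed
  interpret I: ideal IF LA by (rule IF_ideal)
  have z: "\<zero>\<^bsub>Q\<^esub> = IF" by (simp add: Q_eq quotient_algebra_def FactRing_def)
  have "\<theta> f = \<zero>\<^bsub>Q\<^esub> \<longleftrightarrow> loc_frac P U f \<one>\<^bsub>P\<^esub> \<in> IF"
    unfolding z theta_eq using c by (metis I.a_rcos_const I.a_rcos_self)
  also have "\<dots> \<longleftrightarrow> (\<exists>g\<in>carrier P. \<exists>s\<in>U. loc_frac P U f \<one>\<^bsub>P\<^esub> = loc_frac P U (g \<otimes>\<^bsub>P\<^esub> F) s)"
  proof -
    have "(\<exists>Y\<in>carrier LA. loc_frac P U f \<one>\<^bsub>P\<^esub> = Y \<otimes>\<^bsub>LA\<^esub> loc_frac P U F \<one>\<^bsub>P\<^esub>)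
      \<longleftrightarrow> (\<exists>g\<in>carrier P. \<exists>s\<in>U. loc_frac P U f \<one>\<^bsub>P\<^esub> = loc_frac P U g s \<otimes>\<^bsub>LA\<^esub> loc_frac P U F \<one>\<^bsub>P\<^esub>)"
      using c by (auto simp: LR.loc_carrier)
    also have "\<dots> \<longleftrightarrow> (\<exists>g\<in>carrier P. \<exists>s\<in>U. loc_frac P U f \<one>\<^bsub>P\<^esub> = loc_frac P U (g \<otimes>\<^bsub>P\<^esub> F) s)"
      using c by (intro bex_cong refl) (simp add: LR.loc_mult)
    finally show ?thesis unfolding cgenideal_def by blast
  qed
  also have "\<dots> \<longleftrightarrow> (\<exists>s\<in>U. s \<otimes>\<^bsub>P\<^esub> f \<in> PIdl\<^bsub>P\<^esub> F)"
  proof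
    assume "\<exists>g\<in>carrier P. \<exists>s\<in>U. loc_frac P U f \<one>\<^bsub>P\<^esub> = loc_frac P U (g \<otimes>\<^bsub>P\<^esub> F) s"
    then obtain g s u where g: "g \<in> carrier P" "s \<in> U" "u \<in> U"
      "u \<otimes>\<^bsub>P\<^esub> (f \<otimes>\<^bsub>P\<^esub> s) = u \<otimes>\<^bsub>P\<^esub> (g \<otimes>\<^bsub>P\<^esub> F \<otimes>\<^bsub>P\<^esub> \<one>\<^bsub>P\<^esub>)"
      using c by (auto simp: LR.frac_eq_iff)
    have "(u \<otimes>\<^bsub>P\<^esub> s) \<otimes>\<^bsub>P\<^esub> f = u \<otimes>\<^bsub>P\<^esub> (f \<otimes>\<^bsub>P\<^esub> s)" using g c by (simp add: P.m_ac)
    also have "\<dots> = (u \<otimes>\<^bsub>P\<^esub> g) \<otimes>\<^bsub>P\<^esub> F" unfolding g(4) using g(1-3) c by (simp add: P.m_ac)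
    finally have "(u \<otimes>\<^bsub>P\<^esub> s) \<otimes>\<^bsub>P\<^esub> f = (u \<otimes>\<^bsub>P\<^esub> g) \<otimes>\<^bsub>P\<^esub> F" .
    moreover have "u \<otimes>\<^bsub>P\<^esub> s \<in> U" "u \<otimes>\<^bsub>P\<^esub> g \<in> carrier P" using g(1-3) c by auto
    ultimately show "\<exists>s\<in>U. s \<otimes>\<^bsub>P\<^esub> f \<in> PIdl\<^bsub>P\<^esub> F" unfolding cgenideal_def by blast
  next
    assume "\<exists>s\<in>U. s \<otimes>\<^bsub>P\<^esub> f \<in> PIdl\<^bsub>P\<^esub> F"
    then obtain s g where g: "s \<in> U" "g \<in> carrier P" "s \<otimes>\<^bsub>P\<^esub> f = g \<otimes>\<^bsub>P\<^esub> F"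
      by (auto simp: cgenideal_def)
    have "loc_frac P U f \<one>\<^bsub>P\<^esub> = loc_frac P U (g \<otimes>\<^bsub>P\<^esub> F) s"
      using g c by (intro LR.frac_eqI) (auto simp: P.m_comm simp flip: g(3))
    then show "\<exists>g\<in>carrier P. \<exists>s\<in>U. loc_frac P U f \<one>\<^bsub>P\<^esub> = loc_frac P U (g \<otimes>\<^bsub>P\<^esub> F) s"
      using g by blast
  qed
  finally show ?thesis .
qed

lemma theta_unit: assumes "s \<in> U" shows "\<theta> s \<in> Units Q"
proof -
  note c = LR.S_carrier LR.S_mult LR.S_one LR.frac_closed assms
  let ?y = "IF +>\<^bsub>LA\<^esub> loc_frac P U \<one>\<^bsub>P\<^esub> s"
  have y: "?y \<in> carrier Q"
    using c by (auto simp: Q_eq quotient_algebra_carrier[OF LR.loc_algebra IF_ideal])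
  have "\<theta> s \<otimes>\<^bsub>Q\<^esub> ?y = IF +>\<^bsub>LA\<^esub> loc_frac P U s s"
    using c by (simp add: theta_eq Q_eq quotient_algebra_mult[OF LR.loc_algebra IF_ideal] LR.loc_mult)
  also have "loc_frac P U s s = loc_frac P U \<one>\<^bsub>P\<^esub> \<one>\<^bsub>P\<^esub>"
    using c by (intro LR.frac_eqI) auto
  finally have "\<theta> s \<otimes>\<^bsub>Q\<^esub> ?y = \<one>\<^bsub>Q\<^esub>"
    by (simp only: theta_eq[symmetric] theta.hom_one)
  moreover have "\<theta> s \<in> carrier Q" using c by (intro theta.hom_closed) auto
  ultimately show ?thesis using y Q.m_comm[of "\<theta> s" ?y] unfolding Units_def by auto
qed

lemma Q_fraction:
  assumes "x \<in> carrier Q"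
  shows "\<exists>f\<in>carrier P. \<exists>s\<in>U. \<theta> s \<otimes>\<^bsub>Q\<^esub> x = \<theta> f"
proof -
  note c = LR.S_carrier LR.S_mult LR.S_one LR.frac_closed
  obtain f s where fs: "f \<in> carrier P" "s \<in> U" "x = IF +>\<^bsub>LA\<^esub> loc_frac P U f s"
    using assms by (auto simp: Q_eq quotient_algebra_carrier[OF LR.loc_algebra IF_ideal] LR.loc_carrier)
  have "\<theta> s \<otimes>\<^bsub>Q\<^esub> x = IF +>\<^bsub>LA\<^esub> loc_frac P U (s \<otimes>\<^bsub>P\<^esub> f) (\<one>\<^bsub>P\<^esub> \<otimes>\<^bsub>P\<^esub> s)"
    using c fs by (simp add: theta_eq Q_eq quotient_algebra_mult[OF LR.loc_algebra IF_ideal] LR.loc_mult)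
  also have "loc_frac P U (s \<otimes>\<^bsub>P\<^esub> f) (\<one>\<^bsub>P\<^esub> \<otimes>\<^bsub>P\<^esub> s) = loc_frac P U f \<one>\<^bsub>P\<^esub>"
    using c fs by (intro LR.frac_eqI) (auto simp: P.m_comm)
  finally show ?thesis using fs by (auto simp: theta_eq)
qed

lemma theta_minus:
  assumes "f \<in> carrier P" "g \<in> carrier P"
  shows "\<theta> (f \<ominus>\<^bsub>P\<^esub> g) = \<theta> f \<ominus>\<^bsub>Q\<^esub> \<theta> g"
  unfolding P.minus_eq Q.M.minus_eq
  using assms by (simp only: theta.hom_add theta.hom_a_inv P.a_inv_closed)

lemma theta_PIdl: "f \<in> PIdl\<^bsub>P\<^esub> F \<Longrightarrow> \<theta> f = \<zero>\<^bsub>Q\<^esub>"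
  using theta_zero_iff[of f] PIdl_closed[of f] LR.S_one P.l_one[of f] by metis

lemma theta_inverse:
  assumes "s \<in> carrier P" "g \<in> carrier P" "s \<otimes>\<^bsub>P\<^esub> g \<ominus>\<^bsub>P\<^esub> \<one>\<^bsub>P\<^esub> \<in> PIdl\<^bsub>P\<^esub> F"
  shows "\<theta> s \<otimes>\<^bsub>Q\<^esub> \<theta> g = \<one>\<^bsub>Q\<^esub>"
proof -
  have "\<theta> (s \<otimes>\<^bsub>P\<^esub> g \<ominus>\<^bsub>P\<^esub> \<one>\<^bsub>P\<^esub>) = \<zero>\<^bsub>Q\<^esub>"
    using assms by (intro theta_PIdl)
  also have "\<theta> (s \<otimes>\<^bsub>P\<^esub> g \<ominus>\<^bsub>P\<^esub> \<one>\<^bsub>P\<^esub>) = \<theta> s \<otimes>\<^bsub>Q\<^esub> \<theta> g \<ominus>\<^bsub>Q\<^esub> \<one>\<^bsub>Q\<^esub>"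
    using assms(1,2) by (simp only: theta_minus theta.hom_mult theta.hom_one P.m_closed P.one_closed)
  finally show ?thesis by (rule Q.M.minus_zero_imp_eq[rotated 2]) (use assms(1,2) in auto)
qed

lemma Q_unit_mod_surj:
  assumes u: "\<forall>s\<in>U. unit_mod s" and x: "x \<in> carrier Q"
  shows "\<exists>f\<in>carrier P. x = \<theta> f"
proof -
  obtain f s where fs: "f \<in> carrier P" "s \<in> U" "\<theta> s \<otimes>\<^bsub>Q\<^esub> x = \<theta> f" using Q_fraction[OF x] by blast
  have s: "s \<in> carrier P" using fs LR.S_carrier by auto
  obtain g where g: "g \<in> carrier P" "s \<otimes>\<^bsub>P\<^esub> g \<ominus>\<^bsub>P\<^esub> \<one>\<^bsub>P\<^esub> \<in> PIdl\<^bsub>P\<^esub> F"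
    using u fs(2) by (auto simp: unit_mod_def)
  have cl: "\<theta> s \<in> carrier Q" "\<theta> g \<in> carrier Q" using s g(1) by (auto intro: theta.hom_closed)
  have "x = (\<theta> s \<otimes>\<^bsub>Q\<^esub> \<theta> g) \<otimes>\<^bsub>Q\<^esub> x"
    unfolding theta_inverse[OF s g] using x by (rule Q.l_one[symmetric])
  also have "\<dots> = \<theta> g \<otimes>\<^bsub>Q\<^esub> (\<theta> s \<otimes>\<^bsub>Q\<^esub> x)"
    unfolding Q.m_comm[OF cl] using cl x by (intro Q.m_assoc)
  also have "\<dots> = \<theta> (g \<otimes>\<^bsub>P\<^esub> f)" unfolding fs(3) using g(1) fs(1) by (rule theta.hom_mult[symmetric])
  finally show ?thesis using fs(1) g(1) by blast
qed

text \<open>Once the elements of \<open>U\<close> are invertible modulo \<open>F\<close>, localizing does not enlarge the kernel.\<close>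

lemma theta_zero_iff_unit_mod:
  assumes u: "\<forall>s\<in>U. unit_mod s" and f: "f \<in> carrier P"
  shows "\<theta> f = \<zero>\<^bsub>Q\<^esub> \<longleftrightarrow> f \<in> PIdl\<^bsub>P\<^esub> F"
proof
  interpret I: ideal "PIdl\<^bsub>P\<^esub> F" P by (rule PIdl_ideal)
  assume "\<theta> f = \<zero>\<^bsub>Q\<^esub>"
  then obtain s where s: "s \<in> U" "s \<otimes>\<^bsub>P\<^esub> f \<in> PIdl\<^bsub>P\<^esub> F" using theta_zero_iff[OF f] by blast
  then obtain g where g: "g \<in> carrier P" "s \<otimes>\<^bsub>P\<^esub> g \<ominus>\<^bsub>P\<^esub> \<one>\<^bsub>P\<^esub> \<in> PIdl\<^bsub>P\<^esub> F"
    using u by (auto simp: unit_mod_def)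
  have sc: "s \<in> carrier P" using s LR.S_carrier by auto
  have "g \<otimes>\<^bsub>P\<^esub> (s \<otimes>\<^bsub>P\<^esub> f) \<ominus>\<^bsub>P\<^esub> f \<otimes>\<^bsub>P\<^esub> (s \<otimes>\<^bsub>P\<^esub> g \<ominus>\<^bsub>P\<^esub> \<one>\<^bsub>P\<^esub>) \<in> PIdl\<^bsub>P\<^esub> F"
    unfolding P.minus_eq[of "g \<otimes>\<^bsub>P\<^esub> (s \<otimes>\<^bsub>P\<^esub> f)"]
    using I.I_l_closed[OF s(2) g(1)] I.I_l_closed[OF g(2) f] by (intro I.a_closed I.a_inv_closed)
  also have "g \<otimes>\<^bsub>P\<^esub> (s \<otimes>\<^bsub>P\<^esub> f) \<ominus>\<^bsub>P\<^esub> f \<otimes>\<^bsub>P\<^esub> (s \<otimes>\<^bsub>P\<^esub> g \<ominus>\<^bsub>P\<^esub> \<one>\<^bsub>P\<^esub>)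
      = f \<otimes>\<^bsub>P\<^esub> (s \<otimes>\<^bsub>P\<^esub> g) \<ominus>\<^bsub>P\<^esub> f \<otimes>\<^bsub>P\<^esub> (s \<otimes>\<^bsub>P\<^esub> g \<ominus>\<^bsub>P\<^esub> \<one>\<^bsub>P\<^esub>)"
    using sc g(1) f by (simp add: P.m_ac)
  also have "\<dots> = f"
    using sc g(1) f by (simp add: P.minus_eq P.r_distr P.r_minus P.minus_add P.r_neg1 P.r_neg2)
  finally show "f \<in> PIdl\<^bsub>P\<^esub> F" .
next
  assume "f \<in> PIdl\<^bsub>P\<^esub> F"
  then show "\<theta> f = \<zero>\<^bsub>Q\<^esub>" by (rule theta_PIdl)
qed

lemma theta_comb:
  assumes "c \<in> {..<n} \<rightarrow> carrier R"
  shows "(\<Oplus>\<^bsub>Q\<^esub>i\<in>{..<n}. c i \<odot>\<^bsub>Q\<^esub> \<theta> (X i)) = \<theta> (comb c)"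
proof -
  have "\<theta> (comb c) = (\<Oplus>\<^bsub>Q\<^esub>i\<in>{..<n}. \<theta> (c i \<odot>\<^bsub>P\<^esub> X i))"
    unfolding comb_def using assms by (subst theta.hom_finsum) (auto simp: comp_def)
  also have "\<dots> = (\<Oplus>\<^bsub>Q\<^esub>i\<in>{..<n}. c i \<odot>\<^bsub>Q\<^esub> \<theta> (X i))"
    using assms by (intro Q.M.finsum_cong') (auto intro!: theta_smult theta.hom_closed Q.smult_closed)
  finally show ?thesis by simp
qed

lemma theta_remainder: "f \<in> carrier P \<Longrightarrow> \<theta> (remainder f) = \<theta> f"
proof -
  assume f: "f \<in> carrier P"
  then obtain q where q: "q \<in> carrier P" "f = F \<otimes>\<^bsub>P\<^esub> q \<oplus>\<^bsub>P\<^esub> remainder f" using remainder_props by metis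
  have "F \<otimes>\<^bsub>P\<^esub> q \<in> PIdl\<^bsub>P\<^esub> F" using q(1) by (simp add: mem_PIdl_iff remainder_multiple)
  then have "\<theta> (F \<otimes>\<^bsub>P\<^esub> q) = \<zero>\<^bsub>Q\<^esub>"
    by (rule theta_PIdl)
  then have "\<theta> (F \<otimes>\<^bsub>P\<^esub> q \<oplus>\<^bsub>P\<^esub> remainder f) = \<theta> (remainder f)"
    using q(1) f by (subst theta.hom_add) (auto simp del: theta.hom_mult intro!: Q.M.l_zero theta.hom_closed)
  with q(2) show ?thesis by simp
qed

text \<open>The inverse of \<open>\<theta> s\<close> is some \<open>\<theta> g\<close>, and \<open>s g - 1\<close> is in the kernel.\<close>

lemma unit_modI_theta:
  assumes s: "s \<in> U" and surj: "\<And>x. x \<in> carrier Q \<Longrightarrow> \<exists>f\<in>carrier P. x = \<theta> f"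
    and inj: "\<And>f. f \<in> carrier P \<Longrightarrow> \<theta> f = \<zero>\<^bsub>Q\<^esub> \<Longrightarrow> f \<in> PIdl\<^bsub>P\<^esub> F"
  shows "unit_mod s"
proof -
  have sc: "s \<in> carrier P" using s LR.S_carrier by auto
  obtain x where x: "x \<in> carrier Q" "\<theta> s \<otimes>\<^bsub>Q\<^esub> x = \<one>\<^bsub>Q\<^esub>"
    using theta_unit[OF s] unfolding Units_def by blast
  then obtain g where g: "g \<in> carrier P" "x = \<theta> g" using surj by blast
  have "\<theta> (s \<otimes>\<^bsub>P\<^esub> g \<ominus>\<^bsub>P\<^esub> \<one>\<^bsub>P\<^esub>) = \<theta> s \<otimes>\<^bsub>Q\<^esub> \<theta> g \<ominus>\<^bsub>Q\<^esub> \<one>\<^bsub>Q\<^esub>"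
    using sc g by (simp only: theta_minus theta.hom_mult theta.hom_one P.m_closed P.one_closed)
  also have "\<dots> = \<zero>\<^bsub>Q\<^esub>" using x g by (simp add: Q.M.minus_eq Q.M.r_neg)
  finally have "s \<otimes>\<^bsub>P\<^esub> g \<ominus>\<^bsub>P\<^esub> \<one>\<^bsub>P\<^esub> \<in> PIdl\<^bsub>P\<^esub> F" using sc g by (intro inj) auto
  with g show ?thesis by (auto simp: unit_mod_def)
qed

text \<open>By division with remainder, the combinations of \<open>1, X, \<dots>, X\<^sup>n\<^sup>-\<^sup>1\<close> represent each class modulo \<open>F\<close>
  exactly once. So spanning means that \<open>\<theta>\<close> is surjective, and independence that its kernel is \<open>(F)\<close>.\<close>

lemma basis_iff_unit_mod:
  "module_basis R Q {..<n} (\<lambda>i. \<theta> (X i)) \<longleftrightarrow> (\<forall>s\<in>U. unit_mod s)"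
proof
  assume B: "module_basis R Q {..<n} (\<lambda>i. \<theta> (X i))"
  show "\<forall>s\<in>U. unit_mod s"
  proof
    fix s assume "s \<in> U"
    then show "unit_mod s"
    proof (rule unit_modI_theta)
      fix x assume x: "x \<in> carrier Q"
      have "\<forall>x\<in>carrier Q. \<exists>c\<in>{..<n} \<rightarrow> carrier R. x = (\<Oplus>\<^bsub>Q\<^esub>i\<in>{..<n}. c i \<odot>\<^bsub>Q\<^esub> \<theta> (X i))"
        using B unfolding module_basis_def by (elim conjE)
      from bspec[OF this x] obtain c
        where "c \<in> {..<n} \<rightarrow> carrier R" "x = (\<Oplus>\<^bsub>Q\<^esub>i\<in>{..<n}. c i \<odot>\<^bsub>Q\<^esub> \<theta> (X i))"
        by (elim bexE)
      then show "\<exists>f\<in>carrier P. x = \<theta> f" using theta_comb comb_closed by auto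
    next
      \<comment> \<open>Independence forces the remainder of \<open>f\<close> to vanish.\<close>
      fix f assume f: "f \<in> carrier P" "\<theta> f = \<zero>\<^bsub>Q\<^esub>"
      let ?c = "coeff P (remainder f)"
      have c: "?c \<in> {..<n} \<rightarrow> carrier R" using f by auto
      have z: "(\<Oplus>\<^bsub>Q\<^esub>i\<in>{..<n}. ?c i \<odot>\<^bsub>Q\<^esub> \<theta> (X i)) = \<zero>\<^bsub>Q\<^esub>"
        using f theta_comb[OF c] comb_coeff[OF remainder_props(1)[OF f(1)]] theta_remainder[OF f(1)] by simp
      have "\<forall>c\<in>{..<n} \<rightarrow> carrier R. (\<Oplus>\<^bsub>Q\<^esub>i\<in>{..<n}. c i \<odot>\<^bsub>Q\<^esub> \<theta> (X i)) = \<zero>\<^bsub>Q\<^esub> \<longrightarrow>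
          (\<forall>i\<in>{..<n}. c i = \<zero>)"
        using B unfolding module_basis_def by (elim conjE)
      from bspec[OF this c] z have "\<forall>i\<in>{..<n}. ?c i = \<zero>" by (rule mp)
      then have "remainder f = \<zero>\<^bsub>P\<^esub>"
        using f remainder_props(1)[OF f(1)]
        by (intro up_eqI) (simp_all add: low_def Ball_def, metis not_le)
      then show "f \<in> PIdl\<^bsub>P\<^esub> F" using f by (simp add: mem_PIdl_iff)
    qed
  qed
next
  assume u: "\<forall>s\<in>U. unit_mod s"
  show "module_basis R Q {..<n} (\<lambda>i. \<theta> (X i))"
    unfolding module_basis_def
  proof (intro conjI ballI impI)
    fix x assume "x \<in> carrier Q"
    then obtain f where f: "f \<in> carrier P" "x = \<theta> f" using Q_unit_mod_surj[OF u] by blast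
    have c: "coeff P (remainder f) \<in> {..<n} \<rightarrow> carrier R" using f by auto
    have "x = (\<Oplus>\<^bsub>Q\<^esub>i\<in>{..<n}. coeff P (remainder f) i \<odot>\<^bsub>Q\<^esub> \<theta> (X i))"
      using f theta_comb[OF c] comb_coeff[OF remainder_props(1)[OF f(1)]] theta_remainder[OF f(1)] by simp
    with c show "\<exists>c\<in>{..<n} \<rightarrow> carrier R. x = (\<Oplus>\<^bsub>Q\<^esub>i\<in>{..<n}. c i \<odot>\<^bsub>Q\<^esub> \<theta> (X i))" by blast
  next
    fix c i assume c: "c \<in> {..<n} \<rightarrow> carrier R" "(\<Oplus>\<^bsub>Q\<^esub>i\<in>{..<n}. c i \<odot>\<^bsub>Q\<^esub> \<theta> (X i)) = \<zero>\<^bsub>Q\<^esub>" and i: "i \<in> {..<n}"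
    have "comb c \<in> PIdl\<^bsub>P\<^esub> F"
      using theta_zero_iff_unit_mod[OF u comb_closed[OF c(1)]] theta_comb[OF c(1)] c(2) by simp
    then have "comb c = \<zero>\<^bsub>P\<^esub>"
      using mem_PIdl_iff[OF comb_closed[OF c(1)]] remainder_low[OF low_comb[OF c(1)]] by simp
    then show "c i = \<zero>" using coeff_comb[OF c(1), of i] i by simp
  qed (auto intro: theta.hom_closed)
qed

lemma PIdl_coset:
  assumes "f \<in> carrier P" "g \<in> PIdl\<^bsub>P\<^esub> F +>\<^bsub>P\<^esub> f"
  shows "\<theta> g = \<theta> f"
proof -
  obtain h where h: "h \<in> PIdl\<^bsub>P\<^esub> F" "g = h \<oplus>\<^bsub>P\<^esub> f"
    using assms(2) by (auto simp: a_r_coset_def r_coset_def)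
  have "\<theta> h = \<zero>\<^bsub>Q\<^esub>"
    using h by (intro theta_PIdl)
  then show ?thesis
    using h PIdl_closed assms by (auto intro!: Q.M.l_zero theta.hom_closed)
qed

lemma canonical_map_coset:
  assumes "f \<in> carrier P"
  shows "canonical_map R U F (PIdl\<^bsub>P\<^esub> F +>\<^bsub>P\<^esub> f) = \<theta> f"
proof -
  interpret I: ideal "PIdl\<^bsub>P\<^esub> F" P by (rule PIdl_ideal)
  have "\<theta> ` (PIdl\<^bsub>P\<^esub> F +>\<^bsub>P\<^esub> f) = {\<theta> f}"
    using PIdl_coset[OF assms] I.a_rcos_self[OF assms] by blast
  then show ?thesis by (simp add: canonical_map_def)
qed

lemma canonical_iso_iff_unit_mod:
  "canonical_map R U F \<in> ring_iso (P Quot PIdl\<^bsub>P\<^esub> F) Q \<longleftrightarrow> (\<forall>s\<in>U. unit_mod s)"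
    (is "?h \<in> ring_iso ?K Q \<longleftrightarrow> _")
proof -
  interpret I: ideal "PIdl\<^bsub>P\<^esub> F" P by (rule PIdl_ideal)
  let ?\<pi> = "\<lambda>f. PIdl\<^bsub>P\<^esub> F +>\<^bsub>P\<^esub> f"
  have K: "carrier ?K = ?\<pi> ` carrier P"
    by (auto simp: FactRing_def A_RCOSETS_def RCOSETS_def a_r_coset_def)
  have h: "?h (?\<pi> f) = \<theta> f" if "f \<in> carrier P" for f using canonical_map_coset[OF that] .
  have hom: "?h \<in> ring_hom ?K Q"
  proof (rule ring_hom_memI)
    fix x assume "x \<in> carrier ?K"
    then show "?h x \<in> carrier Q" using K h by (auto intro: theta.hom_closed)
  next
    fix x y assume "x \<in> carrier ?K" "y \<in> carrier ?K"
    then obtain f g where fg: "f \<in> carrier P" "g \<in> carrier P" "x = ?\<pi> f" "y = ?\<pi> g" using K by auto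
    show "?h (x \<otimes>\<^bsub>?K\<^esub> y) = ?h x \<otimes>\<^bsub>Q\<^esub> ?h y"
      using fg h[of f] h[of g] h[of "f \<otimes>\<^bsub>P\<^esub> g"] by (simp add: FactRing_def I.rcoset_mult_add)
    show "?h (x \<oplus>\<^bsub>?K\<^esub> y) = ?h x \<oplus>\<^bsub>Q\<^esub> ?h y"
      using fg h[of f] h[of g] h[of "f \<oplus>\<^bsub>P\<^esub> g"] by (simp add: FactRing_def I.a_rcos_sum)
  next
    show "?h \<one>\<^bsub>?K\<^esub> = \<one>\<^bsub>Q\<^esub>" using h[of "\<one>\<^bsub>P\<^esub>"] theta.hom_one by (simp add: FactRing_def)
  qed
  have eq: "?\<pi> f = ?\<pi> g \<longleftrightarrow> f \<ominus>\<^bsub>P\<^esub> g \<in> PIdl\<^bsub>P\<^esub> F" if "f \<in> carrier P" "g \<in> carrier P" for f g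
    using that P.quotient_eq_iff_same_a_r_cos[OF PIdl_ideal] by blast
  have "bij_betw ?h (carrier ?K) (carrier Q) \<longleftrightarrow> (\<forall>s\<in>U. unit_mod s)"
  proof
    assume b: "bij_betw ?h (carrier ?K) (carrier Q)"
    show "\<forall>s\<in>U. unit_mod s"
    proof
      fix s assume "s \<in> U"
      then show "unit_mod s"
      proof (rule unit_modI_theta)
        fix x assume "x \<in> carrier Q"
        then obtain y where "y \<in> carrier ?K" "x = ?h y" using b by (auto simp: bij_betw_def)
        then show "\<exists>f\<in>carrier P. x = \<theta> f" using K h by auto
      next
        fix f assume f: "f \<in> carrier P" "\<theta> f = \<zero>\<^bsub>Q\<^esub>"
        have "?h (?\<pi> f) = ?h (?\<pi> \<zero>\<^bsub>P\<^esub>)"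
          using h[OF f(1)] h[of "\<zero>\<^bsub>P\<^esub>"] f(2) theta.hom_zero by simp
        then have "?\<pi> f = ?\<pi> \<zero>\<^bsub>P\<^esub>"
          using f(1) K by (intro inj_onD[OF bij_betw_imp_inj_on[OF b]]) auto
        then show "f \<in> PIdl\<^bsub>P\<^esub> F" using f eq[of f "\<zero>\<^bsub>P\<^esub>"] by (simp add: P.minus_eq)
      qed
    qed
  next
    assume u: "\<forall>s\<in>U. unit_mod s"
    have "?h ` carrier ?K = carrier Q"
      using Q_unit_mod_surj[OF u] ring_hom_closed[OF hom] K h by fastforce
    moreover have "inj_on ?h (carrier ?K)"
    proof (rule inj_onI)
      fix x y assume xy: "x \<in> carrier ?K" "y \<in> carrier ?K" "?h x = ?h y"
      then obtain f g where fg: "f \<in> carrier P" "g \<in> carrier P" "x = ?\<pi> f" "y = ?\<pi> g" using K by auto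
      then have "\<theta> f = \<theta> g" using xy h by simp
      then have "\<theta> (f \<ominus>\<^bsub>P\<^esub> g) = \<zero>\<^bsub>Q\<^esub>" using fg by (simp add: theta_minus Q.M.minus_eq Q.M.r_neg)
      then show "x = y" using theta_zero_iff_unit_mod[OF u] fg eq by simp
    qed
    ultimately show "bij_betw ?h (carrier ?K) (carrier Q)" by (simp add: bij_betw_def)
  qed
  then show ?thesis using hom by (simp add: ring_iso_def)
qed

end

end

section \<open>Alternating sums over permutations\<close>

definition psign :: "('a, 'm) ring_scheme \<Rightarrow> (nat \<Rightarrow> nat) \<Rightarrow> 'a" where
  "psign R p = (if evenperm p then \<one>\<^bsub>R\<^esub> else \<ominus>\<^bsub>R\<^esub> \<one>\<^bsub>R\<^esub>)"

definition perms :: "nat \<Rightarrow> (nat \<Rightarrow> nat) set" where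
  "perms n = {p. p permutes {1..n}}"

lemma perms_iff: "p \<in> perms n \<longleftrightarrow> p permutes {1..n}"
  by (simp add: perms_def)

lemma finite_perms [simp]: "finite (perms n)"
  unfolding perms_def by (rule finite_permutations) simp

lemma perms_mem: "p \<in> perms n \<Longrightarrow> j \<in> {1..n} \<Longrightarrow> p j \<in> {1..n}"
  by (metis perms_iff permutes_in_image)

lemma perms_bij: "p \<in> perms n \<Longrightarrow> bij_betw p {1..n} {1..n}"
  by (simp add: perms_iff permutes_imp_bij)

lemma transpose_perms: "i \<in> {1..n} \<Longrightarrow> j \<in> {1..n} \<Longrightarrow> transpose i j \<in> perms n"
  by (simp add: perms_iff permutes_swap_id)

lemma perms_permutation: "p \<in> perms n \<Longrightarrow> permutation p"
  using permutation_permutes finite_atLeastAtMost perms_iff by blast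

lemma bij_perms_compose_right: "q \<in> perms n \<Longrightarrow> bij_betw (\<lambda>p. p \<circ> q) (perms n) (perms n)"
  by (rule bij_betw_byWitness[where f' = "\<lambda>p. p \<circ> Hilbert_Choice.inv q"])
    (auto simp: perms_iff permutes_compose permutes_inv comp_assoc permutes_inv_o)

lemma bij_perms_compose_left: "q \<in> perms n \<Longrightarrow> bij_betw (\<lambda>p. q \<circ> p) (perms n) (perms n)"
  by (rule bij_betw_byWitness[where f' = "\<lambda>p. Hilbert_Choice.inv q \<circ> p"])
    (auto simp: perms_iff permutes_compose permutes_inv permutes_inv_o simp flip: comp_assoc)

context cring
begin

lemma psign_closed [simp]: "psign R p \<in> carrier R"
  by (simp add: psign_def)

lemma psign_id [simp]: "psign R id = \<one>"
  by (simp add: psign_def)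

lemma psign_compose:
  "p \<in> perms n \<Longrightarrow> q \<in> perms n \<Longrightarrow> psign R (p \<circ> q) = psign R p \<otimes> psign R q"
  by (auto simp: psign_def evenperm_comp perms_permutation l_minus)

text \<open>A sign-reversing bijection matches even with odd permutations; cancelling the matched terms
  is valid in every characteristic.\<close>

lemma alternating_sum_zero:
  assumes \<psi>: "bij_betw \<psi> (perms n) (perms n)"
    and odd: "\<And>p. p \<in> perms n \<Longrightarrow> evenperm (\<psi> p) \<longleftrightarrow> \<not> evenperm p"
    and inv: "\<And>p. p \<in> perms n \<Longrightarrow> \<Phi> (\<psi> p) = \<Phi> p"
    and cl: "\<And>p. p \<in> perms n \<Longrightarrow> \<Phi> p \<in> carrier R"
  shows "(\<Oplus>p\<in>perms n. psign R p \<otimes> \<Phi> p) = \<zero>"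
proof -
  let ?E = "{p \<in> perms n. evenperm p}" and ?O = "{p \<in> perms n. \<not> evenperm p}"
  have EO: "perms n = ?E \<union> ?O" "?E \<inter> ?O = {}" "finite ?E" "finite ?O" by auto
  have bij: "bij_betw \<psi> ?E ?O"
  proof -
    have "inj_on \<psi> ?E" using \<psi> by (auto simp: bij_betw_def inj_on_def)
    moreover have "\<psi> ` ?E = ?O"
    proof
      show "\<psi> ` ?E \<subseteq> ?O" using odd bij_betwE[OF \<psi>] by blast
      show "?O \<subseteq> \<psi> ` ?E"
      proof
        fix q assume q: "q \<in> ?O"
        then obtain p where "p \<in> perms n" "q = \<psi> p" using \<psi> by (auto simp: bij_betw_def)
        with q odd show "q \<in> \<psi> ` ?E" by auto
      qed
    qed
    ultimately show ?thesis by (simp add: bij_betw_def)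
  qed
  have E: "(\<Oplus>p\<in>?E. psign R p \<otimes> \<Phi> p) = (\<Oplus>p\<in>?E. \<Phi> p)"
    using cl by (intro finsum_cong') (auto simp: psign_def)
  have "(\<Oplus>p\<in>?O. psign R p \<otimes> \<Phi> p) = (\<Oplus>p\<in>?O. (\<ominus> \<one>) \<otimes> \<Phi> p)"
    using cl by (intro finsum_cong') (auto simp: psign_def)
  also have "\<dots> = (\<ominus> \<one>) \<otimes> (\<Oplus>p\<in>?O. \<Phi> p)"
    using cl by (intro finsum_rdistr[symmetric]) auto
  also have "(\<Oplus>p\<in>?O. \<Phi> p) = (\<Oplus>p\<in>?E. \<Phi> (\<psi> p))"
    using cl by (intro add.finprod_reindex_bij[OF bij]) auto
  also have "\<dots> = (\<Oplus>p\<in>?E. \<Phi> p)"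
    using inv cl by (intro finsum_cong') auto
  finally have O: "(\<Oplus>p\<in>?O. psign R p \<otimes> \<Phi> p) = (\<ominus> \<one>) \<otimes> (\<Oplus>p\<in>?E. \<Phi> p)" .
  have "(\<Oplus>p\<in>perms n. psign R p \<otimes> \<Phi> p) = (\<Oplus>p\<in>?E. psign R p \<otimes> \<Phi> p) \<oplus> (\<Oplus>p\<in>?O. psign R p \<otimes> \<Phi> p)"
    using EO cl by (subst EO(1), intro finsum_Un_disjoint) auto
  also have "\<dots> = \<zero>"
    unfolding E O using cl by (subst l_minus) (auto simp: r_neg intro!: finsum_closed)
  finally show ?thesis .
qed

lemma alternating_sum_transpose_right:
  assumes "i \<in> {1..n}" "j \<in> {1..n}" "i \<noteq> j"
    and "\<And>p. p \<in> perms n \<Longrightarrow> \<Phi> (p \<circ> transpose i j) = \<Phi> p"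
    and "\<And>p. p \<in> perms n \<Longrightarrow> \<Phi> p \<in> carrier R"
  shows "(\<Oplus>p\<in>perms n. psign R p \<otimes> \<Phi> p) = \<zero>"
  using assms transpose_perms[OF assms(1,2)]
  by (intro alternating_sum_zero[OF bij_perms_compose_right[of "transpose i j"]])
    (auto simp: evenperm_comp perms_permutation permutation_swap_id evenperm_swap)

lemma alternating_sum_transpose_left:
  assumes "i \<in> {1..n}" "j \<in> {1..n}" "i \<noteq> j"
    and "\<And>p. p \<in> perms n \<Longrightarrow> \<Phi> (transpose i j \<circ> p) = \<Phi> p"
    and "\<And>p. p \<in> perms n \<Longrightarrow> \<Phi> p \<in> carrier R"
  shows "(\<Oplus>p\<in>perms n. psign R p \<otimes> \<Phi> p) = \<zero>"
  using assms transpose_perms[OF assms(1,2)]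
  by (intro alternating_sum_zero[OF bij_perms_compose_left[of "transpose i j"]])
    (auto simp: evenperm_comp perms_permutation permutation_swap_id evenperm_swap)

end

section \<open>Coordinates modulo a monic polynomial\<close>

context monic_polynomial
begin

text \<open>Coordinates with respect to \<open>1, X, \<dots>, X\<^sup>n\<^sup>-\<^sup>1\<close>, numbered from \<open>1\<close> to \<open>n\<close> like the factors of a tensor.\<close>

definition coord where "coord k f = coeff P (remainder f) (k - 1)"

lemma coord_closed [simp]: "f \<in> carrier P \<Longrightarrow> coord k f \<in> carrier R"
  by (simp add: coord_def)

lemma coord_add: "f \<in> carrier P \<Longrightarrow> g \<in> carrier P \<Longrightarrow> coord k (f \<oplus>\<^bsub>P\<^esub> g) = coord k f \<oplus> coord k g"
  by (simp add: coord_def remainder_add)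

lemma coord_smult: "a \<in> carrier R \<Longrightarrow> f \<in> carrier P \<Longrightarrow> coord k (a \<odot>\<^bsub>P\<^esub> f) = a \<otimes> coord k f"
  by (simp add: coord_def remainder_smult)

lemma coord_zero [simp]: "coord k \<zero>\<^bsub>P\<^esub> = \<zero>"
  using coord_smult[of \<zero> "\<zero>\<^bsub>P\<^esub>" k] by simp

lemma coord_finsum:
  assumes "finite A" "\<And>i. i \<in> A \<Longrightarrow> p i \<in> carrier P"
  shows "coord k (\<Oplus>\<^bsub>P\<^esub>i\<in>A. p i) = (\<Oplus>i\<in>A. coord k (p i))"
  using assms by (induction A rule: finite_induct) (auto simp: coord_add Pi_iff intro!: P.finsum_closed)

lemma coord_X:
  assumes "m < n" "k \<ge> 1" shows "coord k (X m) = (if k = Suc m then \<one> else \<zero>)"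
proof -
  have "low (X m)" using assms by (auto simp: low_def)
  then show ?thesis using assms by (auto simp: coord_def remainder_low)
qed

lemma coord_eq_zero_iff:
  assumes "f \<in> carrier P"
  shows "(\<forall>k\<in>{1..n}. coord k f = \<zero>) \<longleftrightarrow> f \<in> PIdl\<^bsub>P\<^esub> F"
proof
  assume z: "\<forall>k\<in>{1..n}. coord k f = \<zero>"
  have "remainder f = \<zero>\<^bsub>P\<^esub>"
  proof (rule up_eqI)
    fix m show "coeff P (remainder f) m = coeff P \<zero>\<^bsub>P\<^esub> m"
    proof (cases "m < n")
      case True
      then show ?thesis using bspec[OF z, of "Suc m"] by (simp add: coord_def)
    next
      case False
      then show ?thesis using remainder_props(1)[OF assms] by (simp add: low_def)
    qed
  qed (use assms in auto)
  then show "f \<in> PIdl\<^bsub>P\<^esub> F" using assms by (simp add: mem_PIdl_iff)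
next
  assume "f \<in> PIdl\<^bsub>P\<^esub> F"
  then show "\<forall>k\<in>{1..n}. coord k f = \<zero>" using assms by (simp add: mem_PIdl_iff coord_def)
qed

lemma bij_Suc: "bij_betw Suc {..<n} {1..n}"
  by (rule bij_betw_byWitness[where f' = "\<lambda>i. i - 1"]) auto

text \<open>The coordinates of \<open>f X\<^sup>i\<^sup>-\<^sup>1\<close> are the columns of the matrix of multiplication by \<open>f\<close>.\<close>

lemma coord_mult:
  assumes "f \<in> carrier P" "g \<in> carrier P"
  shows "coord k (f \<otimes>\<^bsub>P\<^esub> g) = (\<Oplus>i\<in>{1..n}. coord i g \<otimes> coord k (f \<otimes>\<^bsub>P\<^esub> X (i - 1)))"
proof -
  let ?c = "coeff P (remainder g)"
  have c: "?c \<in> {..<n} \<rightarrow> carrier R" using assms by auto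
  have "coord k (f \<otimes>\<^bsub>P\<^esub> g) = coord k (f \<otimes>\<^bsub>P\<^esub> comb ?c)"
    using assms by (simp add: comb_coeff remainder_props(1) coord_def remainder_mult)
  also have "f \<otimes>\<^bsub>P\<^esub> comb ?c = (\<Oplus>\<^bsub>P\<^esub>i\<in>{..<n}. f \<otimes>\<^bsub>P\<^esub> (?c i \<odot>\<^bsub>P\<^esub> X i))"
    unfolding comb_def using assms c by (intro P.finsum_rdistr) auto
  also have "\<dots> = (\<Oplus>\<^bsub>P\<^esub>i\<in>{..<n}. ?c i \<odot>\<^bsub>P\<^esub> (f \<otimes>\<^bsub>P\<^esub> X i))"
    using assms c by (intro P.finsum_cong') (auto simp: P.m_comm[of f] UP_smult_assoc2)
  also have "coord k \<dots> = (\<Oplus>i\<in>{..<n}. ?c i \<otimes> coord k (f \<otimes>\<^bsub>P\<^esub> X i))"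
    using assms c by (subst coord_finsum) (auto simp: coord_smult intro!: R.finsum_cong')
  also have "\<dots> = (\<Oplus>i\<in>{..<n}. coord (Suc i) g \<otimes> coord k (f \<otimes>\<^bsub>P\<^esub> X (Suc i - 1)))"
    by (simp add: coord_def)
  also have "\<dots> = (\<Oplus>i\<in>{1..n}. coord i g \<otimes> coord k (f \<otimes>\<^bsub>P\<^esub> X (i - 1)))"
    using assms by (intro R.add.finprod_reindex_bij[OF bij_Suc, symmetric]) auto
  finally show ?thesis .
qed

lemma coord_mult_cong:
  assumes "f \<in> carrier P" "g \<in> carrier P" "f \<ominus>\<^bsub>P\<^esub> g \<in> PIdl\<^bsub>P\<^esub> F" "h \<in> carrier P" "k \<in> {1..n}"
  shows "coord k (f \<otimes>\<^bsub>P\<^esub> h) = coord k (g \<otimes>\<^bsub>P\<^esub> h)"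
proof -
  interpret I: ideal "PIdl\<^bsub>P\<^esub> F" P by (rule PIdl_ideal)
  have "f \<otimes>\<^bsub>P\<^esub> h = (f \<ominus>\<^bsub>P\<^esub> g) \<otimes>\<^bsub>P\<^esub> h \<oplus>\<^bsub>P\<^esub> g \<otimes>\<^bsub>P\<^esub> h"
    using assms by (simp add: P.minus_eq P.l_distr P.l_minus P.a_assoc P.l_neg)
  moreover have "coord k ((f \<ominus>\<^bsub>P\<^esub> g) \<otimes>\<^bsub>P\<^esub> h) = \<zero>"
    using I.I_r_closed[OF assms(3,4)] assms coord_eq_zero_iff[of "(f \<ominus>\<^bsub>P\<^esub> g) \<otimes>\<^bsub>P\<^esub> h"] by auto
  ultimately show ?thesis using assms by (simp add: coord_add)
qed

text \<open>The determinant of the coordinate matrix of a tuple of polynomials.\<close>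

definition alt where
  "alt t = (\<Oplus>p\<in>perms n. psign R p \<otimes> (\<Otimes>j\<in>{1..n}. coord (p j) (t j)))"

lemma alt_closed: "t \<in> {1..n} \<rightarrow> carrier P \<Longrightarrow> alt t \<in> carrier R"
  unfolding alt_def by (intro R.finsum_closed) (auto simp: Pi_iff intro!: R.m_closed R.finprod_closed)

lemma alt_cong:
  assumes "t' \<in> {1..n} \<rightarrow> carrier P"
    "\<And>j k. j \<in> {1..n} \<Longrightarrow> k \<in> {1..n} \<Longrightarrow> coord k (t j) = coord k (t' j)"
  shows "alt t = alt t'"
proof -
  have "(\<Otimes>j\<in>{1..n}. coord (p j) (t j)) = (\<Otimes>j\<in>{1..n}. coord (p j) (t' j))" if "p \<in> perms n" for p
    using assms perms_mem[OF that] by (intro R.finprod_cong') (auto simp: Pi_iff)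
  then show ?thesis
    unfolding alt_def using assms
    by (intro R.finsum_cong') (auto simp: Pi_iff intro!: R.m_closed R.finprod_closed)
qed

lemma alt_repeated:
  assumes t: "t \<in> {1..n} \<rightarrow> carrier P" and ij: "i \<in> {1..n}" "j \<in> {1..n}" "i \<noteq> j" "t i = t j"
  shows "alt t = \<zero>"
  unfolding alt_def
proof (rule R.alternating_sum_transpose_right[OF ij(1-3)])
  fix p assume p: "p \<in> perms n"
  let ?\<tau> = "transpose i j"
  have \<tau>: "bij_betw ?\<tau> {1..n} {1..n}" using transpose_perms[OF ij(1,2)] by (rule perms_bij)
  have "(\<Otimes>m\<in>{1..n}. coord (p m) (t m)) = (\<Otimes>m\<in>{1..n}. coord (p (?\<tau> m)) (t (?\<tau> m)))"
    using t by (intro R.finprod_reindex_bij[OF \<tau>]) (auto simp: Pi_iff)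
  also have "\<dots> = (\<Otimes>m\<in>{1..n}. coord ((p \<circ> ?\<tau>) m) (t m))"
    using t ij by (intro R.finprod_cong') (auto simp: transpose_def Pi_iff)
  finally show "(\<Otimes>m\<in>{1..n}. coord ((p \<circ> ?\<tau>) m) (t m)) = (\<Otimes>m\<in>{1..n}. coord (p m) (t m))" by simp
qed (use t in \<open>auto simp: Pi_iff intro!: R.finprod_closed\<close>)

lemma alt_single:
  assumes t: "t \<in> {1..n} \<rightarrow> carrier P" and p: "p \<in> perms n"
    and z: "\<And>q. q \<in> perms n \<Longrightarrow> q \<noteq> p \<Longrightarrow> \<exists>j\<in>{1..n}. coord (q j) (t j) = \<zero>"
  shows "alt t = psign R p \<otimes> (\<Otimes>j\<in>{1..n}. coord (p j) (t j))"
  unfolding alt_def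
proof (rule R.finsum_single)
  fix q assume q: "q \<in> perms n" "q \<noteq> p"
  then obtain j where "j \<in> {1..n}" "coord (q j) (t j) = \<zero>" using z by blast
  then have "(\<Otimes>j\<in>{1..n}. coord (q j) (t j)) = \<zero>"
    using t by (intro R.finprod_zero[of _ j]) (auto simp: Pi_iff)
  then show "psign R q \<otimes> (\<Otimes>j\<in>{1..n}. coord (q j) (t j)) = \<zero>" by simp
qed (use t p in \<open>auto simp: Pi_iff intro!: R.m_closed R.finprod_closed\<close>)

lemma alt_basis: "alt (\<lambda>j. X (j - 1)) = \<one>"
proof -
  have id: "id \<in> perms n" by (simp add: perms_iff permutes_id)
  have "alt (\<lambda>j. X (j - 1)) = psign R id \<otimes> (\<Otimes>j\<in>{1..n}. coord (id j) (X (j - 1)))"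
  proof (rule alt_single[OF _ id])
    fix q assume q: "q \<in> perms n" "q \<noteq> id"
    then obtain j where j: "q j \<noteq> j" by (auto simp: fun_eq_iff)
    then have jn: "j \<in> {1..n}" using q by (metis perms_iff permutes_not_in)
    then have "coord (q j) (X (j - 1)) = \<zero>"
      using j perms_mem[OF q(1) jn] by (subst coord_X) auto
    with jn show "\<exists>j\<in>{1..n}. coord (q j) (X (j - 1)) = \<zero>" by blast
  qed simp
  also have "(\<Otimes>j\<in>{1..n}. coord (id j) (X (j - 1))) = \<one>"
    by (intro R.finprod_one_eqI) (auto simp: coord_X)
  finally show ?thesis by (simp only: R.psign_id R.r_one R.one_closed)
qed

section \<open>The determinant of multiplication by a polynomial\<close>

definition mult_det where "mult_det f = alt (\<lambda>j. f \<otimes>\<^bsub>P\<^esub> X (j - 1))"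

lemma mult_det_closed: "f \<in> carrier P \<Longrightarrow> mult_det f \<in> carrier R"
  unfolding mult_det_def by (intro alt_closed) auto

lemma mult_det_one: "mult_det \<one>\<^bsub>P\<^esub> = \<one>"
  unfolding mult_det_def using alt_basis by simp

lemma mult_det_cong:
  assumes "f \<in> carrier P" "g \<in> carrier P" "f \<ominus>\<^bsub>P\<^esub> g \<in> PIdl\<^bsub>P\<^esub> F"
  shows "mult_det f = mult_det g"
  unfolding mult_det_def using assms by (intro alt_cong coord_mult_cong) auto

text \<open>The cofactors of the first row of the matrix of multiplication by \<open>f\<close>: the terms of the determinant
  that take their factor of row \<open>1\<close> from column \<open>j\<close>, with that factor removed.\<close>

definition cofactor where
  "cofactor f j = (\<Oplus>p\<in>{p \<in> perms n. Hilbert_Choice.inv p 1 = j}. psign R p \<otimes>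
     (\<Otimes>i\<in>{1..n} - {j}. coord (p i) (f \<otimes>\<^bsub>P\<^esub> X (i - 1))))"

text \<open>Laplace expansion along the first row, with row \<open>k\<close> in its place. Replacing the value \<open>1\<close> of every permutation by \<open>k\<close> makes
  the summand invariant under the transposition of \<open>1\<close> and \<open>k\<close>, so only \<open>k = 1\<close> survives.\<close>

lemma cofactor_expansion:
  assumes f: "f \<in> carrier P" and k: "k \<in> {1..n}"
  shows "(\<Oplus>j\<in>{1..n}. cofactor f j \<otimes> coord k (f \<otimes>\<^bsub>P\<^esub> X (j - 1))) = (if k = 1 then mult_det f else \<zero>)"
proof -
  let ?t = "\<lambda>i. f \<otimes>\<^bsub>P\<^esub> X (i - 1)"
  define r where "r m = (if m = 1 then k else m)" for m :: nat
  let ?\<Phi> = "\<lambda>p. \<Otimes>i\<in>{1..n}. coord (r (p i)) (?t i)"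
  let ?h = "\<lambda>p :: nat \<Rightarrow> nat. Hilbert_Choice.inv p 1"
  have one: "(1::nat) \<in> {1..n}" using k by auto
  have cl: "(\<Otimes>i\<in>A. coord (s i) (?t i)) \<in> carrier R" for A s
    using f by (intro R.finprod_closed) auto
  have img: "?h ` perms n = {1..n}"
  proof
    show "?h ` perms n \<subseteq> {1..n}"
    proof
      fix y assume "y \<in> ?h ` perms n"
      then obtain p where "p \<in> perms n" "y = Hilbert_Choice.inv p 1" by auto
      then show "y \<in> {1..n}" using perms_mem[of "Hilbert_Choice.inv p" n 1] one by (simp add: perms_iff permutes_inv)
    qed
    show "{1..n} \<subseteq> ?h ` perms n"
      by (rule subsetI, rule_tac image_eqI[where x = "transpose 1 x" for x])
        (use transpose_perms[OF one] in \<open>auto simp: inv_equality\<close>)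
  qed
  have "cofactor f j \<otimes> coord k (?t j) = (\<Oplus>p\<in>{p \<in> perms n. ?h p = j}. psign R p \<otimes> ?\<Phi> p)"
    if j: "j \<in> {1..n}" for j
  proof -
    have "cofactor f j \<otimes> coord k (?t j)
        = (\<Oplus>p\<in>{p \<in> perms n. ?h p = j}. psign R p \<otimes> (\<Otimes>i\<in>{1..n} - {j}. coord (p i) (?t i)) \<otimes> coord k (?t j))"
      unfolding cofactor_def using f cl by (intro R.finsum_ldistr) auto
    also have "\<dots> = (\<Oplus>p\<in>{p \<in> perms n. ?h p = j}. psign R p \<otimes> ?\<Phi> p)"
    proof (rule R.finsum_cong')
      fix p assume p: "p \<in> {p \<in> perms n. ?h p = j}"
      then have bij: "bij p" using permutes_bij perms_iff by blast
      have pj: "p j = 1" using p bij by (metis (mono_tags, lifting) bij_inv_eq_iff mem_Collect_eq)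
      have "?\<Phi> p = coord (r (p j)) (?t j) \<otimes> (\<Otimes>i\<in>{1..n} - {j}. coord (r (p i)) (?t i))"
        using f j by (intro R.finprod_remove) auto
      also have "(\<Otimes>i\<in>{1..n} - {j}. coord (r (p i)) (?t i)) = (\<Otimes>i\<in>{1..n} - {j}. coord (p i) (?t i))"
      proof (rule R.finprod_cong')
        fix i assume "i \<in> {1..n} - {j}"
        then have "p i \<noteq> 1" using pj bij by (metis Diff_iff bij_def injD singletonI)
        then show "coord (r (p i)) (?t i) = coord (p i) (?t i)" by (simp add: r_def)
      qed (use f in auto)
      finally show "psign R p \<otimes> (\<Otimes>i\<in>{1..n} - {j}. coord (p i) (?t i)) \<otimes> coord k (?t j) = psign R p \<otimes> ?\<Phi> p"
        using pj f cl by (simp add: r_def R.m_ac)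
    qed (use cl in auto)
    finally show ?thesis .
  qed
  then have "(\<Oplus>j\<in>{1..n}. cofactor f j \<otimes> coord k (?t j))
      = (\<Oplus>j\<in>?h ` perms n. \<Oplus>p\<in>{p \<in> perms n. ?h p = j}. psign R p \<otimes> ?\<Phi> p)"
    unfolding img using cl by (intro R.finsum_cong') (auto intro!: R.finsum_closed)
  also have "\<dots> = (\<Oplus>p\<in>perms n. psign R p \<otimes> ?\<Phi> p)"
    using cl by (intro R.add.finprod_fibres) auto
  also have "\<dots> = (if k = 1 then mult_det f else \<zero>)"
  proof (cases "k = 1")
    case True
    then have "r m = m" for m by (simp add: r_def)
    then show ?thesis using True by (simp add: mult_det_def alt_def)
  next
    case False
    have "r (transpose 1 k m) = r m" for m by (auto simp: r_def transpose_def)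
    then have "(\<Oplus>p\<in>perms n. psign R p \<otimes> ?\<Phi> p) = \<zero>"
      using one k False cl by (intro R.alternating_sum_transpose_left[of 1 n k]) auto
    with False show ?thesis by simp
  qed
  finally show ?thesis .
qed

lemma cofactor_closed: "f \<in> carrier P \<Longrightarrow> cofactor f j \<in> carrier R"
  unfolding cofactor_def by (auto intro!: R.finsum_closed R.finprod_closed)

text \<open>Cramer's rule: the cofactors of the first row, divided by the determinant, are the coordinates of an
  inverse of \<open>f\<close> modulo \<open>F\<close>.\<close>

lemma unit_mod_of_mult_det:
  assumes f: "f \<in> carrier P" and n: "n > 0" and u: "mult_det f \<in> Units R"
  shows "unit_mod f"
proof -
  obtain d where d: "d \<in> carrier R" "d \<otimes> mult_det f = \<one>"
    using u by (auto simp: Units_def)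
  define g where "g = d \<odot>\<^bsub>P\<^esub> (\<Oplus>\<^bsub>P\<^esub>j\<in>{1..n}. cofactor f j \<odot>\<^bsub>P\<^esub> X (j - 1))"
  have s: "(\<Oplus>\<^bsub>P\<^esub>j\<in>{1..n}. cofactor f j \<odot>\<^bsub>P\<^esub> X (j - 1)) \<in> carrier P"
    using f by (intro P.finsum_closed) (auto simp: cofactor_closed)
  then have g: "g \<in> carrier P" using d by (simp add: g_def)
  have cg: "coord i g = d \<otimes> cofactor f i" if i: "i \<in> {1..n}" for i
  proof -
    have "coord i (\<Oplus>\<^bsub>P\<^esub>j\<in>{1..n}. cofactor f j \<odot>\<^bsub>P\<^esub> X (j - 1))
        = (\<Oplus>j\<in>{1..n}. coord i (cofactor f j \<odot>\<^bsub>P\<^esub> X (j - 1)))"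
      using f by (intro coord_finsum) (auto simp: cofactor_closed)
    also have "\<dots> = coord i (cofactor f i \<odot>\<^bsub>P\<^esub> X (i - 1))"
      using f i by (intro R.finsum_single) (auto simp: cofactor_closed coord_smult coord_X)
    also have "\<dots> = cofactor f i"
    proof -
      have "i - 1 < n" "i \<ge> 1" "i = Suc (i - 1)" using i by auto
      then have "coord i (X (i - 1)) = \<one>" using coord_X[of "i - 1" i] by metis
      then show ?thesis using f by (simp add: cofactor_closed coord_smult)
    qed
    finally show ?thesis using d s by (simp add: g_def coord_smult)
  qed
  have "coord k (f \<otimes>\<^bsub>P\<^esub> g) = coord k \<one>\<^bsub>P\<^esub>" if k: "k \<in> {1..n}" for k
  proof -
    have "coord k (f \<otimes>\<^bsub>P\<^esub> g) = (\<Oplus>i\<in>{1..n}. coord i g \<otimes> coord k (f \<otimes>\<^bsub>P\<^esub> X (i - 1)))"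
      using f g by (rule coord_mult)
    also have "\<dots> = (\<Oplus>i\<in>{1..n}. d \<otimes> (cofactor f i \<otimes> coord k (f \<otimes>\<^bsub>P\<^esub> X (i - 1))))"
      using f d by (intro R.finsum_cong') (auto simp: cg cofactor_closed R.m_assoc)
    also have "\<dots> = d \<otimes> (\<Oplus>i\<in>{1..n}. cofactor f i \<otimes> coord k (f \<otimes>\<^bsub>P\<^esub> X (i - 1)))"
      using f d by (intro R.finsum_rdistr[symmetric]) (auto simp: cofactor_closed)
    also have "\<dots> = (if k = 1 then \<one> else \<zero>)"
      using cofactor_expansion[OF f k] d by simp
    also have "\<dots> = coord k \<one>\<^bsub>P\<^esub>"
      using coord_X[of 0 k] n k by simp
    finally show ?thesis .
  qed
  moreover have "f \<otimes>\<^bsub>P\<^esub> g \<ominus>\<^bsub>P\<^esub> \<one>\<^bsub>P\<^esub> = f \<otimes>\<^bsub>P\<^esub> g \<oplus>\<^bsub>P\<^esub> (\<ominus> \<one>) \<odot>\<^bsub>P\<^esub> \<one>\<^bsub>P\<^esub>"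
    by (simp add: P.minus_eq smult_l_minus)
  ultimately have "\<forall>k\<in>{1..n}. coord k (f \<otimes>\<^bsub>P\<^esub> g \<ominus>\<^bsub>P\<^esub> \<one>\<^bsub>P\<^esub>) = \<zero>"
    using f g by (auto simp: coord_add coord_smult R.l_minus R.r_neg)
  then have "f \<otimes>\<^bsub>P\<^esub> g \<ominus>\<^bsub>P\<^esub> \<one>\<^bsub>P\<^esub> \<in> PIdl\<^bsub>P\<^esub> F" using f g coord_eq_zero_iff by auto
  with g show ?thesis by (auto simp: unit_mod_def)
qed

section \<open>Shifted power bases\<close>

lemma coord_X_n: "i \<in> {1..n} \<Longrightarrow> coord (n - i + 1) (X n) = \<ominus> coeff P F (n - i)"
proof -
  assume i: "i \<in> {1..n}"
  let ?r = "X n \<ominus>\<^bsub>P\<^esub> F"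
  have "coeff P ?r m = \<zero>" if "m \<ge> n" for m
    using that F_lead F_above[of m] by (cases "m = n") (auto simp: P.minus_eq R.r_neg)
  then have low: "low ?r" by (simp add: low_def)
  have "X n = F \<otimes>\<^bsub>P\<^esub> \<one>\<^bsub>P\<^esub> \<oplus>\<^bsub>P\<^esub> ?r" by (simp add: P.minus_eq P.a_lcomm[of F] P.r_neg)
  then have "remainder (X n) = ?r" using remainder_unique[OF P.one_closed low] by simp
  then show ?thesis using i by (auto simp: coord_def P.minus_eq)
qed

text \<open>The cycle that moves each of \<open>a, \<dots>, n - 1\<close> up by one and \<open>n\<close> back to \<open>a\<close>.\<close>

definition top_cycle :: "nat \<Rightarrow> nat \<Rightarrow> nat" where
  "top_cycle a = (\<lambda>j. if a \<le> j \<and> j < n then Suc j else if j = n then a else j)"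

text \<open>Composing with the transposition of \<open>a\<close> and \<open>a + 1\<close> extends the cycle that starts at \<open>a + 1\<close> to the one
  that starts at \<open>a\<close>.\<close>

lemma top_cycle_sign:
  assumes "d < n"
  shows "top_cycle (n - d) \<in> perms n \<and> (evenperm (top_cycle (n - d)) \<longleftrightarrow> even d)"
  using assms
proof (induction d)
  case 0
  have "top_cycle n = id" by (auto simp: top_cycle_def)
  then show ?case using permutes_id[of "{1..n}"] by (simp add: perms_iff id_def)
next
  case (Suc d)
  let ?a = "n - Suc d"
  have a: "n - d = Suc ?a" using Suc.prems by simp
  have eq: "top_cycle ?a = transpose ?a (Suc ?a) \<circ> top_cycle (n - d)"
    unfolding a using Suc.prems by (auto simp: fun_eq_iff top_cycle_def transpose_def)
  have IH: "top_cycle (n - d) \<in> perms n" "evenperm (top_cycle (n - d)) \<longleftrightarrow> even d"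
    using Suc by auto
  have \<tau>: "transpose ?a (Suc ?a) \<in> perms n" using Suc.prems by (intro transpose_perms) auto
  have "top_cycle ?a \<in> perms n"
    unfolding eq using IH(1) \<tau> unfolding perms_iff by (rule permutes_compose)
  moreover have "evenperm (top_cycle ?a) \<longleftrightarrow> even (Suc d)"
    unfolding eq using evenperm_comp[OF permutation_swap_id perms_permutation[OF IH(1)]] IH(2)
    by (simp add: evenperm_swap)
  ultimately show ?case by blast
qed

text \<open>Raising by one the exponents in the slots of \<open>I\<close> produces two equal columns unless \<open>I\<close>
  consists of the last slots; in that case a single cycle contributes.\<close>

lemma alt_shift:
  assumes I: "I \<subseteq> {1..n}" "card I = i" and i: "i \<in> {1..n}"
  shows "alt (\<lambda>j. X (j - 1 + (if j \<in> I then 1 else 0)))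
       = (if I = {n - i + 1..n} then signed_coeff R F n i else \<zero>)"
proof (cases "I = {n - i + 1..n}")
  case False
  \<comment> \<open>Slot \<open>j\<close> is raised and slot \<open>j + 1\<close> is not, so both contain \<open>X\<^sup>j\<close>.\<close>
  have "\<exists>j\<in>I. j < n \<and> Suc j \<notin> I"
  proof (rule ccontr)
    assume "\<not> ?thesis"
    then have up: "Suc j \<in> I" if "j \<in> I" "j < n" for j using that by blast
    have fin: "finite I" "I \<noteq> {}" using I i finite_subset[OF I(1)] by auto
    have "Min I + d \<in> I" if "Min I + d \<le> n" for d
      using that by (induction d) (use fin up in auto)
    then have "{Min I..n} \<subseteq> I" by (metis atLeastAtMost_iff le_Suc_ex subsetI)
    moreover have "I \<subseteq> {Min I..n}" using I fin by auto
    ultimately have "I = {Min I..n}" by blast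
    moreover from this have "Min I = n - i + 1"
      using I i by (metis Suc_diff_le Suc_eq_plus1 Suc_le_mono card_atLeastAtMost diff_diff_cancel
        diff_le_self le_SucI not_less_eq_eq fin Min_in atLeastAtMost_iff subsetD)
    ultimately show False using False by simp
  qed
  then obtain j where j: "j \<in> I" "j < n" "Suc j \<notin> I" by blast
  have "alt (\<lambda>j. X (j - 1 + (if j \<in> I then 1 else 0))) = \<zero>"
    using j I by (intro alt_repeated[of _ j "Suc j"]) auto
  with False show ?thesis by simp
next
  case True
  let ?t = "\<lambda>j. X (j - 1 + (if j \<in> I then 1 else 0))"
  let ?a = "n - i + 1"
  let ?c = "top_cycle ?a"
  have ai: "?a = n - (i - 1)" using i by auto
  have c: "?c \<in> perms n" "evenperm ?c \<longleftrightarrow> even (i - 1)"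
  proof -
    have "i - 1 < n" using i by auto
    from top_cycle_sign[OF this] show "?c \<in> perms n" "evenperm ?c \<longleftrightarrow> even (i - 1)"
      unfolding ai by blast+
  qed
  have ct: "coord k (?t j) = (if k = ?c j then \<one> else \<zero>)" if "j \<in> {1..n}" "j \<noteq> n" "k \<in> {1..n}" for j k
    using that i by (subst coord_X) (auto simp: True top_cycle_def)
  have tn: "coord (?c n) (?t n) = \<ominus> coeff P F (n - i)"
    using coord_X_n[OF i] i by (auto simp: True top_cycle_def)
  have "alt ?t = psign R ?c \<otimes> (\<Otimes>j\<in>{1..n}. coord (?c j) (?t j))"
  proof (rule alt_single[OF _ c(1)])
    fix q assume q: "q \<in> perms n" "q \<noteq> ?c"
    show "\<exists>j\<in>{1..n}. coord (q j) (?t j) = \<zero>"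
    proof (rule ccontr)
      assume nz: "\<not> ?thesis"
      show False
      \<comment> \<open>The coordinates \<open>0\<close> and \<open>1\<close> of a power of \<open>X\<close> differ only over a nonzero ring.\<close>
      proof (cases "\<one> = \<zero>")
        case True
        have "coord (q n) (?t n) = \<zero>" using True by (metis coord_closed R.one_zeroD monom_closed R.one_closed singletonD)
        with nz i show False by auto
      next
        case neq: False
        \<comment> \<open>All columns but the last are basis vectors, which determines \<open>q\<close> outside \<open>n\<close>, and then also at \<open>n\<close>.\<close>
        have qj: "q j = ?c j" if "j \<in> {1..n}" "j \<noteq> n" for j
          using nz ct[OF that, of "q j"] that perms_mem[OF q(1)] by (metis (full_types))
        have "q n = ?c n"
        proof -
          have n: "n \<in> {1..n}" using i by auto
          obtain m where m: "m \<in> {1..n}" "q m = ?c n"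
            using perms_bij[OF q(1)] perms_mem[OF c(1) n] by (metis bij_betw_def imageE)
          show ?thesis
          proof (cases "m = n")
            case False
            then have "?c m = ?c n" using qj m by simp
            then have "m = n" using permutes_inj c(1) by (metis injD perms_iff)
            with False show ?thesis by simp
          qed (use m in simp)
        qed
        then have "q j = ?c j" for j
          using qj q(1) c(1) by (metis perms_iff permutes_not_in)
        with q(2) show False by blast
      qed
    qed
  qed simp
  also have "(\<Otimes>j\<in>{1..n}. coord (?c j) (?t j))
      = coord (?c n) (?t n) \<otimes> (\<Otimes>j\<in>{1..n} - {n}. coord (?c j) (?t j))"
    using i by (intro R.finprod_remove) auto
  also have "(\<Otimes>j\<in>{1..n} - {n}. coord (?c j) (?t j)) = \<one>"
    using ct perms_mem[OF c(1)] by (intro R.finprod_one_eqI) (simp del: One_nat_def)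
  finally have "alt ?t = psign R ?c \<otimes> (\<ominus> coeff P F (n - i))" using tn by simp
  also have "\<dots> = ((\<ominus> \<one>) [^] i) \<otimes> coeff P F (n - i)"
  proof -
    have "(\<ominus> \<one>) [^] m = (if even m then \<one> else \<ominus> \<one>)" for m :: nat
      by (induction m) (auto simp: R.l_minus)
    then show ?thesis using i c(2) by (auto simp: psign_def R.l_minus R.r_minus)
  qed
  finally show ?thesis using True by (simp add: signed_coeff_def P_def)
qed

end

section \<open>Tensor powers\<close>

definition linear_form ::
  "('a, 'r) ring_scheme \<Rightarrow> ('a, 'b, 'm) module_scheme \<Rightarrow> ('b \<Rightarrow> 'a) \<Rightarrow> bool" where
  "linear_form R B \<phi> \<longleftrightarrow> (\<forall>b\<in>carrier B. \<phi> b \<in> carrier R) \<and>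
     (\<forall>b\<in>carrier B. \<forall>c\<in>carrier B. \<phi> (b \<oplus>\<^bsub>B\<^esub> c) = \<phi> b \<oplus>\<^bsub>R\<^esub> \<phi> c) \<and>
     (\<forall>a\<in>carrier R. \<forall>b\<in>carrier B. \<phi> (a \<odot>\<^bsub>B\<^esub> b) = a \<otimes>\<^bsub>R\<^esub> \<phi> b)"

text \<open>This keeps membership in the set of tuples folded, and \<open>{1..n}\<close> in the form in which the facts about
  tuples mention it.\<close>

declare carrier_product_group [simp del] One_nat_def [simp del]

locale tensor_algebra = algebra R B for R (structure) and B (structure) +
  fixes n :: nat
begin

abbreviation "tuples \<equiv> carrier (product_group {1..n} (\<lambda>_. B))"
abbreviation "TA \<equiv> tuple_algebra R B n"
abbreviation "J \<equiv> tensor_ideal R B n"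
abbreviation "T \<equiv> tensor_power R B n"
abbreviation "single \<equiv> tuple_single R"
abbreviation "pure \<equiv> pure_tensor R B n"
abbreviation tmult (infixl "\<star>" 70) where "t \<star> s \<equiv> (\<lambda>j\<in>{1..n}. t j \<otimes>\<^bsub>B\<^esub> s j)"

lemma tuples_iff: "t \<in> tuples \<longleftrightarrow> (\<forall>j\<in>{1..n}. t j \<in> carrier B) \<and> t \<in> extensional {1..n}"
  by (simp add: carrier_product_group PiE_iff)

lemma product_comm_monoid: "comm_monoid (product_group {1..n} (\<lambda>_. B))"
  by (rule comm_monoidI)
    (auto simp: tuples_iff m_ac extensional_def intro!: ext)

sublocale MA: monoid_ring R "product_group {1..n} (\<lambda>_. B)" "tuple_algebra R B n"
  by (intro monoid_ring.intro R_cring product_comm_monoid) (simp add: tuple_algebra_def)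

sublocale TA: algebra R "tuple_algebra R B n"
  by (rule MA.algebra)

lemma tuples_update: "t \<in> tuples \<Longrightarrow> i \<in> {1..n} \<Longrightarrow> b \<in> carrier B \<Longrightarrow> t(i := b) \<in> tuples"
  by (auto simp: tuples_iff extensional_def)

lemma tuples_mult: "t \<in> tuples \<Longrightarrow> s \<in> tuples \<Longrightarrow> t \<star> s \<in> tuples"
  by (auto simp: tuples_iff)

lemma single_closed: "t \<in> tuples \<Longrightarrow> single t \<in> carrier TA"
  unfolding tuple_single_def by (rule MA.single_closed)

lemma pairing_single: "t \<in> tuples \<Longrightarrow> w \<in> tuples \<rightarrow> carrier R \<Longrightarrow> pairing R (single t) w = w t"
  unfolding tuple_single_def by (rule MA.pairing_single)

lemma single_mult:
  assumes "t \<in> tuples" "s \<in> tuples" shows "single t \<otimes>\<^bsub>TA\<^esub> single s = single (t \<star> s)"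
proof (rule MA.pairing_ext)
  fix w assume w: "w \<in> tuples \<rightarrow> carrier R"
  have w': "(\<lambda>y. w (t \<star> y)) \<in> tuples \<rightarrow> carrier R"
    using w tuples_mult[OF assms(1)] by (simp add: Pi_iff)
  have w'': "(\<lambda>x. pairing R (single s) (\<lambda>y. w (x \<star> y))) \<in> tuples \<rightarrow> carrier R"
  proof (rule Pi_I)
    fix x assume "x \<in> tuples"
    then show "pairing R (single s) (\<lambda>y. w (x \<star> y)) \<in> carrier R"
      using w tuples_mult[of x] assms single_closed by (intro MA.pairing_closed) (simp_all add: Pi_iff)
  qed
  have "pairing R (single t \<otimes>\<^bsub>TA\<^esub> single s) w = pairing R (single t) (\<lambda>x. pairing R (single s) (\<lambda>y. w (x \<star> y)))"
    using assms w single_closed MA.pairing_mult[of "single t" "single s" w] by simp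
  also have "\<dots> = pairing R (single s) (\<lambda>y. w (t \<star> y))"
    using assms w'' by (intro pairing_single)
  also have "\<dots> = w (t \<star> s)" using assms w' by (intro pairing_single)
  also have "\<dots> = pairing R (single (t \<star> s)) w"
    using assms w tuples_mult by (intro pairing_single[symmetric])
  finally show "pairing R (single t \<otimes>\<^bsub>TA\<^esub> single s) w = pairing R (single (t \<star> s)) w" .
qed (use assms single_closed tuples_mult in auto)

lemma relation_add: "t \<in> tuples \<Longrightarrow> i \<in> {1..n} \<Longrightarrow> b \<in> carrier B \<Longrightarrow> c \<in> carrier B \<Longrightarrow>
    single (t(i := b \<oplus>\<^bsub>B\<^esub> c)) \<ominus>\<^bsub>TA\<^esub> (single (t(i := b)) \<oplus>\<^bsub>TA\<^esub> single (t(i := c)))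
      \<in> tensor_relations R B n"
  unfolding tensor_relations_def carrier_product_group by blast

lemma relation_smult: "t \<in> tuples \<Longrightarrow> i \<in> {1..n} \<Longrightarrow> a \<in> carrier R \<Longrightarrow> b \<in> carrier B \<Longrightarrow>
    single (t(i := a \<odot>\<^bsub>B\<^esub> b)) \<ominus>\<^bsub>TA\<^esub> (a \<odot>\<^bsub>TA\<^esub> single (t(i := b))) \<in> tensor_relations R B n"
  unfolding tensor_relations_def carrier_product_group by blast

lemma relation_cases:
  assumes "x \<in> tensor_relations R B n"
  obtains (add) t i b c where "t \<in> tuples" "i \<in> {1..n}" "b \<in> carrier B" "c \<in> carrier B"
      "x = single (t(i := b \<oplus>\<^bsub>B\<^esub> c)) \<ominus>\<^bsub>TA\<^esub> (single (t(i := b)) \<oplus>\<^bsub>TA\<^esub> single (t(i := c)))"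
    | (smult) t i a b where "t \<in> tuples" "i \<in> {1..n}" "a \<in> carrier R" "b \<in> carrier B"
      "x = single (t(i := a \<odot>\<^bsub>B\<^esub> b)) \<ominus>\<^bsub>TA\<^esub> (a \<odot>\<^bsub>TA\<^esub> single (t(i := b)))"
  using assms unfolding tensor_relations_def carrier_product_group by blast

lemma relations_closed: "tensor_relations R B n \<subseteq> carrier TA"
proof
  fix x assume "x \<in> tensor_relations R B n"
  then show "x \<in> carrier TA"
    by (cases rule: relation_cases)
      (auto intro!: TA.minus_closed TA.a_closed TA.smult_closed single_closed tuples_update
        simp del: fun_upd_apply)
qed

lemma J_ideal: "ideal J TA"
  unfolding tensor_ideal_def by (rule TA.genideal_ideal[OF relations_closed])

sublocale T: algebra R "tensor_power R B n"
  unfolding tensor_power_def by (rule quotient_algebra_algebra[OF MA.algebra J_ideal])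

lemma T_carrier: "carrier T = (\<lambda>f. J +>\<^bsub>TA\<^esub> f) ` carrier TA"
  unfolding tensor_power_def by (rule quotient_algebra_carrier[OF MA.algebra J_ideal])

lemma coset_add: "f \<in> carrier TA \<Longrightarrow> g \<in> carrier TA \<Longrightarrow>
    (J +>\<^bsub>TA\<^esub> f) \<oplus>\<^bsub>T\<^esub> (J +>\<^bsub>TA\<^esub> g) = J +>\<^bsub>TA\<^esub> (f \<oplus>\<^bsub>TA\<^esub> g)"
  and coset_mult: "f \<in> carrier TA \<Longrightarrow> g \<in> carrier TA \<Longrightarrow>
    (J +>\<^bsub>TA\<^esub> f) \<otimes>\<^bsub>T\<^esub> (J +>\<^bsub>TA\<^esub> g) = J +>\<^bsub>TA\<^esub> (f \<otimes>\<^bsub>TA\<^esub> g)"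
  and coset_smult: "a \<in> carrier R \<Longrightarrow> f \<in> carrier TA \<Longrightarrow>
    a \<odot>\<^bsub>T\<^esub> (J +>\<^bsub>TA\<^esub> f) = J +>\<^bsub>TA\<^esub> (a \<odot>\<^bsub>TA\<^esub> f)"
  and coset_one: "\<one>\<^bsub>T\<^esub> = J +>\<^bsub>TA\<^esub> \<one>\<^bsub>TA\<^esub>"
  and coset_zero: "\<zero>\<^bsub>T\<^esub> = J +>\<^bsub>TA\<^esub> \<zero>\<^bsub>TA\<^esub>"
  unfolding tensor_power_def
  by (simp_all add: quotient_algebra_add[OF MA.algebra J_ideal] quotient_algebra_mult[OF MA.algebra J_ideal]
    quotient_algebra_smult[OF MA.algebra J_ideal] quotient_algebra_one[OF MA.algebra J_ideal]
    quotient_algebra_zero[OF MA.algebra J_ideal])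

lemma pure_eq: "pure t = J +>\<^bsub>TA\<^esub> single t"
  by (simp add: pure_tensor_def)

lemma pure_closed: "t \<in> tuples \<Longrightarrow> pure t \<in> carrier T"
  unfolding T_carrier pure_eq using single_closed by blast

lemma pure_mult: "t \<in> tuples \<Longrightarrow> s \<in> tuples \<Longrightarrow> pure t \<otimes>\<^bsub>T\<^esub> pure s = pure (t \<star> s)"
  unfolding pure_eq using single_closed single_mult by (simp add: coset_mult)

lemma one_tuple: "(\<lambda>j\<in>{1..n}. \<one>\<^bsub>B\<^esub>) \<in> tuples"
  by (simp add: tuples_iff)

lemma pure_one: "pure (\<lambda>j\<in>{1..n}. \<one>\<^bsub>B\<^esub>) = \<one>\<^bsub>T\<^esub>"
  unfolding pure_eq coset_one by (simp add: MA.one_eq tuple_single_def)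

lemma J_relation:
  assumes "x \<in> tensor_relations R B n" shows "x \<in> J"
  unfolding tensor_ideal_def using TA.genideal_self[OF relations_closed] assms by blast

lemma coset_eqI: "f \<in> carrier TA \<Longrightarrow> g \<in> carrier TA \<Longrightarrow> f \<ominus>\<^bsub>TA\<^esub> g \<in> J \<Longrightarrow> J +>\<^bsub>TA\<^esub> f = J +>\<^bsub>TA\<^esub> g"
  using coset_eq_iff[OF MA.algebra J_ideal] by blast

lemma pure_add:
  assumes "t \<in> tuples" "i \<in> {1..n}" "b \<in> carrier B" "c \<in> carrier B"
  shows "pure (t(i := b \<oplus>\<^bsub>B\<^esub> c)) = pure (t(i := b)) \<oplus>\<^bsub>T\<^esub> pure (t(i := c))"
proof -
  note cl = single_closed[OF tuples_update[OF assms(1,2)]]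
  have "single (t(i := b \<oplus>\<^bsub>B\<^esub> c)) \<ominus>\<^bsub>TA\<^esub> (single (t(i := b)) \<oplus>\<^bsub>TA\<^esub> single (t(i := c))) \<in> J"
    using assms by (intro J_relation relation_add)
  then show ?thesis
    unfolding pure_eq coset_add[OF cl[OF assms(3)] cl[OF assms(4)]]
    using assms by (intro coset_eqI cl TA.a_closed M.a_closed)
qed

lemma pure_smult:
  assumes "t \<in> tuples" "i \<in> {1..n}" "a \<in> carrier R" "b \<in> carrier B"
  shows "pure (t(i := a \<odot>\<^bsub>B\<^esub> b)) = a \<odot>\<^bsub>T\<^esub> pure (t(i := b))"
proof -
  note cl = single_closed[OF tuples_update[OF assms(1,2)]]
  have "single (t(i := a \<odot>\<^bsub>B\<^esub> b)) \<ominus>\<^bsub>TA\<^esub> (a \<odot>\<^bsub>TA\<^esub> single (t(i := b))) \<in> J"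
    using assms by (intro J_relation relation_smult)
  then show ?thesis
    unfolding pure_eq coset_smult[OF assms(3) cl[OF assms(4)]]
    using assms by (intro coset_eqI cl TA.smult_closed smult_closed)
qed

text \<open>The pure tensors span the tensor power: a representative loses one point of its support at a time.\<close>

lemma tensor_induct [consumes 1, case_names pure add smult]:
  assumes x: "x \<in> carrier T"
    and pure: "\<And>t. t \<in> tuples \<Longrightarrow> Q (pure t)"
    and add: "\<And>x y. x \<in> carrier T \<Longrightarrow> y \<in> carrier T \<Longrightarrow> Q x \<Longrightarrow> Q y \<Longrightarrow> Q (x \<oplus>\<^bsub>T\<^esub> y)"
    and smult: "\<And>a x. a \<in> carrier R \<Longrightarrow> x \<in> carrier T \<Longrightarrow> Q x \<Longrightarrow> Q (a \<odot>\<^bsub>T\<^esub> x)"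
  shows "Q x"
proof -
  have T: "J +>\<^bsub>TA\<^esub> f \<in> carrier T" if "f \<in> carrier TA" for f using that T_carrier by blast
  have "Q (J +>\<^bsub>TA\<^esub> f)" if "finite S" "f \<in> carrier TA" "{t. f t \<noteq> \<zero>} \<subseteq> S" for f S
    using that
  proof (induction S arbitrary: f rule: finite_induct)
    case empty
    then have "f = \<zero>\<^bsub>TA\<^esub>" by (auto simp: MA.zero_eq)
    then have "J +>\<^bsub>TA\<^esub> f = \<zero> \<odot>\<^bsub>T\<^esub> \<one>\<^bsub>T\<^esub>" by (simp add: coset_zero[symmetric])
    then show ?case using smult[OF _ _ pure[OF one_tuple], of \<zero>] pure_one by simp
  next
    case (insert t S)
    show ?case
    proof (cases "f t = \<zero>")
      case True
      then show ?thesis using insert by (intro insert.IH) auto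
    next
      case False
      then have t: "t \<in> tuples" and ft: "f t \<in> carrier R" using insert.prems(1) MA.carrier_iff by auto
      let ?g = "f(t := \<zero>)"
      have g: "?g \<in> carrier TA"
        using insert.prems(1) unfolding MA.carrier_iff
        by (auto intro: rev_finite_subset[of "{x. f x \<noteq> \<zero>}"])
      have "f = ?g \<oplus>\<^bsub>TA\<^esub> f t \<odot>\<^bsub>TA\<^esub> single t"
      proof
        fix s show "f s = (?g \<oplus>\<^bsub>TA\<^esub> f t \<odot>\<^bsub>TA\<^esub> single t) s"
          using insert.prems(1) by (cases "s = t") (auto simp: MA.add_eq MA.smult_eq tuple_single_def MA.carrier_iff)
      qed
      then have "J +>\<^bsub>TA\<^esub> f = (J +>\<^bsub>TA\<^esub> ?g) \<oplus>\<^bsub>T\<^esub> f t \<odot>\<^bsub>T\<^esub> pure t"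
        using g t ft single_closed by (simp add: pure_eq coset_smult coset_add)
      moreover have "Q (J +>\<^bsub>TA\<^esub> ?g)" using insert by (intro insert.IH g) auto
      ultimately show ?thesis
        using add[OF T[OF g] T.smult_closed[OF ft pure_closed[OF t]]] smult[OF ft pure_closed[OF t] pure[OF t]] by simp
    qed
  qed
  moreover obtain f where f: "f \<in> carrier TA" "x = J +>\<^bsub>TA\<^esub> f" using x unfolding T_carrier by blast
  ultimately show ?thesis using MA.carrier_iff[of f] by blast
qed

subsection \<open>Products of linear forms\<close>

definition form_product where
  "form_product \<phi> t = (\<Otimes>j\<in>{1..n}. \<phi> j (t j))"

text \<open>The linear form \<open>\<phi>\<^sub>1 \<otimes> \<dots> \<otimes> \<phi>\<^sub>n\<close>, evaluated on a representative of the coset \<open>x\<close>.\<close>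

definition tensor_form where
  "tensor_form \<phi> x = pairing R (SOME f. f \<in> x) (form_product \<phi>)"

context
  fixes \<phi> :: "nat \<Rightarrow> 'c \<Rightarrow> 'a"
  assumes \<phi>: "\<And>j. j \<in> {1..n} \<Longrightarrow> linear_form R B (\<phi> j)"
begin

lemma form_closed: "j \<in> {1..n} \<Longrightarrow> b \<in> carrier B \<Longrightarrow> \<phi> j b \<in> carrier R"
  and form_add: "j \<in> {1..n} \<Longrightarrow> b \<in> carrier B \<Longrightarrow> c \<in> carrier B \<Longrightarrow> \<phi> j (b \<oplus>\<^bsub>B\<^esub> c) = \<phi> j b \<oplus> \<phi> j c"
  and form_smult: "j \<in> {1..n} \<Longrightarrow> a \<in> carrier R \<Longrightarrow> b \<in> carrier B \<Longrightarrow> \<phi> j (a \<odot>\<^bsub>B\<^esub> b) = a \<otimes> \<phi> j b"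
  using \<phi> by (auto simp: linear_form_def)

lemma form_product_closed: "t \<in> tuples \<Longrightarrow> form_product \<phi> t \<in> carrier R"
  unfolding form_product_def using form_closed
  by (intro R.finprod_closed Pi_I) (auto simp: tuples_iff)

lemma form_product_update:
  assumes "t \<in> tuples" "i \<in> {1..n}" "b \<in> carrier B"
  shows "form_product \<phi> (t(i := b)) = \<phi> i b \<otimes> (\<Otimes>j\<in>{1..n} - {i}. \<phi> j (t j))"
proof -
  have cl: "j \<in> {1..n} \<Longrightarrow> \<phi> j ((t(i := b)) j) \<in> carrier R" for j
    using assms form_closed by (auto simp: tuples_iff)
  have "form_product \<phi> (t(i := b)) = \<phi> i ((t(i := b)) i) \<otimes> (\<Otimes>j\<in>{1..n} - {i}. \<phi> j ((t(i := b)) j))"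
    unfolding form_product_def using assms cl by (intro R.finprod_remove) auto
  also have "(\<Otimes>j\<in>{1..n} - {i}. \<phi> j ((t(i := b)) j)) = (\<Otimes>j\<in>{1..n} - {i}. \<phi> j (t j))"
    using assms form_closed by (intro R.finprod_cong') (auto simp: tuples_iff)
  finally show ?thesis by (simp only: fun_upd_same)
qed

text \<open>Multiplying a multilinearity relation by a tuple gives a multilinearity relation, so the
  elements killed together with all their translates form an ideal that contains the relations.\<close>

lemma form_product_J:
  assumes "f \<in> J" shows "f \<in> carrier TA" "pairing R f (form_product \<phi>) = \<zero>"
proof -
  let ?w = "\<lambda>s t. form_product \<phi> (t \<star> s)"
  let ?K = "{f \<in> carrier TA. \<forall>s\<in>tuples. pairing R f (?w s) = \<zero>}"
  have w: "?w s \<in> tuples \<rightarrow> carrier R" if "s \<in> tuples" for s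
    using that tuples_mult by (intro Pi_I form_product_closed)
  have cl0: "(\<Otimes>j\<in>{1..n} - {i}. \<phi> j ((t \<star> s) j)) \<in> carrier R" if "t \<in> tuples" "s \<in> tuples" for t s i
    using that form_closed by (intro R.finprod_closed Pi_I) (auto simp: tuples_iff)
  have upd: "?w s (t(i := b)) = \<phi> i (b \<otimes>\<^bsub>B\<^esub> s i) \<otimes> (\<Otimes>j\<in>{1..n} - {i}. \<phi> j ((t \<star> s) j))"
    if "t \<in> tuples" "s \<in> tuples" "i \<in> {1..n}" "b \<in> carrier B" for t s i b
  proof -
    have "t(i := b) \<star> s = (t \<star> s)(i := b \<otimes>\<^bsub>B\<^esub> s i)" using that by (auto simp: fun_eq_iff)
    then show ?thesis
      using that form_product_update[of "t \<star> s" i "b \<otimes>\<^bsub>B\<^esub> s i"] tuples_mult by (simp add: tuples_iff)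
  qed
  have neg: "pairing R (\<ominus>\<^bsub>TA\<^esub> f) v = \<ominus> pairing R f v"
    if f: "f \<in> carrier TA" and v: "v \<in> tuples \<rightarrow> carrier R" for f v
  proof -
    have "\<ominus>\<^bsub>TA\<^esub> f = (\<ominus> \<one>) \<odot>\<^bsub>TA\<^esub> f" using f by (simp add: TA.smult_l_minus)
    then show ?thesis
      using MA.pairing_smult[OF f _ v, of "\<ominus> \<one>"] MA.pairing_closed[OF f v] by (simp add: R.l_minus)
  qed
  have zero: "pairing R \<zero>\<^bsub>TA\<^esub> v = \<zero>" for v
    by (simp add: pairing_def MA.zero_eq)
  have mult: "f \<otimes>\<^bsub>TA\<^esub> g \<in> ?K" if f: "f \<in> ?K" and g: "g \<in> carrier TA" for f g
  proof -
    have "pairing R (g \<otimes>\<^bsub>TA\<^esub> f) (?w s) = \<zero>" if s: "s \<in> tuples" for s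
    proof -
      have "pairing R (g \<otimes>\<^bsub>TA\<^esub> f) (?w s) = pairing R g (\<lambda>x. pairing R f (\<lambda>y. ?w s (x \<star> y)))"
        using MA.pairing_mult[OF g _ w[OF s]] f by simp
      also have "\<dots> = pairing R g (\<lambda>x. \<zero>)"
      proof (rule MA.pairing_cong[OF g])
        fix x assume x: "x \<in> tuples"
        have "?w s (x \<star> y) = ?w (x \<star> s) y" if "y \<in> tuples" for y
        proof -
          have "x \<star> y \<star> s = y \<star> (x \<star> s)" using that x s by (auto simp: fun_eq_iff tuples_iff m_ac)
          then show ?thesis by simp
        qed
        then have "pairing R f (\<lambda>y. ?w s (x \<star> y)) = pairing R f (?w (x \<star> s))"
          using f w[OF tuples_mult[OF x s]] by (intro MA.pairing_cong) blast+
        also have "\<dots> = \<zero>" using f tuples_mult[OF x s] by blast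
        finally show "pairing R f (\<lambda>y. ?w s (x \<star> y)) = \<zero>" .
      qed simp
      also have "\<dots> = \<zero>" unfolding pairing_def using g by (intro R.add.finprod_one_eqI) (auto simp: MA.carrier_iff)
      finally show ?thesis .
    qed
    then show ?thesis using f g TA.m_comm[of f g] by auto
  qed
  have "ideal ?K TA"
  proof (rule idealI)
    show "subgroup ?K (add_monoid TA)"
    proof (rule TA.M.add.subgroupI)
      show "?K \<noteq> {}" using zero TA.M.zero_closed by blast
    qed (use w neg in \<open>auto simp: MA.pairing_add\<close>)
    fix a x assume "a \<in> ?K" "x \<in> carrier TA"
    then show "a \<otimes>\<^bsub>TA\<^esub> x \<in> ?K" "x \<otimes>\<^bsub>TA\<^esub> a \<in> ?K"
      using mult[of a x] TA.m_comm[of x a] by auto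
  qed (rule TA.ring_axioms)
  moreover have "tensor_relations R B n \<subseteq> ?K"
  proof
    fix x assume x: "x \<in> tensor_relations R B n"
    have ps: "pairing R (single (t(i := b))) (?w s) = ?w s (t(i := b))"
      if "t \<in> tuples" "s \<in> tuples" "i \<in> {1..n}" "b \<in> carrier B" for t i b s
      using that w tuples_update by (intro pairing_single)
    have "pairing R x (?w s) = \<zero>" if s: "s \<in> tuples" for s
      using x
    proof (cases rule: relation_cases)
      case (add t i b c)
      note t = add(1) and i = add(2-4) and x = add(5)
      have si: "s i \<in> carrier B" using s i by (simp add: tuples_iff)
      note cl = single_closed[OF tuples_update[OF t i(1)]]
      have "pairing R x (?w s) = ?w s (t(i := b \<oplus>\<^bsub>B\<^esub> c)) \<ominus> (?w s (t(i := b)) \<oplus> ?w s (t(i := c)))"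
        unfolding x TA.M.minus_eq R.minus_eq using cl i w s t
        by (simp add: MA.pairing_add neg ps del: fun_upd_apply restrict_apply)
      also have "\<dots> = \<zero>"
        using upd[OF t s i(1)] i si form_closed[OF i(1)] cl0[OF t s, of i]
        by (simp add: l_distr form_add R.l_distr R.minus_eq R.r_neg del: fun_upd_apply restrict_apply)
      finally show ?thesis .
    next
      case (smult t i a b)
      note t = smult(1) and i = smult(2-4) and x = smult(5)
      have si: "s i \<in> carrier B" using s i by (simp add: tuples_iff)
      note cl = single_closed[OF tuples_update[OF t i(1)]]
      have "pairing R x (?w s) = ?w s (t(i := a \<odot>\<^bsub>B\<^esub> b)) \<ominus> a \<otimes> ?w s (t(i := b))"
        unfolding x TA.M.minus_eq R.minus_eq using cl i w s t
        by (simp add: MA.pairing_add MA.pairing_smult neg ps del: fun_upd_apply restrict_apply)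
      also have "\<dots> = \<zero>"
        using upd[OF t s i(1)] i si form_closed[OF i(1)] cl0[OF t s, of i]
        by (simp add: smult_assoc2 form_smult R.m_assoc R.minus_eq R.r_neg del: fun_upd_apply restrict_apply)
      finally show ?thesis .
    qed
    then show "x \<in> ?K" using x relations_closed by blast
  qed
  ultimately have "J \<subseteq> ?K" unfolding tensor_ideal_def by (rule TA.genideal_minimal)
  then have fK: "f \<in> ?K" using assms by blast
  then show "f \<in> carrier TA" by blast
  have "pairing R f (form_product \<phi>) = pairing R f (?w (\<lambda>j\<in>{1..n}. \<one>\<^bsub>B\<^esub>))"
  proof (rule MA.pairing_cong)
    fix t assume t: "t \<in> tuples"
    then have "t \<star> (\<lambda>j\<in>{1..n}. \<one>\<^bsub>B\<^esub>) = t" by (auto simp: fun_eq_iff tuples_iff extensional_def)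
    then show "form_product \<phi> t = ?w (\<lambda>j\<in>{1..n}. \<one>\<^bsub>B\<^esub>) t" by simp
  qed (use fK w[OF one_tuple] in blast)+
  then show "pairing R f (form_product \<phi>) = \<zero>" using fK one_tuple by auto
qed

lemma tensor_form_coset:
  assumes f: "f \<in> carrier TA"
  shows "tensor_form \<phi> (J +>\<^bsub>TA\<^esub> f) = pairing R f (form_product \<phi>)"
proof -
  interpret I: ideal J TA by (rule J_ideal)
  let ?g = "SOME g. g \<in> J +>\<^bsub>TA\<^esub> f"
  have "?g \<in> J +>\<^bsub>TA\<^esub> f" using someI[of "\<lambda>g. g \<in> J +>\<^bsub>TA\<^esub> f", OF I.a_rcos_self[OF f]] .
  then obtain h where h: "h \<in> J" "?g = h \<oplus>\<^bsub>TA\<^esub> f" by (auto simp: a_r_coset_def r_coset_def)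
  have w: "form_product \<phi> \<in> tuples \<rightarrow> carrier R" using form_product_closed by blast
  have "pairing R ?g (form_product \<phi>) = pairing R h (form_product \<phi>) \<oplus> pairing R f (form_product \<phi>)"
    unfolding h(2) using form_product_J(1)[OF h(1)] f w by (rule MA.pairing_add)
  then show ?thesis
    using form_product_J(2)[OF h(1)] MA.pairing_closed[OF f w] by (simp add: tensor_form_def)
qed

lemma form_product_fun: "form_product \<phi> \<in> tuples \<rightarrow> carrier R"
  using form_product_closed by blast

lemma tensor_form_closed: "x \<in> carrier T \<Longrightarrow> tensor_form \<phi> x \<in> carrier R"
  unfolding T_carrier using form_product_fun by (auto simp: tensor_form_coset intro: MA.pairing_closed)

lemma tensor_form_add:
  "x \<in> carrier T \<Longrightarrow> y \<in> carrier T \<Longrightarrow> tensor_form \<phi> (x \<oplus>\<^bsub>T\<^esub> y) = tensor_form \<phi> x \<oplus> tensor_form \<phi> y"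
  unfolding T_carrier using form_product_fun
  by (auto simp: coset_add tensor_form_coset MA.pairing_add)

lemma tensor_form_smult:
  "a \<in> carrier R \<Longrightarrow> x \<in> carrier T \<Longrightarrow> tensor_form \<phi> (a \<odot>\<^bsub>T\<^esub> x) = a \<otimes> tensor_form \<phi> x"
  unfolding T_carrier using form_product_fun
  by (auto simp: coset_smult tensor_form_coset MA.pairing_smult)

lemma tensor_form_pure: "t \<in> tuples \<Longrightarrow> tensor_form \<phi> (pure t) = (\<Otimes>j\<in>{1..n}. \<phi> j (t j))"
  unfolding pure_eq using single_closed form_product_fun
  by (simp add: tensor_form_coset pairing_single form_product_def)

lemma tensor_form_zero: "tensor_form \<phi> \<zero>\<^bsub>T\<^esub> = \<zero>"
  using tensor_form_smult[of \<zero> "\<one>\<^bsub>T\<^esub>"] tensor_form_closed[of "\<one>\<^bsub>T\<^esub>"] by simp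

lemma tensor_form_finsum:
  assumes "finite A" "\<And>i. i \<in> A \<Longrightarrow> x i \<in> carrier T"
  shows "tensor_form \<phi> (\<Oplus>\<^bsub>T\<^esub>i\<in>A. x i) = (\<Oplus>i\<in>A. tensor_form \<phi> (x i))"
  using assms
  by (induction A rule: finite_induct)
    (auto simp: tensor_form_zero tensor_form_add tensor_form_closed Pi_iff intro!: T.M.finsum_closed)

end

end

section \<open>Permuting the factors\<close>

abbreviation pinv :: "(nat \<Rightarrow> nat) \<Rightarrow> nat \<Rightarrow> nat" where "pinv \<equiv> Hilbert_Choice.inv"

lemma pinv_perms: "p \<in> perms n \<Longrightarrow> pinv p \<in> perms n"
  by (simp add: perms_iff permutes_inv)

lemma perms_not_in: "p \<in> perms n \<Longrightarrow> j \<notin> {1..n} \<Longrightarrow> p j = j"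
  unfolding perms_iff by (rule permutes_not_in)

lemma pinv_comp: "p \<in> perms n \<Longrightarrow> pinv p \<circ> p = id" "p \<in> perms n \<Longrightarrow> p \<circ> pinv p = id"
  by (simp_all add: perms_iff permutes_inv_o)

lemma pinv_eq: "p \<in> perms n \<Longrightarrow> pinv p (p j) = j" "p \<in> perms n \<Longrightarrow> p (pinv p j) = j"
  by (simp_all add: perms_iff permutes_inverses)

lemma restrict_perm:
  assumes p: "p \<in> perms n" shows "restrict f {1..n} \<circ> p = (\<lambda>j\<in>{1..n}. f (p j))"
proof
  fix j show "(restrict f {1..n} \<circ> p) j = (\<lambda>j\<in>{1..n}. f (p j)) j"
    using perms_mem[OF p, of j] perms_not_in[OF p, of j] by (cases "j \<in> {1..n}") auto
qed

definition permute_tuple :: "(nat \<Rightarrow> nat) \<Rightarrow> ((nat \<Rightarrow> 'b) \<Rightarrow> 'a) \<Rightarrow> (nat \<Rightarrow> 'b) \<Rightarrow> 'a" where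
  "permute_tuple p f = (\<lambda>t. f (t \<circ> p))"

context tensor_algebra
begin

lemma tuples_comp:
  assumes "t \<in> tuples" "p \<in> perms n" shows "t \<circ> p \<in> tuples"
  using assms perms_mem[OF assms(2)] perms_not_in[OF assms(2)] by (simp add: tuples_iff extensional_def)

lemma tuples_comp_iff:
  assumes p: "p \<in> perms n" shows "t \<circ> p \<in> tuples \<longleftrightarrow> t \<in> tuples"
proof
  assume "t \<circ> p \<in> tuples"
  then have "t \<circ> p \<circ> pinv p \<in> tuples" by (rule tuples_comp[OF _ pinv_perms[OF p]])
  then show "t \<in> tuples" using pinv_comp(2)[OF p] by (simp only: comp_assoc comp_id)
qed (rule tuples_comp[OF _ p])

lemma bij_comp_support:
  assumes p: "p \<in> perms n"
  shows "bij_betw (\<lambda>s. s \<circ> pinv p) {s. f s \<noteq> \<zero>} {t. permute_tuple p f t \<noteq> \<zero>}"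
  by (rule bij_betw_byWitness[where f' = "\<lambda>t. t \<circ> p"])
    (auto simp: permute_tuple_def comp_assoc pinv_comp[OF p])

lemma permute_closed:
  assumes f: "f \<in> carrier TA" and p: "p \<in> perms n"
  shows "permute_tuple p f \<in> carrier TA"
proof -
  have "finite {t. permute_tuple p f t \<noteq> \<zero>}"
    using bij_betw_finite[OF bij_comp_support[OF p, of f]] f MA.carrier_iff by simp
  then show ?thesis
    using f tuples_comp_iff[OF p] unfolding MA.carrier_iff by (auto simp: permute_tuple_def)
qed

lemma comp_fun:
  assumes "w \<in> tuples \<rightarrow> carrier R" "p \<in> perms n" shows "(\<lambda>s. w (s \<circ> p)) \<in> tuples \<rightarrow> carrier R"
  using assms tuples_comp by blast

text \<open>Pairings turn the permutation of the factors of a tensor into one of the arguments of a function, which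
  makes compatibility with the product visible.\<close>

lemma pairing_permute:
  assumes f: "f \<in> carrier TA" and p: "p \<in> perms n" and w: "w \<in> tuples \<rightarrow> carrier R"
  shows "pairing R (permute_tuple p f) w = pairing R f (\<lambda>s. w (s \<circ> pinv p))"
proof -
  have "pairing R (permute_tuple p f) w
      = (\<Oplus>s\<in>{s. f s \<noteq> \<zero>}. permute_tuple p f (s \<circ> pinv p) \<otimes> w (s \<circ> pinv p))"
    unfolding pairing_def using permute_closed[OF f p] w
    by (intro R.add.finprod_reindex_bij[OF bij_comp_support[OF p]]) (auto simp: MA.carrier_iff Pi_iff)
  then show ?thesis
    unfolding pairing_def by (simp add: permute_tuple_def comp_assoc pinv_comp[OF p])
qed

lemma mult_comp: "p \<in> perms n \<Longrightarrow> (t \<star> s) \<circ> p = (t \<circ> p) \<star> (s \<circ> p)"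
proof
  fix j assume p: "p \<in> perms n"
  show "((t \<star> s) \<circ> p) j = ((t \<circ> p) \<star> (s \<circ> p)) j"
    using perms_mem[OF p, of j] perms_not_in[OF p, of j] by (cases "j \<in> {1..n}") auto
qed

lemma permute_single:
  assumes p: "p \<in> perms n" shows "permute_tuple p (single t) = single (t \<circ> pinv p)"
proof -
  have "s \<circ> p = t \<longleftrightarrow> s = t \<circ> pinv p" for s
    using pinv_comp[OF p] by (metis comp_assoc comp_id)
  then show ?thesis by (simp add: permute_tuple_def tuple_single_def fun_eq_iff)
qed

lemma permute_mult:
  assumes f: "f \<in> carrier TA" and g: "g \<in> carrier TA" and p: "p \<in> perms n"
  shows "permute_tuple p (f \<otimes>\<^bsub>TA\<^esub> g) = permute_tuple p f \<otimes>\<^bsub>TA\<^esub> permute_tuple p g"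
proof (rule MA.pairing_ext)
  fix w assume w: "w \<in> tuples \<rightarrow> carrier R"
  have w1: "(\<lambda>y. w (x \<star> y)) \<in> tuples \<rightarrow> carrier R" if "x \<in> tuples" for x
    using w tuples_mult[OF that] by blast
  have w2: "(\<lambda>x. pairing R (permute_tuple p g) (\<lambda>y. w (x \<star> y))) \<in> tuples \<rightarrow> carrier R"
    by (rule Pi_I) (rule MA.pairing_closed[OF permute_closed[OF g p] w1])
  have "pairing R (permute_tuple p f \<otimes>\<^bsub>TA\<^esub> permute_tuple p g) w
      = pairing R (permute_tuple p f) (\<lambda>x. pairing R (permute_tuple p g) (\<lambda>y. w (x \<star> y)))"
    using MA.pairing_mult[OF permute_closed[OF f p] permute_closed[OF g p] w] by simp
  also have "\<dots> = pairing R f (\<lambda>x. pairing R (permute_tuple p g) (\<lambda>y. w ((x \<circ> pinv p) \<star> y)))"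
    by (rule pairing_permute[OF f p w2])
  also have "\<dots> = pairing R f (\<lambda>x. pairing R g (\<lambda>y. w ((x \<star> y) \<circ> pinv p)))"
  proof (rule MA.pairing_cong[OF f])
    fix x assume x: "x \<in> tuples"
    show "pairing R (permute_tuple p g) (\<lambda>y. w ((x \<circ> pinv p) \<star> y)) = pairing R g (\<lambda>y. w ((x \<star> y) \<circ> pinv p))"
      unfolding mult_comp[OF pinv_perms[OF p]]
      by (rule pairing_permute[OF g p w1[OF tuples_comp[OF x pinv_perms[OF p]]]])
  next
    show "(\<lambda>x. pairing R g (\<lambda>y. w ((x \<star> y) \<circ> pinv p))) \<in> tuples \<rightarrow> carrier R"
      using comp_fun[OF w pinv_perms[OF p]] tuples_mult by (intro Pi_I MA.pairing_closed g) blast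
  qed
  also have "\<dots> = pairing R (f \<otimes>\<^bsub>TA\<^esub> g) (\<lambda>s. w (s \<circ> pinv p))"
    using MA.pairing_mult[OF f g comp_fun[OF w pinv_perms[OF p]]] by simp
  also have "\<dots> = pairing R (permute_tuple p (f \<otimes>\<^bsub>TA\<^esub> g)) w"
    using f g p w by (intro pairing_permute[symmetric]) auto
  finally show "pairing R (permute_tuple p (f \<otimes>\<^bsub>TA\<^esub> g)) w = pairing R (permute_tuple p f \<otimes>\<^bsub>TA\<^esub> permute_tuple p g) w"
    by simp
qed (use assms permute_closed in auto)

lemma permute_hom:
  assumes p: "p \<in> perms n" shows "ring_hom_ring TA TA (permute_tuple p)"
proof (intro ring_hom_ringI2 TA.ring_axioms ring_hom_memI)
  show "permute_tuple p \<one>\<^bsub>TA\<^esub> = \<one>\<^bsub>TA\<^esub>"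
    using permute_single[OF p, of "\<lambda>j\<in>{1..n}. \<one>\<^bsub>B\<^esub>"]
    by (simp add: restrict_perm[OF pinv_perms[OF p]] MA.one_eq tuple_single_def)
qed (use p permute_closed permute_mult in \<open>auto simp: MA.add_eq permute_tuple_def\<close>)

lemma permute_J:
  assumes p: "p \<in> perms n" and h: "h \<in> J" shows "permute_tuple p h \<in> J"
proof -
  interpret h: ring_hom_ring TA TA "permute_tuple p" by (rule permute_hom[OF p])
  have upd: "(t(i := b)) \<circ> pinv p = (t \<circ> pinv p)(p i := b)" for t i and b :: 'c
    using pinv_eq[OF p] by (auto simp: fun_eq_iff)
  have sm: "permute_tuple p (a \<odot>\<^bsub>TA\<^esub> f) = a \<odot>\<^bsub>TA\<^esub> permute_tuple p f" for a f
    by (simp add: permute_tuple_def MA.smult_eq)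
  have "tensor_relations R B n \<subseteq> {r \<in> carrier TA. permute_tuple p r \<in> J}"
  proof
    fix x assume x: "x \<in> tensor_relations R B n"
    have "permute_tuple p x \<in> tensor_relations R B n"
      using x
    proof (cases rule: relation_cases)
      case (add t i b c)
      have "permute_tuple p x = single ((t \<circ> pinv p)(p i := b \<oplus>\<^bsub>B\<^esub> c)) \<ominus>\<^bsub>TA\<^esub>
          (single ((t \<circ> pinv p)(p i := b)) \<oplus>\<^bsub>TA\<^esub> single ((t \<circ> pinv p)(p i := c)))"
        unfolding add(5) TA.M.minus_eq using single_closed[OF tuples_update[OF add(1,2)]] add(3,4)
        by (simp add: permute_single[OF p] upd del: fun_upd_apply)
      then show ?thesis
        using relation_add[OF tuples_comp[OF add(1) pinv_perms[OF p]] perms_mem[OF p add(2)] add(3,4)]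
        by (simp only:)
    next
      case (smult t i a b)
      have "permute_tuple p x = single ((t \<circ> pinv p)(p i := a \<odot>\<^bsub>B\<^esub> b)) \<ominus>\<^bsub>TA\<^esub>
          (a \<odot>\<^bsub>TA\<^esub> single ((t \<circ> pinv p)(p i := b)))"
        unfolding smult(5) TA.M.minus_eq using single_closed[OF tuples_update[OF smult(1,2)]] smult(3,4)
        by (simp add: permute_single[OF p] upd sm del: fun_upd_apply)
      then show ?thesis
        using relation_smult[OF tuples_comp[OF smult(1) pinv_perms[OF p]] perms_mem[OF p smult(2)] smult(3,4)]
        by (simp only:)
    qed
    then show "x \<in> {r \<in> carrier TA. permute_tuple p r \<in> J}"
      using x relations_closed J_relation by blast
  qed
  then have "J \<subseteq> {r \<in> carrier TA. permute_tuple p r \<in> J}"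
    unfolding tensor_ideal_def[of R B n]
    by (intro TA.genideal_minimal) (use h.ideal_vimage[OF J_ideal] in \<open>simp_all add: tensor_ideal_def\<close>)
  then show ?thesis using h by blast
qed

definition act where "act p x = permute_tuple p ` x"

lemma act_coset:
  assumes p: "p \<in> perms n" and f: "f \<in> carrier TA"
  shows "act p (J +>\<^bsub>TA\<^esub> f) = J +>\<^bsub>TA\<^esub> permute_tuple p f"
proof -
  interpret I: ideal J TA by (rule J_ideal)
  interpret h: ring_hom_ring TA TA "permute_tuple p" by (rule permute_hom[OF p])
  have J: "h \<in> J \<Longrightarrow> h \<in> carrier TA" for h using I.a_Hcarr by blast
  have inv: "permute_tuple p (permute_tuple (pinv p) g) = g" for g
    by (simp add: permute_tuple_def comp_assoc pinv_comp[OF p])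
  have "permute_tuple p ` (J +>\<^bsub>TA\<^esub> f) = J +>\<^bsub>TA\<^esub> permute_tuple p f"
  proof
    show "permute_tuple p ` (J +>\<^bsub>TA\<^esub> f) \<subseteq> J +>\<^bsub>TA\<^esub> permute_tuple p f"
    proof
      fix g assume "g \<in> permute_tuple p ` (J +>\<^bsub>TA\<^esub> f)"
      then obtain h where h: "h \<in> J" "g = permute_tuple p (h \<oplus>\<^bsub>TA\<^esub> f)"
        by (auto simp: a_r_coset_def r_coset_def)
      then have "g = permute_tuple p h \<oplus>\<^bsub>TA\<^esub> permute_tuple p f" using f J by simp
      then show "g \<in> J +>\<^bsub>TA\<^esub> permute_tuple p f"
        using permute_J[OF p h(1)] unfolding a_r_coset_def r_coset_def by auto
    qed
    show "J +>\<^bsub>TA\<^esub> permute_tuple p f \<subseteq> permute_tuple p ` (J +>\<^bsub>TA\<^esub> f)"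
    proof
      fix g assume "g \<in> J +>\<^bsub>TA\<^esub> permute_tuple p f"
      then obtain h where h: "h \<in> J" "g = h \<oplus>\<^bsub>TA\<^esub> permute_tuple p f" by (auto simp: a_r_coset_def r_coset_def)
      let ?h = "permute_tuple (pinv p) h"
      have h': "?h \<in> J" using permute_J[OF pinv_perms[OF p] h(1)] .
      have "g = permute_tuple p (?h \<oplus>\<^bsub>TA\<^esub> f)" using h h' f J by (simp add: inv)
      moreover have "?h \<oplus>\<^bsub>TA\<^esub> f \<in> J +>\<^bsub>TA\<^esub> f" using h' by (auto simp: a_r_coset_def r_coset_def)
      ultimately show "g \<in> permute_tuple p ` (J +>\<^bsub>TA\<^esub> f)" by blast
    qed
  qed
  then show ?thesis by (simp add: act_def)
qed

lemma T_cases: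
  assumes "x \<in> carrier T" obtains f where "f \<in> carrier TA" "x = J +>\<^bsub>TA\<^esub> f"
  using assms unfolding T_carrier by blast

lemma coset_in_T: "f \<in> carrier TA \<Longrightarrow> J +>\<^bsub>TA\<^esub> f \<in> carrier T"
  unfolding T_carrier by blast

lemma act_closed: "p \<in> perms n \<Longrightarrow> x \<in> carrier T \<Longrightarrow> act p x \<in> carrier T"
  by (erule T_cases) (simp add: act_coset permute_closed coset_in_T)

lemma act_add:
  assumes "p \<in> perms n" "x \<in> carrier T" "y \<in> carrier T"
  shows "act p (x \<oplus>\<^bsub>T\<^esub> y) = act p x \<oplus>\<^bsub>T\<^esub> act p y"
proof -
  obtain f g where fg: "f \<in> carrier TA" "g \<in> carrier TA" "x = J +>\<^bsub>TA\<^esub> f" "y = J +>\<^bsub>TA\<^esub> g"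
    using assms unfolding T_carrier by auto
  have "permute_tuple p (f \<oplus>\<^bsub>TA\<^esub> g) = permute_tuple p f \<oplus>\<^bsub>TA\<^esub> permute_tuple p g"
    by (simp add: permute_tuple_def MA.add_eq)
  then show ?thesis using fg assms(1) by (simp add: coset_add act_coset permute_closed)
qed

lemma act_smult:
  assumes "p \<in> perms n" "a \<in> carrier R" "x \<in> carrier T"
  shows "act p (a \<odot>\<^bsub>T\<^esub> x) = a \<odot>\<^bsub>T\<^esub> act p x"
proof -
  obtain f where f: "f \<in> carrier TA" "x = J +>\<^bsub>TA\<^esub> f"
    using assms unfolding T_carrier by auto
  have "permute_tuple p (a \<odot>\<^bsub>TA\<^esub> f) = a \<odot>\<^bsub>TA\<^esub> permute_tuple p f"
    by (simp add: permute_tuple_def MA.smult_eq)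
  then show ?thesis using f assms(1,2) by (simp add: coset_smult act_coset permute_closed)
qed

lemma act_mult:
  assumes "p \<in> perms n" "x \<in> carrier T" "y \<in> carrier T"
  shows "act p (x \<otimes>\<^bsub>T\<^esub> y) = act p x \<otimes>\<^bsub>T\<^esub> act p y"
proof -
  obtain f g where fg: "f \<in> carrier TA" "g \<in> carrier TA" "x = J +>\<^bsub>TA\<^esub> f" "y = J +>\<^bsub>TA\<^esub> g"
    using assms unfolding T_carrier by auto
  then show ?thesis using assms(1) by (simp add: coset_mult act_coset permute_closed permute_mult)
qed

lemma act_pure: "p \<in> perms n \<Longrightarrow> t \<in> tuples \<Longrightarrow> act p (pure t) = pure (t \<circ> pinv p)"
  unfolding pure_eq by (simp add: act_coset single_closed permute_single)

lemma act_finsum: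
  assumes "finite A" "\<And>i. i \<in> A \<Longrightarrow> x i \<in> carrier T" "p \<in> perms n"
  shows "act p (\<Oplus>\<^bsub>T\<^esub>i\<in>A. x i) = (\<Oplus>\<^bsub>T\<^esub>i\<in>A. act p (x i))"
  using assms(1,2)
proof (induction A rule: finite_induct)
  case empty
  have "act p (\<zero> \<odot>\<^bsub>T\<^esub> \<one>\<^bsub>T\<^esub>) = \<zero> \<odot>\<^bsub>T\<^esub> act p \<one>\<^bsub>T\<^esub>" using assms(3) by (intro act_smult) auto
  then show ?case using act_closed[OF assms(3), of "\<one>\<^bsub>T\<^esub>"] by simp
next
  case (insert i A)
  have "act p (\<Oplus>\<^bsub>T\<^esub>i\<in>insert i A. x i) = act p (x i \<oplus>\<^bsub>T\<^esub> (\<Oplus>\<^bsub>T\<^esub>i\<in>A. x i))"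
    using insert by (subst T.M.finsum_insert) auto
  also have "\<dots> = act p (x i) \<oplus>\<^bsub>T\<^esub> act p (\<Oplus>\<^bsub>T\<^esub>i\<in>A. x i)"
    using insert assms(3) by (intro act_add T.M.finsum_closed) auto
  also have "\<dots> = (\<Oplus>\<^bsub>T\<^esub>i\<in>insert i A. act p (x i))"
    using insert act_closed[OF assms(3)] by (subst T.M.finsum_insert) auto
  finally show ?case .
qed

abbreviation "S \<equiv> symmetric_tensors R B n"

lemma S_iff: "x \<in> S \<longleftrightarrow> x \<in> carrier T \<and> (\<forall>p\<in>perms n. act p x = x)"
  unfolding symmetric_tensors_def perms_iff act_def permute_tuple_def[abs_def] perms_def by blast

lemma S_closed: "x \<in> S \<Longrightarrow> x \<in> carrier T"
  by (simp add: S_iff)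

lemma S_add: "x \<in> S \<Longrightarrow> y \<in> S \<Longrightarrow> x \<oplus>\<^bsub>T\<^esub> y \<in> S"
  and S_mult: "x \<in> S \<Longrightarrow> y \<in> S \<Longrightarrow> x \<otimes>\<^bsub>T\<^esub> y \<in> S"
  and S_smult: "a \<in> carrier R \<Longrightarrow> x \<in> S \<Longrightarrow> a \<odot>\<^bsub>T\<^esub> x \<in> S"
  unfolding S_iff by (simp_all add: act_add act_mult act_smult)

lemma S_minus: "x \<in> S \<Longrightarrow> y \<in> S \<Longrightarrow> x \<ominus>\<^bsub>T\<^esub> y \<in> S"
  using S_add[of x "(\<ominus> \<one>) \<odot>\<^bsub>T\<^esub> y"] S_smult[of "\<ominus> \<one>" y] S_closed[of y]
  by (simp add: T.M.minus_eq T.smult_l_minus)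

text \<open>On a pure tensor both sides are the same product in a different order.\<close>

lemma tensor_form_act:
  assumes \<phi>: "\<And>j. j \<in> {1..n} \<Longrightarrow> linear_form R B (\<phi> j)" and p: "p \<in> perms n" and x: "x \<in> carrier T"
  shows "tensor_form \<phi> (act p x) = tensor_form (\<lambda>j. \<phi> (p j)) x"
proof -
  have \<phi>': "\<And>j. j \<in> {1..n} \<Longrightarrow> linear_form R B (\<phi> (p j))" using \<phi> perms_mem[OF p] by blast
  show ?thesis
    using x
  proof (induction rule: tensor_induct)
    case (pure t)
    have cl: "\<phi> j (t i) \<in> carrier R" if "i \<in> {1..n}" "j \<in> {1..n}" for i j
      using pure \<phi>[OF that(2)] that(1) by (auto simp: tuples_iff linear_form_def)
    have "tensor_form \<phi> (act p (pure t)) = (\<Otimes>j\<in>{1..n}. \<phi> j (t (pinv p j)))"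
      using tensor_form_pure[OF \<phi> tuples_comp[OF pure pinv_perms[OF p]]] by (simp add: act_pure[OF p pure])
    also have "\<dots> = (\<Otimes>j\<in>{1..n}. \<phi> (p j) (t (pinv p (p j))))"
      using cl perms_mem[OF pinv_perms[OF p]] by (intro R.finprod_reindex_bij[OF perms_bij[OF p]]) auto
    also have "\<dots> = tensor_form (\<lambda>j. \<phi> (p j)) (pure t)"
      using tensor_form_pure[OF \<phi>' pure] by (simp add: pinv_eq[OF p])
    finally show ?case .
  next
    case (add x y)
    then show ?case
      using tensor_form_add[OF \<phi> act_closed[OF p add(1)] act_closed[OF p add(2)]]
        tensor_form_add[OF \<phi>' add(1,2)] by (simp add: act_add[OF p])
  next
    case (smult a x)
    then show ?case
      using tensor_form_smult[OF \<phi> smult(1) act_closed[OF p smult(2)]]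
        tensor_form_smult[OF \<phi>' smult(1,2)] by (simp add: act_smult[OF p])
  qed
qed

section \<open>Multilinear expansion\<close>

text \<open>The \<open>j\<close>-th of the \<open>n\<close> inclusions of the algebra into its tensor power. Pure tensors are products of
  these, so multilinear expansion becomes the expansion of a product of sums.\<close>

definition slot where "slot j b = pure ((\<lambda>j\<in>{1..n}. \<one>\<^bsub>B\<^esub>)(j := b))"

lemma slot_closed: "j \<in> {1..n} \<Longrightarrow> b \<in> carrier B \<Longrightarrow> slot j b \<in> carrier T"
  unfolding slot_def by (intro pure_closed tuples_update one_tuple)

lemma slot_add: "j \<in> {1..n} \<Longrightarrow> b \<in> carrier B \<Longrightarrow> c \<in> carrier B \<Longrightarrow> slot j (b \<oplus>\<^bsub>B\<^esub> c) = slot j b \<oplus>\<^bsub>T\<^esub> slot j c"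
  unfolding slot_def by (intro pure_add one_tuple)

lemma slot_smult: "j \<in> {1..n} \<Longrightarrow> a \<in> carrier R \<Longrightarrow> b \<in> carrier B \<Longrightarrow> slot j (a \<odot>\<^bsub>B\<^esub> b) = a \<odot>\<^bsub>T\<^esub> slot j b"
  unfolding slot_def by (intro pure_smult one_tuple)

lemma slot_finsum:
  assumes "finite A" "\<And>i. i \<in> A \<Longrightarrow> b i \<in> carrier B" "j \<in> {1..n}"
  shows "slot j (\<Oplus>\<^bsub>B\<^esub>i\<in>A. b i) = (\<Oplus>\<^bsub>T\<^esub>i\<in>A. slot j (b i))"
  using assms(1,2)
proof (induction A rule: finite_induct)
  case empty
  have "slot j (\<zero> \<odot>\<^bsub>B\<^esub> \<one>\<^bsub>B\<^esub>) = \<zero> \<odot>\<^bsub>T\<^esub> slot j \<one>\<^bsub>B\<^esub>" using assms(3) by (intro slot_smult) auto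
  then show ?case using slot_closed[OF assms(3), of "\<one>\<^bsub>B\<^esub>"] by simp
next
  case (insert i A)
  then show ?case
    using slot_closed[OF assms(3)] by (simp add: slot_add[OF assms(3)] Pi_iff)
qed

lemma finprod_slot:
  assumes t: "\<And>j. j \<in> {1..n} \<Longrightarrow> t j \<in> carrier B" and I: "I \<subseteq> {1..n}"
  shows "(\<Otimes>\<^bsub>T\<^esub>j\<in>I. slot j (t j)) = pure (\<lambda>j\<in>{1..n}. if j \<in> I then t j else \<one>\<^bsub>B\<^esub>)"
proof -
  have "finite I" using I finite_subset by blast
  then show ?thesis using I
  proof (induction I rule: finite_induct)
    case empty
    then show ?case by (simp only: T.finprod_empty empty_iff if_False pure_one)
  next
    case (insert i I)
    have tup: "(\<lambda>j\<in>{1..n}. if j \<in> I then t j else \<one>\<^bsub>B\<^esub>) \<in> tuples"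
      "(\<lambda>j\<in>{1..n}. \<one>\<^bsub>B\<^esub>)(i := t i) \<in> tuples"
      using t insert.prems by (auto simp: tuples_iff extensional_def)
    have "(\<Otimes>\<^bsub>T\<^esub>j\<in>insert i I. slot j (t j)) = slot i (t i) \<otimes>\<^bsub>T\<^esub> (\<Otimes>\<^bsub>T\<^esub>j\<in>I. slot j (t j))"
      using insert t slot_closed by (intro T.finprod_insert) (auto simp: Pi_iff)
    also have "\<dots> = pure ((\<lambda>j\<in>{1..n}. \<one>\<^bsub>B\<^esub>)(i := t i) \<star> (\<lambda>j\<in>{1..n}. if j \<in> I then t j else \<one>\<^bsub>B\<^esub>))"
      using insert.IH insert.prems by (simp only: slot_def pure_mult[OF tup(2,1)] insert_subset)
    also have "(\<lambda>j\<in>{1..n}. \<one>\<^bsub>B\<^esub>)(i := t i) \<star> (\<lambda>j\<in>{1..n}. if j \<in> I then t j else \<one>\<^bsub>B\<^esub>)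
        = (\<lambda>j\<in>{1..n}. if j \<in> insert i I then t j else \<one>\<^bsub>B\<^esub>)"
      using t insert by (auto simp: fun_eq_iff)
    finally show ?case .
  qed
qed

lemma finprod_smult:
  assumes "finite A" "\<And>i. i \<in> A \<Longrightarrow> a i \<in> carrier R" "\<And>i. i \<in> A \<Longrightarrow> x i \<in> carrier T"
  shows "(\<Otimes>\<^bsub>T\<^esub>i\<in>A. a i \<odot>\<^bsub>T\<^esub> x i) = (\<Otimes>i\<in>A. a i) \<odot>\<^bsub>T\<^esub> (\<Otimes>\<^bsub>T\<^esub>i\<in>A. x i)"
  using assms
proof (induction A rule: finite_induct)
  case (insert i A)
  have cl: "(\<Otimes>i\<in>A. a i) \<in> carrier R" "(\<Otimes>\<^bsub>T\<^esub>i\<in>A. x i) \<in> carrier T"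
    using insert by (auto intro!: R.finprod_closed T.finprod_closed)
  have r: "y \<otimes>\<^bsub>T\<^esub> (b \<odot>\<^bsub>T\<^esub> z) = b \<odot>\<^bsub>T\<^esub> (y \<otimes>\<^bsub>T\<^esub> z)"
    if "b \<in> carrier R" "y \<in> carrier T" "z \<in> carrier T" for b y z
    using that by (metis T.m_comm T.smult_assoc2 T.smult_closed)
  show ?case
    using insert cl by (simp add: Pi_iff T.smult_assoc2 r flip: T.smult_assoc1) (simp add: R.m_comm)
qed simp

lemma pure_expand:
  assumes I: "\<And>j. j \<in> {1..n} \<Longrightarrow> finite (I j)"
    and a: "\<And>j i. j \<in> {1..n} \<Longrightarrow> i \<in> I j \<Longrightarrow> a j i \<in> carrier R"
    and b: "\<And>j i. j \<in> {1..n} \<Longrightarrow> i \<in> I j \<Longrightarrow> b j i \<in> carrier B"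
  shows "pure (\<lambda>j\<in>{1..n}. \<Oplus>\<^bsub>B\<^esub>i\<in>I j. a j i \<odot>\<^bsub>B\<^esub> b j i)
    = (\<Oplus>\<^bsub>T\<^esub>h\<in>choices {1..n} I d. (\<Otimes>j\<in>{1..n}. a j (h j)) \<odot>\<^bsub>T\<^esub> pure (\<lambda>j\<in>{1..n}. b j (h j)))"
proof -
  let ?C = "choices {1..n} I d"
  have C: "h j \<in> I j" if "h \<in> ?C" "j \<in> {1..n}" for h j using that by (auto simp: choices_def)
  have s: "(\<Oplus>\<^bsub>B\<^esub>i\<in>I j. a j i \<odot>\<^bsub>B\<^esub> b j i) \<in> carrier B" if "j \<in> {1..n}" for j
    using that a b by (auto intro!: M.finsum_closed)
  have sl: "a j i \<odot>\<^bsub>T\<^esub> slot j (b j i) \<in> carrier T" if "j \<in> {1..n}" "i \<in> I j" for i j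
    using that a b slot_closed by (auto intro!: T.smult_closed)
  have "pure (\<lambda>j\<in>{1..n}. \<Oplus>\<^bsub>B\<^esub>i\<in>I j. a j i \<odot>\<^bsub>B\<^esub> b j i)
      = (\<Otimes>\<^bsub>T\<^esub>j\<in>{1..n}. slot j (\<Oplus>\<^bsub>B\<^esub>i\<in>I j. a j i \<odot>\<^bsub>B\<^esub> b j i))"
    using s by (subst finprod_slot) (auto cong: restrict_cong)
  also have "\<dots> = (\<Otimes>\<^bsub>T\<^esub>j\<in>{1..n}. \<Oplus>\<^bsub>T\<^esub>i\<in>I j. a j i \<odot>\<^bsub>T\<^esub> slot j (b j i))"
  proof (rule T.finprod_cong')
    fix j assume j: "j \<in> {1..n}"
    have "slot j (\<Oplus>\<^bsub>B\<^esub>i\<in>I j. a j i \<odot>\<^bsub>B\<^esub> b j i) = (\<Oplus>\<^bsub>T\<^esub>i\<in>I j. slot j (a j i \<odot>\<^bsub>B\<^esub> b j i))"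
      using j I a b by (intro slot_finsum) auto
    also have "\<dots> = (\<Oplus>\<^bsub>T\<^esub>i\<in>I j. a j i \<odot>\<^bsub>T\<^esub> slot j (b j i))"
      using j a b sl by (intro T.M.finsum_cong') (auto simp: slot_smult)
    finally show "slot j (\<Oplus>\<^bsub>B\<^esub>i\<in>I j. a j i \<odot>\<^bsub>B\<^esub> b j i) = \<dots>" .
  qed (use sl in \<open>auto intro!: T.M.finsum_closed\<close>)
  also have "\<dots> = (\<Oplus>\<^bsub>T\<^esub>h\<in>?C. \<Otimes>\<^bsub>T\<^esub>j\<in>{1..n}. a j (h j) \<odot>\<^bsub>T\<^esub> slot j (b j (h j)))"
    using I sl by (intro T.finprod_finsum) auto
  also have "\<dots> = (\<Oplus>\<^bsub>T\<^esub>h\<in>?C. (\<Otimes>j\<in>{1..n}. a j (h j)) \<odot>\<^bsub>T\<^esub> pure (\<lambda>j\<in>{1..n}. b j (h j)))"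
  proof (rule T.M.finsum_cong')
    fix h assume h: "h \<in> ?C"
    have "(\<Otimes>\<^bsub>T\<^esub>j\<in>{1..n}. a j (h j) \<odot>\<^bsub>T\<^esub> slot j (b j (h j)))
        = (\<Otimes>j\<in>{1..n}. a j (h j)) \<odot>\<^bsub>T\<^esub> (\<Otimes>\<^bsub>T\<^esub>j\<in>{1..n}. slot j (b j (h j)))"
      using a b C[OF h] slot_closed by (intro finprod_smult) auto
    also have "(\<Otimes>\<^bsub>T\<^esub>j\<in>{1..n}. slot j (b j (h j))) = pure (\<lambda>j\<in>{1..n}. b j (h j))"
      using b C[OF h] by (subst finprod_slot) (auto cong: restrict_cong)
    finally show "(\<Otimes>\<^bsub>T\<^esub>j\<in>{1..n}. a j (h j) \<odot>\<^bsub>T\<^esub> slot j (b j (h j)))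
        = (\<Otimes>j\<in>{1..n}. a j (h j)) \<odot>\<^bsub>T\<^esub> pure (\<lambda>j\<in>{1..n}. b j (h j))" .
  next
    show "(\<lambda>h. (\<Otimes>j\<in>{1..n}. a j (h j)) \<odot>\<^bsub>T\<^esub> pure (\<lambda>j\<in>{1..n}. b j (h j))) \<in> ?C \<rightarrow> carrier T"
      using a b C by (intro Pi_I T.smult_closed pure_closed R.finprod_closed) (auto simp: tuples_iff)
  qed simp
  finally show ?thesis .
qed

end

section \<open>Symmetric tensors over a polynomial ring\<close>

definition indic :: "nat set \<Rightarrow> nat \<Rightarrow> nat" where
  "indic I j = (if j \<in> I then 1 else 0)"

lemma sum_indic: "finite A \<Longrightarrow> I \<subseteq> A \<Longrightarrow> (\<Sum>j\<in>A. indic I j) = card I"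
  by (simp add: indic_def sum.If_cases Int_absorb1)

locale poly_tensors = UP_cring R P + tensor_algebra R P n for R (structure) and P (structure) and n
begin

definition mono where "mono \<alpha> = pure (\<lambda>j\<in>{1..n}. X (\<alpha> j))"

definition exponents :: "(nat \<Rightarrow> nat) set" where "exponents = {\<alpha>. \<forall>j. j \<notin> {1..n} \<longrightarrow> \<alpha> j = 0}"

text \<open>These forms are dual to the monomials, so that a tensor can be handled as a polynomial in \<open>n\<close>
  variables.\<close>

definition coefficient where "coefficient \<alpha> = tensor_form (\<lambda>j f. coeff P f (\<alpha> j))"

lemma mono_tuple: "(\<lambda>j\<in>{1..n}. X (\<alpha> j)) \<in> tuples"
  by (simp add: tuples_iff)

lemma mono_closed: "mono \<alpha> \<in> carrier T"
  unfolding mono_def by (intro pure_closed mono_tuple)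

lemma mono_mult: "mono \<alpha> \<otimes>\<^bsub>T\<^esub> mono \<beta> = mono (\<lambda>j. \<alpha> j + \<beta> j)"
proof -
  have "tmult (\<lambda>j\<in>{1..n}. X (\<alpha> j)) (\<lambda>j\<in>{1..n}. X (\<beta> j)) = (\<lambda>j\<in>{1..n}. X (\<alpha> j + \<beta> j))"
    by (intro restrict_ext) (simp add: monom_one_mult)
  then show ?thesis unfolding mono_def pure_mult[OF mono_tuple mono_tuple] by (simp only:)
qed

lemma mono_zero: "mono (\<lambda>_. 0) = \<one>\<^bsub>T\<^esub>"
  unfolding mono_def pure_one[symmetric] by (simp only: monom_one)

lemma act_mono: "p \<in> perms n \<Longrightarrow> act p (mono \<alpha>) = mono (\<alpha> \<circ> pinv p)"
  unfolding mono_def by (simp add: act_pure mono_tuple restrict_perm pinv_perms del: restrict_apply)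

lemma coeff_linear: "linear_form R P (\<lambda>f. coeff P f m)"
  by (simp add: linear_form_def)

lemma coefficient_closed: "x \<in> carrier T \<Longrightarrow> coefficient \<alpha> x \<in> carrier R"
  unfolding coefficient_def by (rule tensor_form_closed[OF coeff_linear])

lemma coefficient_add: "x \<in> carrier T \<Longrightarrow> y \<in> carrier T \<Longrightarrow>
    coefficient \<alpha> (x \<oplus>\<^bsub>T\<^esub> y) = coefficient \<alpha> x \<oplus> coefficient \<alpha> y"
  unfolding coefficient_def by (rule tensor_form_add[OF coeff_linear])

lemma coefficient_smult: "a \<in> carrier R \<Longrightarrow> x \<in> carrier T \<Longrightarrow>
    coefficient \<alpha> (a \<odot>\<^bsub>T\<^esub> x) = a \<otimes> coefficient \<alpha> x"
  unfolding coefficient_def by (rule tensor_form_smult[OF coeff_linear])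

lemma coefficient_pure: "t \<in> tuples \<Longrightarrow>
    coefficient \<alpha> (pure t) = (\<Otimes>j\<in>{1..n}. coeff P (t j) (\<alpha> j))"
  unfolding coefficient_def by (rule tensor_form_pure[OF coeff_linear])

lemma coefficient_finsum:
  "finite A \<Longrightarrow> (\<And>i. i \<in> A \<Longrightarrow> x i \<in> carrier T) \<Longrightarrow>
    coefficient \<alpha> (\<Oplus>\<^bsub>T\<^esub>i\<in>A. x i) = (\<Oplus>i\<in>A. coefficient \<alpha> (x i))"
  unfolding coefficient_def by (rule tensor_form_finsum[OF coeff_linear])

lemma coefficient_mono:
  assumes "\<alpha> \<in> exponents" "\<beta> \<in> exponents"
  shows "coefficient \<alpha> (mono \<beta>) = (if \<alpha> = \<beta> then \<one> else \<zero>)"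
proof -
  have "coefficient \<alpha> (mono \<beta>) = (\<Otimes>j\<in>{1..n}. coeff P ((\<lambda>j\<in>{1..n}. X (\<beta> j)) j) (\<alpha> j))"
    unfolding mono_def by (rule coefficient_pure[OF mono_tuple])
  also have "\<dots> = (\<Otimes>j\<in>{1..n}. if \<beta> j = \<alpha> j then \<one> else \<zero>)"
    by (intro R.finprod_cong') auto
  also have "\<dots> = (if \<alpha> = \<beta> then \<one> else \<zero>)"
  proof (cases "\<alpha> = \<beta>")
    case False
    then obtain j where j: "\<alpha> j \<noteq> \<beta> j" by auto
    then have "j \<in> {1..n}" using assms unfolding exponents_def by (metis (mono_tags, lifting) mem_Collect_eq)
    then have "(\<Otimes>j\<in>{1..n}. if \<beta> j = \<alpha> j then \<one> else \<zero>) = \<zero>"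
      using j by (intro R.finprod_zero[of _ j]) auto
    with False show ?thesis by simp
  qed simp
  finally show ?thesis .
qed

lemma coefficient_symmetric:
  assumes x: "x \<in> S" and p: "p \<in> perms n" shows "coefficient (\<alpha> \<circ> p) x = coefficient \<alpha> x"
  using tensor_form_act[of "\<lambda>j f. coeff P f (\<alpha> j)", OF coeff_linear p S_closed[OF x]] x p
  by (simp add: coefficient_def S_iff)

abbreviation "box M \<equiv> choices {1..n} (\<lambda>_. {..M}) (\<lambda>_. 0 :: nat)"

lemma finite_box: "finite (box M)"
  by (intro finite_choices) auto

lemma box_exponents: "\<alpha> \<in> box M \<Longrightarrow> \<alpha> \<in> exponents"
  by (auto simp: choices_def exponents_def)

text \<open>Every larger box of exponents works as well, so that two tensors can be expanded over a common one.\<close>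

lemma expansion_ex:
  assumes "x \<in> carrier T"
  shows "\<exists>M. \<forall>m\<ge>M. x = (\<Oplus>\<^bsub>T\<^esub>\<alpha>\<in>box m. coefficient \<alpha> x \<odot>\<^bsub>T\<^esub> mono \<alpha>)"
  using assms
proof (induction rule: tensor_induct)
  case (pure t)
  have t: "t j \<in> carrier P" if "j \<in> {1..n}" for j using pure that by (simp add: tuples_iff)
  have "\<forall>j\<in>{1..n}. \<exists>N. \<forall>m\<ge>N. coeff P (t j) m = \<zero>"
    using eventually_coeff_zero t by metis
  then obtain N where N: "\<And>j m. j \<in> {1..n} \<Longrightarrow> m \<ge> N j \<Longrightarrow> coeff P (t j) m = \<zero>" by metis
  show ?case
  proof (intro exI allI impI)
    fix m assume m: "m \<ge> (\<Sum>j\<in>{1..n}. N j)"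
    have tj: "(\<Oplus>\<^bsub>P\<^esub>i\<in>{..m}. coeff P (t j) i \<odot>\<^bsub>P\<^esub> X i) = t j" if j: "j \<in> {1..n}" for j
    proof (rule up_eqI)
      fix k
      have Nj: "N j \<le> m" using m j member_le_sum[of j "{1..n}" N] by auto
      have "coeff P (\<Oplus>\<^bsub>P\<^esub>i\<in>{..m}. coeff P (t j) i \<odot>\<^bsub>P\<^esub> X i) k
          = (\<Oplus>i\<in>{..m}. coeff P (coeff P (t j) i \<odot>\<^bsub>P\<^esub> X i) k)"
        using t[OF j] by (intro coeff_finsum) auto
      also have "\<dots> = (\<Oplus>i\<in>{..m}. if i = k then coeff P (t j) i else \<zero>)"
        using t[OF j] by (intro R.finsum_cong') auto
      also have "\<dots> = coeff P (t j) k"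
      proof (cases "k \<le> m")
        case True
        have "(\<Oplus>i\<in>{..m}. if i = k then coeff P (t j) i else \<zero>) = (if k = k then coeff P (t j) k else \<zero>)"
          using True t[OF j] by (intro R.finsum_single) auto
        then show ?thesis by simp
      next
        case False
        then show ?thesis using N[OF j, of k] Nj by (auto intro!: R.add.finprod_one_eqI)
      qed
      finally show "coeff P (\<Oplus>\<^bsub>P\<^esub>i\<in>{..m}. coeff P (t j) i \<odot>\<^bsub>P\<^esub> X i) k = coeff P (t j) k" .
    qed (use t[OF j] in \<open>auto intro!: P.finsum_closed\<close>)
    have "(\<lambda>j\<in>{1..n}. \<Oplus>\<^bsub>P\<^esub>i\<in>{..m}. coeff P (t j) i \<odot>\<^bsub>P\<^esub> X i) = t"
    proof
      fix j show "(\<lambda>j\<in>{1..n}. \<Oplus>\<^bsub>P\<^esub>i\<in>{..m}. coeff P (t j) i \<odot>\<^bsub>P\<^esub> X i) j = t j"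
        using tj[of j] pure by (cases "j \<in> {1..n}") (auto simp: tuples_iff extensional_def)
    qed
    then have "pure t = pure (\<lambda>j\<in>{1..n}. \<Oplus>\<^bsub>P\<^esub>i\<in>{..m}. coeff P (t j) i \<odot>\<^bsub>P\<^esub> X i)" by (simp only:)
    also have "\<dots> = (\<Oplus>\<^bsub>T\<^esub>\<alpha>\<in>box m. (\<Otimes>j\<in>{1..n}. coeff P (t j) (\<alpha> j)) \<odot>\<^bsub>T\<^esub> pure (\<lambda>j\<in>{1..n}. X (\<alpha> j)))"
      using t by (intro pure_expand) auto
    also have "\<dots> = (\<Oplus>\<^bsub>T\<^esub>\<alpha>\<in>box m. coefficient \<alpha> (pure t) \<odot>\<^bsub>T\<^esub> mono \<alpha>)"
      by (simp only: coefficient_pure[OF pure] mono_def)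
    finally show "pure t = (\<Oplus>\<^bsub>T\<^esub>\<alpha>\<in>box m. coefficient \<alpha> (pure t) \<odot>\<^bsub>T\<^esub> mono \<alpha>)" .
  qed
next
  case (add x y)
  then obtain M M' where M: "\<And>m. m \<ge> M \<Longrightarrow> x = (\<Oplus>\<^bsub>T\<^esub>\<alpha>\<in>box m. coefficient \<alpha> x \<odot>\<^bsub>T\<^esub> mono \<alpha>)"
    "\<And>m. m \<ge> M' \<Longrightarrow> y = (\<Oplus>\<^bsub>T\<^esub>\<alpha>\<in>box m. coefficient \<alpha> y \<odot>\<^bsub>T\<^esub> mono \<alpha>)" by blast
  show ?case
  proof (intro exI allI impI)
    fix m assume m: "m \<ge> max M M'"
    have "x \<oplus>\<^bsub>T\<^esub> y = (\<Oplus>\<^bsub>T\<^esub>\<alpha>\<in>box m. coefficient \<alpha> x \<odot>\<^bsub>T\<^esub> mono \<alpha>) \<oplus>\<^bsub>T\<^esub> (\<Oplus>\<^bsub>T\<^esub>\<alpha>\<in>box m. coefficient \<alpha> y \<odot>\<^bsub>T\<^esub> mono \<alpha>)"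
      using M(1)[of m] M(2)[of m] m by simp
    also have "\<dots> = (\<Oplus>\<^bsub>T\<^esub>\<alpha>\<in>box m. coefficient \<alpha> x \<odot>\<^bsub>T\<^esub> mono \<alpha> \<oplus>\<^bsub>T\<^esub> coefficient \<alpha> y \<odot>\<^bsub>T\<^esub> mono \<alpha>)"
      using add by (intro T.M.finsum_addf[symmetric]) (auto intro!: T.smult_closed mono_closed coefficient_closed)
    also have "\<dots> = (\<Oplus>\<^bsub>T\<^esub>\<alpha>\<in>box m. coefficient \<alpha> (x \<oplus>\<^bsub>T\<^esub> y) \<odot>\<^bsub>T\<^esub> mono \<alpha>)"
      using add by (intro T.M.finsum_cong')
        (auto simp: coefficient_add T.smult_l_distr mono_closed coefficient_closed intro!: T.smult_closed)
    finally show "x \<oplus>\<^bsub>T\<^esub> y = (\<Oplus>\<^bsub>T\<^esub>\<alpha>\<in>box m. coefficient \<alpha> (x \<oplus>\<^bsub>T\<^esub> y) \<odot>\<^bsub>T\<^esub> mono \<alpha>)" .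
  qed
next
  case (smult a x)
  then obtain M where M: "\<And>m. m \<ge> M \<Longrightarrow> x = (\<Oplus>\<^bsub>T\<^esub>\<alpha>\<in>box m. coefficient \<alpha> x \<odot>\<^bsub>T\<^esub> mono \<alpha>)" by blast
  show ?case
  proof (intro exI allI impI)
    fix m assume m: "m \<ge> M"
    have "a \<odot>\<^bsub>T\<^esub> x = a \<odot>\<^bsub>T\<^esub> (\<Oplus>\<^bsub>T\<^esub>\<alpha>\<in>box m. coefficient \<alpha> x \<odot>\<^bsub>T\<^esub> mono \<alpha>)"
      using M[OF m] by simp
    also have "\<dots> = (\<Oplus>\<^bsub>T\<^esub>\<alpha>\<in>box m. a \<odot>\<^bsub>T\<^esub> (coefficient \<alpha> x \<odot>\<^bsub>T\<^esub> mono \<alpha>))"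
      using smult by (intro T.finsum_smult_ldistr finite_box)
        (auto intro!: T.smult_closed mono_closed coefficient_closed)
    also have "\<dots> = (\<Oplus>\<^bsub>T\<^esub>\<alpha>\<in>box m. coefficient \<alpha> (a \<odot>\<^bsub>T\<^esub> x) \<odot>\<^bsub>T\<^esub> mono \<alpha>)"
      using smult by (intro T.M.finsum_cong')
        (auto simp: coefficient_smult T.smult_assoc1 mono_closed coefficient_closed intro!: T.smult_closed)
    finally show "a \<odot>\<^bsub>T\<^esub> x = (\<Oplus>\<^bsub>T\<^esub>\<alpha>\<in>box m. coefficient \<alpha> (a \<odot>\<^bsub>T\<^esub> x) \<odot>\<^bsub>T\<^esub> mono \<alpha>)" .
  qed
qed

definition terms where "terms x = {\<alpha> \<in> exponents. coefficient \<alpha> x \<noteq> \<zero>}"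

lemma finite_terms:
  assumes x: "x \<in> carrier T" shows "finite (terms x)"
proof -
  obtain M where M: "x = (\<Oplus>\<^bsub>T\<^esub>\<alpha>\<in>box M. coefficient \<alpha> x \<odot>\<^bsub>T\<^esub> mono \<alpha>)" using expansion_ex[OF x] by blast
  have cl: "coefficient \<alpha> x \<odot>\<^bsub>T\<^esub> mono \<alpha> \<in> carrier T" for \<alpha>
    using x by (intro T.smult_closed mono_closed coefficient_closed)
  have "coefficient \<beta> x = \<zero>" if \<beta>: "\<beta> \<in> exponents" "\<beta> \<notin> box M" for \<beta>
  proof -
    have "coefficient \<beta> x = coefficient \<beta> (\<Oplus>\<^bsub>T\<^esub>\<alpha>\<in>box M. coefficient \<alpha> x \<odot>\<^bsub>T\<^esub> mono \<alpha>)" using M by simp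
    also have "\<dots> = (\<Oplus>\<alpha>\<in>box M. coefficient \<beta> (coefficient \<alpha> x \<odot>\<^bsub>T\<^esub> mono \<alpha>))"
      using cl by (intro coefficient_finsum finite_box)
    also have "\<dots> = \<zero>"
    proof (rule R.add.finprod_one_eqI)
      fix \<alpha> assume \<alpha>: "\<alpha> \<in> box M"
      then show "coefficient \<beta> (coefficient \<alpha> x \<odot>\<^bsub>T\<^esub> mono \<alpha>) = \<zero>"
        using \<beta> x box_exponents[OF \<alpha>] coefficient_mono[of \<beta> \<alpha>]
        by (auto simp: coefficient_smult[OF coefficient_closed mono_closed] coefficient_closed)
    qed
    finally show ?thesis .
  qed
  then have "terms x \<subseteq> box M" by (auto simp: terms_def)
  then show ?thesis using finite_box finite_subset by blast
qed

lemma zero_of_no_terms: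
  assumes x: "x \<in> carrier T" and "terms x = {}" shows "x = \<zero>\<^bsub>T\<^esub>"
proof -
  obtain M where M: "x = (\<Oplus>\<^bsub>T\<^esub>\<alpha>\<in>box M. coefficient \<alpha> x \<odot>\<^bsub>T\<^esub> mono \<alpha>)" using expansion_ex[OF x] by blast
  also have "\<dots> = \<zero>\<^bsub>T\<^esub>"
  proof (rule T.M.add.finprod_one_eqI)
    fix \<alpha> assume "\<alpha> \<in> box M"
    then have "coefficient \<alpha> x = \<zero>" using assms(2) box_exponents by (auto simp: terms_def)
    then show "coefficient \<alpha> x \<odot>\<^bsub>T\<^esub> mono \<alpha> = \<zero>\<^bsub>T\<^esub>" using mono_closed by simp
  qed
  finally show ?thesis .
qed

subsection \<open>Monomial symmetric functions\<close>

definition orbit where "orbit \<alpha> = (\<lambda>p. \<alpha> \<circ> p) ` perms n"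

text \<open>The monomial symmetric function of the exponent vector \<open>\<alpha>\<close>.\<close>

definition msum where "msum \<alpha> = (\<Oplus>\<^bsub>T\<^esub>\<beta>\<in>orbit \<alpha>. mono \<beta>)"

lemma finite_orbit: "finite (orbit \<alpha>)"
  by (simp add: orbit_def)

lemma orbit_self: "\<alpha> \<in> orbit \<alpha>"
proof -
  have "id \<in> perms n" unfolding perms_iff by (rule permutes_id)
  then show ?thesis unfolding orbit_def by (intro image_eqI[where x = id]) simp_all
qed

lemma orbit_exponents:
  assumes "\<alpha> \<in> exponents" "\<beta> \<in> orbit \<alpha>" shows "\<beta> \<in> exponents"
proof -
  obtain p where p: "p \<in> perms n" "\<beta> = \<alpha> \<circ> p" using assms by (auto simp: orbit_def)
  then show ?thesis using assms(1) perms_not_in[OF p(1)] by (simp add: exponents_def)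
qed

lemma orbit_comp: "\<beta> \<in> orbit \<alpha> \<Longrightarrow> q \<in> perms n \<Longrightarrow> \<beta> \<circ> q \<in> orbit \<alpha>"
proof -
  assume "\<beta> \<in> orbit \<alpha>" and q: "q \<in> perms n"
  then obtain p where p: "p \<in> perms n" "\<beta> = \<alpha> \<circ> p" by (auto simp: orbit_def)
  then have "p \<circ> q \<in> perms n" "\<beta> \<circ> q = \<alpha> \<circ> (p \<circ> q)"
    using q permutes_compose unfolding perms_iff by (blast, simp add: comp_assoc)
  then show ?thesis unfolding orbit_def by blast
qed

lemma msum_closed: "msum \<alpha> \<in> carrier T"
  unfolding msum_def by (intro T.M.finsum_closed Pi_I mono_closed)

lemma msum_symmetric: "msum \<alpha> \<in> S"
  unfolding S_iff
proof (intro conjI ballI msum_closed)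
  fix p assume p: "p \<in> perms n"
  have bij: "bij_betw (\<lambda>\<beta>. \<beta> \<circ> pinv p) (orbit \<alpha>) (orbit \<alpha>)"
    using orbit_comp p pinv_perms[OF p]
    by (intro bij_betw_byWitness[where f' = "\<lambda>\<beta>. \<beta> \<circ> p"]) (auto simp: comp_assoc pinv_comp[OF p])
  have "act p (msum \<alpha>) = (\<Oplus>\<^bsub>T\<^esub>\<beta>\<in>orbit \<alpha>. act p (mono \<beta>))"
    unfolding msum_def by (intro act_finsum finite_orbit mono_closed p)
  also have "\<dots> = (\<Oplus>\<^bsub>T\<^esub>\<beta>\<in>orbit \<alpha>. mono (\<beta> \<circ> pinv p))"
    by (simp only: act_mono[OF p])
  also have "\<dots> = msum \<alpha>"
    unfolding msum_def by (intro T.M.add.finprod_reindex_bij[OF bij, symmetric] mono_closed)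
  finally show "act p (msum \<alpha>) = msum \<alpha>" .
qed

lemma coefficient_mono_sum:
  assumes "finite A" "\<And>i. i \<in> A \<Longrightarrow> b i \<in> exponents" "\<beta> \<in> exponents" "\<beta> \<notin> b ` A"
  shows "coefficient \<beta> (\<Oplus>\<^bsub>T\<^esub>i\<in>A. mono (b i)) = \<zero>"
proof -
  have "coefficient \<beta> (\<Oplus>\<^bsub>T\<^esub>i\<in>A. mono (b i)) = (\<Oplus>i\<in>A. coefficient \<beta> (mono (b i)))"
    using assms mono_closed by (intro coefficient_finsum)
  also have "\<dots> = \<zero>"
    using assms by (intro R.add.finprod_one_eqI) (auto simp: coefficient_mono)
  finally show ?thesis .
qed

lemma coefficient_msum:
  assumes "\<alpha> \<in> exponents" "\<beta> \<in> exponents"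
  shows "coefficient \<beta> (msum \<alpha>) = (if \<beta> \<in> orbit \<alpha> then \<one> else \<zero>)"
proof (cases "\<beta> \<in> orbit \<alpha>")
  case True
  have "coefficient \<beta> (msum \<alpha>) = (\<Oplus>\<gamma>\<in>orbit \<alpha>. coefficient \<beta> (mono \<gamma>))"
    unfolding msum_def by (intro coefficient_finsum finite_orbit mono_closed)
  also have "\<dots> = coefficient \<beta> (mono \<beta>)"
    using True assms orbit_exponents[OF assms(1)]
    by (intro R.finsum_single finite_orbit) (auto simp: coefficient_mono)
  finally show ?thesis using True assms by (simp add: coefficient_mono)
next
  case False
  then show ?thesis
    using coefficient_mono_sum[OF finite_orbit, of \<alpha> "\<lambda>\<gamma>. \<gamma>" \<beta>] assms orbit_exponents[OF assms(1)]
    by (simp add: msum_def)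
qed

lemma finsum_elem_sym:
  "elem_sym_tensor R n i = (\<Oplus>\<^bsub>T\<^esub>I\<in>{I. I \<subseteq> {1..n} \<and> card I = i}. mono (indic I))"
proof -
  have var: "tensor_var R n j = slot j (X 1)" if "j \<in> {1..n}" for j
  proof -
    have "(\<lambda>j'\<in>{1..n}. if j' = j then X 1 else \<one>\<^bsub>P\<^esub>) = (\<lambda>j\<in>{1..n}. \<one>\<^bsub>P\<^esub>)(j := X 1)"
      using that by (auto simp: fun_eq_iff)
    then show ?thesis by (simp only: tensor_var_def slot_def P_def[symmetric])
  qed
  have "(\<Otimes>\<^bsub>T\<^esub>j\<in>I. tensor_var R n j) = mono (indic I)" if I: "I \<subseteq> {1..n}" for I
  proof -
    have "(\<Otimes>\<^bsub>T\<^esub>j\<in>I. tensor_var R n j) = (\<Otimes>\<^bsub>T\<^esub>j\<in>I. slot j (X 1))"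
      using I var slot_closed by (intro T.finprod_cong') (auto simp: subset_iff)
    also have "\<dots> = pure (\<lambda>j\<in>{1..n}. if j \<in> I then X 1 else \<one>\<^bsub>P\<^esub>)"
      using I by (intro finprod_slot) auto
    also have "(\<lambda>j\<in>{1..n}. if j \<in> I then X 1 else \<one>\<^bsub>P\<^esub>) = (\<lambda>j\<in>{1..n}. X (indic I j))"
      by (intro restrict_ext) (auto simp: indic_def)
    finally show ?thesis by (simp only: mono_def)
  qed
  then show ?thesis
    unfolding elem_sym_tensor_def P_def[symmetric] by (intro T.M.finsum_cong') (auto simp: mono_closed)
qed

lemma elem_sym_symmetric: "elem_sym_tensor R n i \<in> S"
  unfolding S_iff
proof (intro conjI ballI)
  let ?K = "{I. I \<subseteq> {1..n} \<and> card I = i}"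
  show "elem_sym_tensor R n i \<in> carrier T"
    unfolding finsum_elem_sym by (intro T.M.finsum_closed Pi_I mono_closed)
  fix p assume p: "p \<in> perms n"
  have perm: "p ` I \<in> ?K" if "I \<in> ?K" "p \<in> perms n" for p I
  proof -
    have "inj_on p I" using pinv_eq(1)[OF that(2)] by (metis inj_onI)
    then show ?thesis using that(1) perms_mem[OF that(2)] by (auto simp: card_image)
  qed
  have bij: "bij_betw ((`) p) ?K ?K"
  proof (rule bij_betw_byWitness[where f' = "(`) (pinv p)"])
    show "(`) p ` ?K \<subseteq> ?K" "(`) (pinv p) ` ?K \<subseteq> ?K"
      using perm[OF _ p] perm[OF _ pinv_perms[OF p]] by blast+
  qed (simp_all add: image_image pinv_eq[OF p])
  have ind: "indic I \<circ> pinv p = indic (p ` I)" for I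
  proof
    fix j
    have "pinv p j \<in> I \<longleftrightarrow> j \<in> p ` I" using pinv_eq[OF p] by (metis image_iff)
    then show "(indic I \<circ> pinv p) j = indic (p ` I) j" by (simp add: indic_def)
  qed
  have "act p (elem_sym_tensor R n i) = (\<Oplus>\<^bsub>T\<^esub>I\<in>?K. act p (mono (indic I)))"
    unfolding finsum_elem_sym by (intro act_finsum mono_closed p) simp
  also have "\<dots> = (\<Oplus>\<^bsub>T\<^esub>I\<in>?K. mono (indic (p ` I)))"
    by (simp only: act_mono[OF p] ind)
  also have "\<dots> = elem_sym_tensor R n i"
    unfolding finsum_elem_sym by (intro T.M.add.finprod_reindex_bij[OF bij, symmetric] mono_closed)
  finally show "act p (elem_sym_tensor R n i) = elem_sym_tensor R n i" .
qed

definition supp where "supp \<alpha> = {j :: nat. \<alpha> j \<noteq> (0 :: nat)}"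

lemma supp_exponents: "\<alpha> \<in> exponents \<Longrightarrow> supp \<alpha> \<subseteq> {1..n}"
  by (auto simp: exponents_def supp_def)

lemma supp_comp: "p \<in> perms n \<Longrightarrow> supp (\<alpha> \<circ> p) = pinv p ` supp \<alpha>"
proof -
  assume p: "p \<in> perms n"
  have "j \<in> pinv p ` supp \<alpha>" if "\<alpha> (p j) \<noteq> 0" for j
    using that pinv_eq(1)[OF p, of j] by (metis (mono_tags, lifting) imageI mem_Collect_eq supp_def)
  moreover have "\<alpha> (p (pinv p i)) \<noteq> 0" if "\<alpha> i \<noteq> 0" for i using that pinv_eq(2)[OF p] by simp
  ultimately show ?thesis by (auto simp: supp_def)
qed

lemma card_supp_orbit: "\<beta> \<in> orbit \<alpha> \<Longrightarrow> card (supp \<beta>) = card (supp \<alpha>)"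
proof -
  assume "\<beta> \<in> orbit \<alpha>"
  then obtain p where p: "p \<in> perms n" "\<beta> = \<alpha> \<circ> p" by (auto simp: orbit_def)
  have "inj_on (pinv p) (supp \<alpha>)" using pinv_eq(2)[OF p(1)] by (metis inj_onI)
  then show ?thesis by (simp only: p(2) supp_comp[OF p(1)] card_image)
qed

lemma sum_orbit: "\<beta> \<in> orbit \<alpha> \<Longrightarrow> sum \<beta> {1..n} = sum \<alpha> {1..n}"
proof -
  assume "\<beta> \<in> orbit \<alpha>"
  then obtain p where p: "p \<in> perms n" "\<beta> = \<alpha> \<circ> p" by (auto simp: orbit_def)
  then show ?thesis using sum.reindex_bij_betw[OF perms_bij[OF p(1)], of \<alpha>] by simp
qed

lemma orbitI_mset:
  assumes "\<alpha> \<in> exponents" "\<beta> \<in> exponents"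
    and "image_mset \<beta> (mset_set {1..n}) = image_mset \<alpha> (mset_set {1..n})"
  shows "\<beta> \<in> orbit \<alpha>"
proof -
  obtain p where p: "p permutes {1..n}" "\<forall>x\<in>{1..n}. \<beta> x = \<alpha> (p x)"
    using image_mset_eq_implies_permutes[OF _ assms(3)] by auto
  have "\<beta> = \<alpha> \<circ> p"
  proof
    fix j show "\<beta> j = (\<alpha> \<circ> p) j"
      using p permutes_not_in[OF p(1), of j] assms(1,2) by (cases "j \<in> {1..n}") (auto simp: exponents_def)
  qed
  then show ?thesis using p(1) by (auto simp: orbit_def perms_iff)
qed

text \<open>Two exponent vectors lie in the same orbit if they take the same values with the same
  multiplicities. Raising the exponents in \<open>I\<close> undoes the lowering of the nonzero entries of \<open>\<alpha>\<close> up to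
  a permutation, as the remaining \<open>n - card I\<close> entries are zero in either case.\<close>

lemma raise_orbit:
  assumes \<alpha>: "\<alpha> \<in> exponents" and I: "I \<subseteq> {1..n}" "card I = card (supp \<alpha>)"
    and \<gamma>: "\<gamma> \<in> orbit (\<lambda>j. \<alpha> j - 1)" and sub: "supp \<gamma> \<subseteq> I"
  shows "(\<lambda>j. indic I j + \<gamma> j) \<in> orbit \<alpha>"
proof (rule orbitI_mset[OF \<alpha>])
  let ?\<alpha>' = "\<lambda>j. \<alpha> j - 1" and ?\<delta> = "\<lambda>j. indic I j + \<gamma> j" and ?A = "supp \<alpha>"
  have A: "?A \<subseteq> {1..n}" by (rule supp_exponents[OF \<alpha>])
  have fin: "finite I" "finite ?A" using I A finite_subset by blast+
  have \<gamma>e: "\<gamma> \<in> exponents" using \<alpha> by (intro orbit_exponents[OF _ \<gamma>]) (auto simp: exponents_def)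
  then show "?\<delta> \<in> exponents" using I by (auto simp: exponents_def indic_def)
  have split: "image_mset f (mset_set {1..n}) = image_mset f (mset_set C) + replicate_mset (n - card C) 0"
    if C: "C \<subseteq> {1..n}" and z: "\<And>j. j \<in> {1..n} - C \<Longrightarrow> f j = 0" for C and f :: "nat \<Rightarrow> nat"
  proof -
    have finC: "finite C" using C finite_subset by blast
    have "mset_set {1..n} = mset_set (C \<union> ({1..n} - C))" using C by (simp add: Un_absorb1)
    also have "\<dots> = mset_set C + mset_set ({1..n} - C)" using finC by (intro mset_set_Union) auto
    finally have "image_mset f (mset_set {1..n}) = image_mset f (mset_set C) + image_mset f (mset_set ({1..n} - C))"
      by simp
    moreover have "image_mset f (mset_set ({1..n} - C)) = image_mset (\<lambda>_. 0) (mset_set ({1..n} - C))"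
      using z by (intro image_mset_cong) auto
    ultimately show ?thesis using C finC by (simp add: image_mset_const_eq card_Diff_subset)
  qed
  obtain p where p: "p \<in> perms n" "\<gamma> = ?\<alpha>' \<circ> p" using \<gamma> by (auto simp: orbit_def)
  have "image_mset \<gamma> (mset_set {1..n}) = image_mset ?\<alpha>' (image_mset p (mset_set {1..n}))"
    by (simp add: p(2) multiset.map_comp)
  also have "image_mset p (mset_set {1..n}) = mset_set {1..n}"
    using p(1) permutes_image_mset unfolding perms_iff by blast
  finally have eq: "image_mset \<gamma> (mset_set {1..n}) = image_mset ?\<alpha>' (mset_set {1..n})" .
  have "image_mset \<gamma> (mset_set {1..n}) = image_mset \<gamma> (mset_set I) + replicate_mset (n - card I) 0"
    using I sub by (intro split) (auto simp: supp_def)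
  moreover have "image_mset ?\<alpha>' (mset_set {1..n}) = image_mset ?\<alpha>' (mset_set ?A) + replicate_mset (n - card I) 0"
    unfolding I(2) using A by (intro split) (auto simp: supp_def)
  ultimately have core: "image_mset \<gamma> (mset_set I) = image_mset ?\<alpha>' (mset_set ?A)" using eq by simp
  have "image_mset ?\<delta> (mset_set {1..n}) = image_mset ?\<delta> (mset_set I) + replicate_mset (n - card I) 0"
    using I sub by (intro split) (auto simp: supp_def indic_def)
  also have "image_mset ?\<delta> (mset_set I) = image_mset Suc (image_mset \<gamma> (mset_set I))"
    using fin by (subst multiset.map_comp) (auto intro!: image_mset_cong simp: indic_def)
  also have "\<dots> = image_mset \<alpha> (mset_set ?A)"
    unfolding core using fin by (subst multiset.map_comp) (auto intro!: image_mset_cong simp: supp_def)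
  also have "image_mset \<alpha> (mset_set ?A) + replicate_mset (n - card I) 0 = image_mset \<alpha> (mset_set {1..n})"
    unfolding I(2) using A by (intro split[symmetric]) (auto simp: supp_def)
  finally show "image_mset ?\<delta> (mset_set {1..n}) = image_mset \<alpha> (mset_set {1..n})" .
qed

text \<open>The inverse map sends an exponent vector to its support and its lowering.\<close>

lemma bij_raise:
  assumes \<alpha>: "\<alpha> \<in> exponents"
  shows "bij_betw (\<lambda>(I, \<gamma>) j. indic I j + \<gamma> j)
    {(I, \<gamma>). I \<subseteq> {1..n} \<and> card I = card (supp \<alpha>) \<and> \<gamma> \<in> orbit (\<lambda>j. \<alpha> j - 1) \<and> supp \<gamma> \<subseteq> I} (orbit \<alpha>)"
    (is "bij_betw ?f ?W _")
proof (rule bij_betw_byWitness[where f' = "\<lambda>\<delta>. (supp \<delta>, \<lambda>j. \<delta> j - 1)"])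
  show "\<forall>w\<in>?W. (supp (?f w), \<lambda>j. ?f w j - 1) = w"
  proof
    fix w assume "w \<in> ?W"
    then obtain I \<gamma> where w: "w = (I, \<gamma>)" and sub: "supp \<gamma> \<subseteq> I" by auto
    have "\<gamma> j = 0" if "j \<notin> I" for j using sub that by (auto simp: supp_def)
    then have "indic I j + \<gamma> j - 1 = \<gamma> j" for j by (simp add: indic_def)
    moreover have "supp (\<lambda>j. indic I j + \<gamma> j) = I"
      using sub by (auto simp: supp_def indic_def)
    ultimately show "(supp (?f w), \<lambda>j. ?f w j - 1) = w" by (simp add: w)
  qed
  show "\<forall>\<delta>\<in>orbit \<alpha>. ?f (supp \<delta>, \<lambda>j. \<delta> j - 1) = \<delta>"
    by (auto simp: supp_def indic_def fun_eq_iff)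
  show "?f ` ?W \<subseteq> orbit \<alpha>"
    using raise_orbit[OF \<alpha>] by auto
  show "(\<lambda>\<delta>. (supp \<delta>, \<lambda>j. \<delta> j - 1)) ` orbit \<alpha> \<subseteq> ?W"
  proof
    fix w assume "w \<in> (\<lambda>\<delta>. (supp \<delta>, \<lambda>j. \<delta> j - 1)) ` orbit \<alpha>"
    then obtain \<delta> where \<delta>: "\<delta> \<in> orbit \<alpha>" "w = (supp \<delta>, \<lambda>j. \<delta> j - 1)" by blast
    then obtain p where p: "p \<in> perms n" "\<delta> = \<alpha> \<circ> p" by (auto simp: orbit_def)
    have "(\<lambda>j. \<delta> j - 1) = (\<lambda>j. \<alpha> j - 1) \<circ> p" by (simp add: p(2) comp_def)
    then have "(\<lambda>j. \<delta> j - 1) \<in> orbit (\<lambda>j. \<alpha> j - 1)" using p(1) unfolding orbit_def by blast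
    moreover have "supp (\<lambda>j. \<delta> j - 1) \<subseteq> supp \<delta>" by (auto simp: supp_def)
    ultimately show "w \<in> ?W"
      using \<delta> card_supp_orbit[OF \<delta>(1)] supp_exponents[OF orbit_exponents[OF \<alpha> \<delta>(1)]] by auto
  qed
qed

lemma one_symmetric: "\<one>\<^bsub>T\<^esub> \<in> S"
  unfolding S_iff
proof (intro conjI ballI)
  fix p assume "p \<in> perms n"
  then show "act p \<one>\<^bsub>T\<^esub> = \<one>\<^bsub>T\<^esub>" using act_mono[of p "\<lambda>_. 0"] by (simp only: mono_zero comp_def)
qed simp

section \<open>Generation by elementary symmetric functions\<close>

text \<open>\<open>H\<close> stands for the set on which two homomorphisms from the symmetric tensors agree. Such a set is
  closed under the operations only within \<open>S\<close>.\<close>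

context
  fixes H
  assumes H_one: "\<one>\<^bsub>T\<^esub> \<in> H"
    and H_add: "\<And>x y. x \<in> H \<Longrightarrow> y \<in> H \<Longrightarrow> x \<in> S \<Longrightarrow> y \<in> S \<Longrightarrow> x \<oplus>\<^bsub>T\<^esub> y \<in> H"
    and H_mult: "\<And>x y. x \<in> H \<Longrightarrow> y \<in> H \<Longrightarrow> x \<in> S \<Longrightarrow> y \<in> S \<Longrightarrow> x \<otimes>\<^bsub>T\<^esub> y \<in> H"
    and H_smult: "\<And>a x. a \<in> carrier R \<Longrightarrow> x \<in> H \<Longrightarrow> x \<in> S \<Longrightarrow> a \<odot>\<^bsub>T\<^esub> x \<in> H"
    and H_elem: "\<And>i. i \<in> {1..n} \<Longrightarrow> elem_sym_tensor R n i \<in> H"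
begin

text \<open>Coefficients of a symmetric tensor are constant on orbits, so subtracting a multiple of a monomial
  symmetric function removes a whole orbit of terms.\<close>

lemma generated_of_terms:
  assumes "x \<in> S" "\<And>\<alpha>. \<alpha> \<in> terms x \<Longrightarrow> msum \<alpha> \<in> H"
  shows "x \<in> H"
  using assms
proof (induction "card (terms x)" arbitrary: x rule: less_induct)
  case less
  have x: "x \<in> carrier T" using less.prems(1) by (rule S_closed)
  show ?case
  proof (cases "terms x = {}")
    case True
    then have "x = \<zero> \<odot>\<^bsub>T\<^esub> \<one>\<^bsub>T\<^esub>" using zero_of_no_terms[OF x] by simp
    then show ?thesis using H_smult[OF _ H_one one_symmetric, of \<zero>] by simp
  next
    case False
    then obtain \<alpha> where \<alpha>: "\<alpha> \<in> terms x" by blast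
    then have \<alpha>e: "\<alpha> \<in> exponents" by (simp add: terms_def)
    let ?a = "coefficient \<alpha> x"
    let ?m = "?a \<odot>\<^bsub>T\<^esub> msum \<alpha>"
    let ?y = "x \<ominus>\<^bsub>T\<^esub> ?m"
    have a: "?a \<in> carrier R" using x by (rule coefficient_closed)
    have m: "?m \<in> S" "?m \<in> H" "?m \<in> carrier T"
      using a msum_symmetric H_smult less.prems(2)[OF \<alpha>] S_smult S_closed by blast+
    have y: "?y \<in> S" using less.prems(1) m(1) by (rule S_minus)
    have minus: "?y = x \<oplus>\<^bsub>T\<^esub> (\<ominus> \<one>) \<odot>\<^bsub>T\<^esub> ?m" using m(3) by (simp add: T.M.minus_eq T.smult_l_minus)
    have cy: "coefficient \<beta> ?y = coefficient \<beta> x \<ominus> ?a \<otimes> (if \<beta> \<in> orbit \<alpha> then \<one> else \<zero>)"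
      if \<beta>: "\<beta> \<in> exponents" for \<beta>
      unfolding minus using x m(3) a msum_closed \<beta>
      by (simp add: coefficient_add coefficient_smult coefficient_msum \<alpha>e coefficient_closed R.minus_eq R.l_minus)
    have "terms ?y \<subseteq> terms x - {\<alpha>}"
    proof
      fix \<beta> assume \<beta>: "\<beta> \<in> terms ?y"
      then have \<beta>e: "\<beta> \<in> exponents" by (simp add: terms_def)
      have "\<beta> \<notin> orbit \<alpha>"
      proof
        assume o: "\<beta> \<in> orbit \<alpha>"
        then obtain p where p: "p \<in> perms n" "\<beta> = \<alpha> \<circ> p" by (auto simp: orbit_def)
        then have "coefficient \<beta> x = ?a" using coefficient_symmetric[OF less.prems(1)] by simp
        then have "coefficient \<beta> ?y = \<zero>" using cy[OF \<beta>e] o a by (simp add: R.minus_eq R.r_neg)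
        with \<beta> show False by (simp add: terms_def)
      qed
      then show "\<beta> \<in> terms x - {\<alpha>}"
        using \<beta> \<beta>e cy[OF \<beta>e] a orbit_self x by (auto simp: terms_def R.minus_eq coefficient_closed)
    qed
    then have sub: "terms ?y \<subset> terms x" using \<alpha> by blast
    then have "card (terms ?y) < card (terms x)" using finite_terms[OF x] by (rule psubset_card_mono[rotated])
    then have "?y \<in> H" using less.hyps y less.prems(2) sub by blast
    moreover have "x = ?y \<oplus>\<^bsub>T\<^esub> ?m" using x m(3) by (simp add: T.M.minus_eq T.M.a_assoc T.M.l_neg)
    ultimately show ?thesis using H_add[of ?y ?m] m y by simp
  qed
qed

text \<open>Multiplying the monomial symmetric function of the lowered exponents by the elementary one of
  the size of the support reproduces the original one, plus monomials of the same degree with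
  strictly larger support.\<close>

lemma msum_generated:
  assumes "\<alpha> \<in> exponents" shows "msum \<alpha> \<in> H"
  using assms
\<comment> \<open>The lowered exponents have smaller degree; the other monomials have the same degree, but more
    variables occur in them.\<close>
proof (induction \<alpha> rule: wf_induct_rule[OF wf_measures[of "[\<lambda>\<alpha>. sum \<alpha> {1..n}, \<lambda>\<alpha>. n - card (supp \<alpha>)]"]])
  case (1 \<alpha>)
  note \<alpha> = 1(2)
  have IH: "msum \<beta> \<in> H" if "\<beta> \<in> exponents"
    "sum \<beta> {1..n} < sum \<alpha> {1..n} \<or> sum \<beta> {1..n} = sum \<alpha> {1..n} \<and> n - card (supp \<beta>) < n - card (supp \<alpha>)" for \<beta>
    using 1(1)[of \<beta>] that by auto
  show ?case
  proof (cases "supp \<alpha> = {}")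
    case True
    then have z: "\<alpha> = (\<lambda>_. 0)" by (auto simp: supp_def)
    then have "orbit \<alpha> = {\<lambda>_. 0}" using orbit_self[of \<alpha>] by (auto simp: orbit_def)
    then have "msum \<alpha> = \<one>\<^bsub>T\<^esub>" by (simp add: msum_def mono_zero)
    then show ?thesis using H_one by simp
  next
    case False
    let ?k = "card (supp \<alpha>)" and ?\<alpha>' = "\<lambda>j. \<alpha> j - 1"
    have A: "supp \<alpha> \<subseteq> {1..n}" by (rule supp_exponents[OF \<alpha>])
    then have finA: "finite (supp \<alpha>)" using finite_subset by blast
    have k: "?k \<in> {1..n}" 
    proof -
      have "?k > 0" using False finA by (simp add: card_gt_0_iff)
      then show ?thesis using card_mono[OF _ A] by simp
    qed
    have \<alpha>'e: "?\<alpha>' \<in> exponents" using \<alpha> by (auto simp: exponents_def)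
    have sum': "sum ?\<alpha>' {1..n} + ?k = sum \<alpha> {1..n}"
    proof -
      have "(\<Sum>j\<in>{1..n}. \<alpha> j) = (\<Sum>j\<in>{1..n}. (\<alpha> j - 1) + indic (supp \<alpha>) j)"
        by (intro sum.cong) (auto simp: supp_def indic_def)
      also have "\<dots> = sum ?\<alpha>' {1..n} + ?k"
        using A by (simp add: sum.distrib sum_indic)
      finally show ?thesis by simp
    qed
    let ?K = "{I. I \<subseteq> {1..n} \<and> card I = ?k}"
    let ?f = "\<lambda>w. (\<lambda>j. indic (fst w) j + snd w j) :: nat \<Rightarrow> nat"
    let ?W = "?K \<times> orbit ?\<alpha>'"
    \<comment> \<open>The pairs in \<open>?W1\<close> contribute \<open>msum \<alpha>\<close>, those in \<open>?W2\<close> monomials with larger support.\<close>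
    let ?W1 = "{(I, \<gamma>). I \<subseteq> {1..n} \<and> card I = ?k \<and> \<gamma> \<in> orbit ?\<alpha>' \<and> supp \<gamma> \<subseteq> I}"
    let ?W2 = "?W - ?W1"
    have finK: "finite ?K" by simp
    have finW: "finite ?W" using finK finite_orbit by blast
    have W: "?W = ?W1 \<union> ?W2" "?W1 \<inter> ?W2 = {}" "?W1 \<subseteq> ?W" by auto
    have fin1: "finite ?W1" "finite ?W2" using finW finite_subset[OF W(3)] by auto
    let ?y = "elem_sym_tensor R n ?k \<otimes>\<^bsub>T\<^esub> msum ?\<alpha>'"
    let ?z = "\<Oplus>\<^bsub>T\<^esub>w\<in>?W2. mono (?f w)"
    have "?y = (\<Oplus>\<^bsub>T\<^esub>I\<in>?K. mono (indic I) \<otimes>\<^bsub>T\<^esub> msum ?\<alpha>')"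
      unfolding finsum_elem_sym by (intro T.finsum_ldistr finK Pi_I mono_closed msum_closed)
    also have "\<dots> = (\<Oplus>\<^bsub>T\<^esub>I\<in>?K. \<Oplus>\<^bsub>T\<^esub>\<gamma>\<in>orbit ?\<alpha>'. mono (\<lambda>j. indic I j + \<gamma> j))"
    proof (rule T.M.finsum_cong')
      fix I
      have "mono (indic I) \<otimes>\<^bsub>T\<^esub> msum ?\<alpha>' = (\<Oplus>\<^bsub>T\<^esub>\<gamma>\<in>orbit ?\<alpha>'. mono (indic I) \<otimes>\<^bsub>T\<^esub> mono \<gamma>)"
        unfolding msum_def by (intro T.finsum_rdistr finite_orbit Pi_I mono_closed)
      then show "mono (indic I) \<otimes>\<^bsub>T\<^esub> msum ?\<alpha>' = (\<Oplus>\<^bsub>T\<^esub>\<gamma>\<in>orbit ?\<alpha>'. mono (\<lambda>j. indic I j + \<gamma> j))"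
        by (simp only: mono_mult)
    qed (auto intro!: T.M.finsum_closed mono_closed)
    also have "\<dots> = (\<Oplus>\<^bsub>T\<^esub>w\<in>?W. mono (?f w))"
      by (intro T.M.add.finprod_Sigma finK finite_orbit mono_closed)
    also have "\<dots> = (\<Oplus>\<^bsub>T\<^esub>w\<in>?W1. mono (?f w)) \<oplus>\<^bsub>T\<^esub> ?z"
      by (subst W(1), rule T.M.finsum_Un_disjoint[OF fin1 W(2)]) (auto intro: mono_closed)
    also have "(\<Oplus>\<^bsub>T\<^esub>w\<in>?W1. mono (?f w)) = msum \<alpha>"
      unfolding msum_def
      using T.M.add.finprod_reindex_bij[OF bij_raise[OF \<alpha>], of mono] mono_closed
      by (simp add: case_prod_beta')
    finally have y: "?y = msum \<alpha> \<oplus>\<^bsub>T\<^esub> ?z" .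
    have zc: "?z \<in> carrier T" by (intro T.M.finsum_closed Pi_I mono_closed)
    have eS: "elem_sym_tensor R n ?k \<in> S" by (rule elem_sym_symmetric)
    have yS: "?y \<in> S" by (intro S_mult eS msum_symmetric)
    have yH: "?y \<in> H"
      using k sum' by (intro H_mult H_elem IH eS msum_symmetric \<alpha>'e) auto
    have "?z = ?y \<ominus>\<^bsub>T\<^esub> msum \<alpha>"
      unfolding y using zc msum_closed[of \<alpha>] by (simp add: T.M.minus_eq T.M.a_ac T.M.r_neg1 T.M.r_neg2)
    then have zS: "?z \<in> S" using S_minus[OF yS msum_symmetric] by simp
    have fe: "?f w \<in> exponents" if "w \<in> ?W" for w
    proof -
      have "snd w \<in> exponents" using that orbit_exponents[OF \<alpha>'e] by auto
      then show ?thesis using that by (auto simp: exponents_def indic_def)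
    qed
    have "?z \<in> H"
    proof (rule generated_of_terms[OF zS])
      fix \<beta> assume \<beta>: "\<beta> \<in> terms ?z"
      have "\<beta> \<in> ?f ` ?W2"
      proof (rule ccontr)
        assume "\<beta> \<notin> ?f ` ?W2"
        then have "coefficient \<beta> ?z = \<zero>"
          using \<beta> fe by (intro coefficient_mono_sum fin1) (auto simp: terms_def)
        with \<beta> show False by (simp add: terms_def)
      qed
      then obtain v where v: "v \<in> ?W2" "\<beta> = ?f v" by blast
      obtain I \<gamma> where "v = (I, \<gamma>)" by (cases v)
      with v have w: "I \<subseteq> {1..n}" "card I = ?k" "\<gamma> \<in> orbit ?\<alpha>'" "\<not> supp \<gamma> \<subseteq> I"
        "\<beta> = (\<lambda>j. indic I j + \<gamma> j)" by auto
      have \<beta>e: "\<beta> \<in> exponents" using \<beta> by (simp add: terms_def)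
      have "sum \<beta> {1..n} = ?k + sum \<gamma> {1..n}"
        unfolding w(5) using w(1,2) by (simp add: sum.distrib sum_indic)
      then have s: "sum \<beta> {1..n} = sum \<alpha> {1..n}" using sum_orbit[OF w(3)] sum' by simp
      have "I \<subset> supp \<beta>" using w(4) unfolding w(5) by (auto simp: supp_def indic_def)
      moreover have sb: "supp \<beta> \<subseteq> {1..n}" by (rule supp_exponents[OF \<beta>e])
      moreover from sb have "finite (supp \<beta>)" "card (supp \<beta>) \<le> n"
        using finite_subset card_mono[OF _ sb] by auto
      ultimately have "?k < card (supp \<beta>)" "card (supp \<beta>) \<le> n" using psubset_card_mono[of "supp \<beta>" I] w(2) by auto
      then show "msum \<beta> \<in> H" using s \<beta>e by (intro IH) auto
    qed
    then have "(\<ominus> \<one>) \<odot>\<^bsub>T\<^esub> ?z \<in> H" using zS by (intro H_smult) auto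
    then have "?y \<oplus>\<^bsub>T\<^esub> (\<ominus> \<one>) \<odot>\<^bsub>T\<^esub> ?z \<in> H" using yH yS zS by (intro H_add S_smult) auto
    moreover have "?y \<oplus>\<^bsub>T\<^esub> (\<ominus> \<one>) \<odot>\<^bsub>T\<^esub> ?z = msum \<alpha>"
      unfolding y using zc msum_closed[of \<alpha>] by (simp add: T.smult_l_minus T.M.a_assoc T.M.r_neg)
    ultimately show ?thesis by simp
  qed
qed

theorem symmetric_generated: "S \<subseteq> H"
  using generated_of_terms msum_generated by (auto simp: terms_def)

end

end

section \<open>The norm homomorphism\<close>

lemma perms_choices: "p \<in> perms n \<Longrightarrow> p \<in> choices {1..n} (\<lambda>_. {1..n}) id"
  by (simp add: choices_def perms_mem perms_not_in del: atLeastAtMost_iff)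

lemma choices_perms:
  assumes "h \<in> choices {1..n} (\<lambda>_. {1..n}) id" "inj_on h {1..n}" shows "h \<in> perms n"
proof -
  have "h ` {1..n} = {1..n}" using assms by (intro endo_inj_surj) (auto simp: choices_def)
  then have "bij_betw h {1..n} {1..n}" using assms(2) by (simp add: bij_betw_def)
  then show ?thesis
    unfolding perms_iff using assms(1) by (intro bij_imp_permutes) (simp_all add: choices_def)
qed

context monic_polynomial
begin

sublocale poly_tensors R P n
  by (intro poly_tensors.intro UP_cring_axioms tensor_algebra.intro)
    (rule UP_algebra[unfolded P_def], rule P_def)

text \<open>The matrix entries of multiplication by a tensor on the \<open>n\<close>-th tensor power of \<open>R[X]/(F)\<close>,
  whose basis is indexed by the self-maps of \<open>{1..n}\<close>.\<close>

definition entry where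
  "entry x k g = tensor_form (\<lambda>j b. coord (k j) (b \<otimes>\<^bsub>P\<^esub> X (g j - 1))) x"

lemma entry_linear: "linear_form R P (\<lambda>b. coord k (b \<otimes>\<^bsub>P\<^esub> X m))"
  by (auto simp: linear_form_def P.l_distr coord_add UP_smult_assoc2 coord_smult)

lemma entry_closed: "x \<in> carrier T \<Longrightarrow> entry x k g \<in> carrier R"
  unfolding entry_def by (rule tensor_form_closed[OF entry_linear])

lemma entry_add: "x \<in> carrier T \<Longrightarrow> y \<in> carrier T \<Longrightarrow> entry (x \<oplus>\<^bsub>T\<^esub> y) k g = entry x k g \<oplus> entry y k g"
  unfolding entry_def by (rule tensor_form_add[OF entry_linear])

lemma entry_smult: "a \<in> carrier R \<Longrightarrow> x \<in> carrier T \<Longrightarrow> entry (a \<odot>\<^bsub>T\<^esub> x) k g = a \<otimes> entry x k g"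
  unfolding entry_def by (rule tensor_form_smult[OF entry_linear])

lemma entry_pure: "t \<in> tuples \<Longrightarrow>
    entry (pure t) k g = (\<Otimes>j\<in>{1..n}. coord (k j) (t j \<otimes>\<^bsub>P\<^esub> X (g j - 1)))"
  unfolding entry_def by (rule tensor_form_pure[OF entry_linear])

abbreviation "selfmaps \<equiv> choices {1..n} (\<lambda>_. {1..n}) id"

lemma finite_selfmaps: "finite selfmaps"
  by (intro finite_choices) auto

lemma entry_mult_pure:
  assumes t: "t \<in> tuples" and s: "s \<in> tuples"
  shows "entry (pure t \<otimes>\<^bsub>T\<^esub> pure s) k g = (\<Oplus>h\<in>selfmaps. entry (pure t) k h \<otimes> entry (pure s) h g)"
proof -
  have tj: "t j \<in> carrier P" "s j \<in> carrier P" if "j \<in> {1..n}" for j using t s that by (simp_all add: tuples_iff)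
  let ?a = "\<lambda>j i. coord i (s j \<otimes>\<^bsub>P\<^esub> X (g j - 1))" and ?b = "\<lambda>j i. coord (k j) (t j \<otimes>\<^bsub>P\<^esub> X (i - 1))"
  have "entry (pure t \<otimes>\<^bsub>T\<^esub> pure s) k g = entry (pure (tmult t s)) k g"
    by (simp only: pure_mult[OF t s])
  also have "\<dots> = (\<Otimes>j\<in>{1..n}. coord (k j) (tmult t s j \<otimes>\<^bsub>P\<^esub> X (g j - 1)))"
    by (rule entry_pure[OF tuples_mult[OF t s]])
  also have "\<dots> = (\<Otimes>j\<in>{1..n}. \<Oplus>i\<in>{1..n}. ?a j i \<otimes> ?b j i)"
  proof (rule R.finprod_cong')
    fix j assume j: "j \<in> {1..n}"
    have "tmult t s j \<otimes>\<^bsub>P\<^esub> X (g j - 1) = t j \<otimes>\<^bsub>P\<^esub> (s j \<otimes>\<^bsub>P\<^esub> X (g j - 1))"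
      using j tj by (simp add: P.m_assoc)
    then show "coord (k j) (tmult t s j \<otimes>\<^bsub>P\<^esub> X (g j - 1)) = (\<Oplus>i\<in>{1..n}. ?a j i \<otimes> ?b j i)"
      using coord_mult[OF tj(1)[OF j], of "s j \<otimes>\<^bsub>P\<^esub> X (g j - 1)" "k j"] tj(2)[OF j] by simp
  qed (use tj in \<open>auto intro!: R.finsum_closed\<close>)
  also have "\<dots> = (\<Oplus>h\<in>selfmaps. \<Otimes>j\<in>{1..n}. ?a j (h j) \<otimes> ?b j (h j))"
    using tj by (intro R.finprod_finsum) auto
  also have "\<dots> = (\<Oplus>h\<in>selfmaps. entry (pure t) k h \<otimes> entry (pure s) h g)"
  proof (rule R.finsum_cong')
    fix h
    have "(\<Otimes>j\<in>{1..n}. ?a j (h j) \<otimes> ?b j (h j)) = (\<Otimes>j\<in>{1..n}. ?a j (h j)) \<otimes> (\<Otimes>j\<in>{1..n}. ?b j (h j))"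
      using tj by (intro R.finprod_multf) auto
    also have "\<dots> = entry (pure s) h g \<otimes> entry (pure t) k h"
      using entry_pure[OF t, of k h] entry_pure[OF s, of h g] by simp
    also have "\<dots> = entry (pure t) k h \<otimes> entry (pure s) h g"
      using pure_closed[OF t] pure_closed[OF s] entry_closed by (intro R.m_comm)
    finally show "(\<Otimes>j\<in>{1..n}. ?a j (h j) \<otimes> ?b j (h j)) = entry (pure t) k h \<otimes> entry (pure s) h g" .
  qed (auto intro!: entry_closed pure_closed t s)
  finally show ?thesis .
qed

text \<open>The action on the tensor power of \<open>R[X]/(F)\<close> is multiplicative. Both sides are bilinear, so pure
  tensors suffice.\<close>

lemma entry_mult:
  assumes x: "x \<in> carrier T" and y: "y \<in> carrier T"
  shows "entry (x \<otimes>\<^bsub>T\<^esub> y) k g = (\<Oplus>h\<in>selfmaps. entry x k h \<otimes> entry y h g)"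
  using x
proof (induction rule: tensor_induct)
  case (pure t)
  show ?case
    using y
  proof (induction rule: tensor_induct)
    case (pure s)
    then show ?case using entry_mult_pure[OF \<open>t \<in> tuples\<close>] by blast
  next
    case (add y z)
    have t: "pure t \<in> carrier T" using \<open>t \<in> tuples\<close> by (rule pure_closed)
    have "entry (pure t \<otimes>\<^bsub>T\<^esub> (y \<oplus>\<^bsub>T\<^esub> z)) k g = entry (pure t \<otimes>\<^bsub>T\<^esub> y) k g \<oplus> entry (pure t \<otimes>\<^bsub>T\<^esub> z) k g"
      using add.hyps t by (simp add: T.r_distr entry_add)
    also have "\<dots> = (\<Oplus>h\<in>selfmaps. entry (pure t) k h \<otimes> entry y h g \<oplus> entry (pure t) k h \<otimes> entry z h g)"
      unfolding add.IH using add.hyps t by (intro R.finsum_addf[symmetric]) (auto intro!: entry_closed)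
    also have "\<dots> = (\<Oplus>h\<in>selfmaps. entry (pure t) k h \<otimes> entry (y \<oplus>\<^bsub>T\<^esub> z) h g)"
      using add.hyps t by (intro R.finsum_cong') (auto simp: entry_add entry_closed R.r_distr)
    finally show ?case .
  next
    case (smult a y)
    have t: "pure t \<in> carrier T" using \<open>t \<in> tuples\<close> by (rule pure_closed)
    have "pure t \<otimes>\<^bsub>T\<^esub> (a \<odot>\<^bsub>T\<^esub> y) = a \<odot>\<^bsub>T\<^esub> (pure t \<otimes>\<^bsub>T\<^esub> y)"
      using smult.hyps t by (metis T.m_comm T.smult_assoc2 T.smult_closed)
    then have "entry (pure t \<otimes>\<^bsub>T\<^esub> (a \<odot>\<^bsub>T\<^esub> y)) k g = a \<otimes> entry (pure t \<otimes>\<^bsub>T\<^esub> y) k g"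
      using smult.hyps t by (simp add: entry_smult)
    also have "\<dots> = (\<Oplus>h\<in>selfmaps. a \<otimes> (entry (pure t) k h \<otimes> entry y h g))"
      unfolding smult.IH using smult.hyps t by (intro R.finsum_rdistr finite_selfmaps) (auto intro!: entry_closed)
    also have "\<dots> = (\<Oplus>h\<in>selfmaps. entry (pure t) k h \<otimes> entry (a \<odot>\<^bsub>T\<^esub> y) h g)"
      using smult.hyps t by (intro R.finsum_cong') (auto simp: entry_smult entry_closed R.m_lcomm)
    finally show ?case .
  qed
next
  case (add x z)
  have "entry ((x \<oplus>\<^bsub>T\<^esub> z) \<otimes>\<^bsub>T\<^esub> y) k g = entry (x \<otimes>\<^bsub>T\<^esub> y) k g \<oplus> entry (z \<otimes>\<^bsub>T\<^esub> y) k g"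
    using add.hyps y by (simp add: T.l_distr entry_add)
  also have "\<dots> = (\<Oplus>h\<in>selfmaps. entry x k h \<otimes> entry y h g \<oplus> entry z k h \<otimes> entry y h g)"
    unfolding add.IH using add.hyps y by (intro R.finsum_addf[symmetric]) (auto intro!: entry_closed)
  also have "\<dots> = (\<Oplus>h\<in>selfmaps. entry (x \<oplus>\<^bsub>T\<^esub> z) k h \<otimes> entry y h g)"
    using add.hyps y by (intro R.finsum_cong') (auto simp: entry_add entry_closed R.l_distr)
  finally show ?case .
next
  case (smult a x)
  have "entry ((a \<odot>\<^bsub>T\<^esub> x) \<otimes>\<^bsub>T\<^esub> y) k g = a \<otimes> entry (x \<otimes>\<^bsub>T\<^esub> y) k g"
    using smult.hyps y by (simp add: T.smult_assoc2 entry_smult)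
  also have "\<dots> = (\<Oplus>h\<in>selfmaps. a \<otimes> (entry x k h \<otimes> entry y h g))"
    unfolding smult.IH using smult.hyps y by (intro R.finsum_rdistr finite_selfmaps) (auto intro!: entry_closed)
  also have "\<dots> = (\<Oplus>h\<in>selfmaps. entry (a \<odot>\<^bsub>T\<^esub> x) k h \<otimes> entry y h g)"
    using smult.hyps y by (intro R.finsum_cong') (auto simp: entry_smult entry_closed R.m_assoc)
  finally show ?case .
qed

lemma entry_symmetric:
  assumes x: "x \<in> S" and p: "p \<in> perms n"
  shows "entry x (k \<circ> p) (g \<circ> p) = entry x k g"
  using tensor_form_act[of "\<lambda>j b. coord (k j) (b \<otimes>\<^bsub>P\<^esub> X (g j - 1))", OF entry_linear p S_closed[OF x]] x p
  by (simp add: entry_def S_iff)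

text \<open>A symmetric tensor commutes with the permutations of the factors, so it acts on the top
  exterior power of \<open>R[X]/(F)\<close>, which is free of rank one; \<open>ext_det x\<close> is the scalar by which \<open>x\<close>
  acts.\<close>

definition alt_entry where
  "alt_entry x h = (\<Oplus>p\<in>perms n. psign R p \<otimes> entry x p h)"

definition ext_det where "ext_det x = alt_entry x id"

lemma alt_entry_closed: "x \<in> carrier T \<Longrightarrow> alt_entry x h \<in> carrier R"
  unfolding alt_entry_def by (auto intro!: R.finsum_closed entry_closed)

lemma alt_entry_perm:
  assumes x: "x \<in> S" and h: "h \<in> perms n"
  shows "alt_entry x h = psign R h \<otimes> ext_det x"
proof -
  note xc = S_closed[OF x]
  have "alt_entry x h = (\<Oplus>p\<in>perms n. psign R (p \<circ> h) \<otimes> entry x (p \<circ> h) h)"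
    unfolding alt_entry_def using xc
    by (intro R.add.finprod_reindex_bij[OF bij_perms_compose_right[OF h]]) (auto intro!: entry_closed)
  also have "\<dots> = (\<Oplus>p\<in>perms n. psign R h \<otimes> (psign R p \<otimes> entry x p id))"
  proof (rule R.finsum_cong')
    fix p assume p: "p \<in> perms n"
    have "entry x (p \<circ> h) h = entry x p id" using entry_symmetric[OF x h, of p id] by simp
    then show "psign R (p \<circ> h) \<otimes> entry x (p \<circ> h) h = psign R h \<otimes> (psign R p \<otimes> entry x p id)"
      using R.psign_compose[OF p h] entry_closed[OF xc] by (simp add: R.m_ac)
  qed (use xc in \<open>auto intro!: R.m_closed entry_closed\<close>)
  also have "\<dots> = psign R h \<otimes> ext_det x"
    unfolding ext_det_def alt_entry_def using xc
    by (intro R.finsum_rdistr[symmetric]) (auto intro!: entry_closed)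
  finally show ?thesis .
qed

lemma alt_entry_not_inj:
  assumes x: "x \<in> S" and h: "\<not> inj_on h {1..n}"
  shows "alt_entry x h = \<zero>"
proof -
  note xc = S_closed[OF x]
  obtain i j where ij: "i \<in> {1..n}" "j \<in> {1..n}" "i \<noteq> j" "h i = h j"
    using h by (auto simp: inj_on_def)
  have h\<tau>: "h \<circ> transpose i j = h" using ij(4) by (auto simp: transpose_def)
  show ?thesis
    unfolding alt_entry_def
  proof (rule R.alternating_sum_transpose_right[OF ij(1-3)])
    fix p
    show "entry x (p \<circ> transpose i j) h = entry x p h"
      using entry_symmetric[OF x transpose_perms[OF ij(1,2)], of p h] by (simp only: h\<tau>)
  qed (use xc in \<open>auto intro: entry_closed\<close>)
qed

text \<open>In the alternating sum of the entries of the matrix product, the intermediate self-maps that are not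
  injective contribute zero, and a permutation contributes its sign times \<open>ext_det x\<close>.\<close>

lemma ext_det_mult:
  assumes x: "x \<in> S" and y: "y \<in> S"
  shows "ext_det (x \<otimes>\<^bsub>T\<^esub> y) = ext_det x \<otimes> ext_det y"
proof -
  note xc = S_closed[OF x] and yc = S_closed[OF y]
  have "ext_det (x \<otimes>\<^bsub>T\<^esub> y) = (\<Oplus>p\<in>perms n. \<Oplus>h\<in>selfmaps. psign R p \<otimes> (entry x p h \<otimes> entry y h id))"
    unfolding ext_det_def alt_entry_def entry_mult[OF xc yc] using xc yc
    by (intro R.finsum_cong' R.finsum_rdistr finite_selfmaps) (auto intro!: R.finsum_closed entry_closed)
  also have "\<dots> = (\<Oplus>h\<in>selfmaps. \<Oplus>p\<in>perms n. psign R p \<otimes> (entry x p h \<otimes> entry y h id))"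
    using xc yc by (intro R.add.finprod_swap finite_selfmaps finite_perms) (auto intro!: entry_closed)
  also have "\<dots> = (\<Oplus>h\<in>selfmaps. alt_entry x h \<otimes> entry y h id)"
  proof (rule R.finsum_cong')
    fix h
    have "(\<Oplus>p\<in>perms n. psign R p \<otimes> (entry x p h \<otimes> entry y h id))
        = (\<Oplus>p\<in>perms n. psign R p \<otimes> entry x p h \<otimes> entry y h id)"
      using xc yc by (intro R.finsum_cong') (auto simp: R.m_assoc entry_closed)
    also have "\<dots> = alt_entry x h \<otimes> entry y h id"
      unfolding alt_entry_def using xc yc
      by (intro R.finsum_ldistr[symmetric]) (auto intro!: entry_closed)
    finally show "(\<Oplus>p\<in>perms n. psign R p \<otimes> (entry x p h \<otimes> entry y h id)) = alt_entry x h \<otimes> entry y h id" .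
  qed (use xc yc in \<open>auto intro!: entry_closed alt_entry_closed\<close>)
  also have "\<dots> = (\<Oplus>h\<in>perms n. alt_entry x h \<otimes> entry y h id)"
  proof (rule R.add.finprod_mono_neutral_cong_right[OF finite_selfmaps])
    show "perms n \<subseteq> selfmaps" using perms_choices by blast
    fix h assume "h \<in> selfmaps - perms n"
    then have "\<not> inj_on h {1..n}" using choices_perms by blast
    then show "alt_entry x h \<otimes> entry y h id = \<zero>"
      using alt_entry_not_inj[OF x] entry_closed[OF yc] by simp
  qed (use xc yc in \<open>auto intro!: entry_closed alt_entry_closed\<close>)
  also have "\<dots> = (\<Oplus>h\<in>perms n. ext_det x \<otimes> (psign R h \<otimes> entry y h id))"
    using alt_entry_perm[OF x] alt_entry_closed[OF xc, of id] entry_closed[OF yc]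
    by (intro R.finsum_cong') (auto simp: ext_det_def R.m_ac)
  also have "\<dots> = ext_det x \<otimes> ext_det y"
    unfolding ext_det_def alt_entry_def[of y] using alt_entry_closed[OF xc] yc
    by (intro R.finsum_rdistr[symmetric]) (auto intro!: entry_closed)
  finally show ?thesis .
qed

lemma ext_det_closed: "x \<in> carrier T \<Longrightarrow> ext_det x \<in> carrier R"
  unfolding ext_det_def by (rule alt_entry_closed)

lemma ext_det_add:
  assumes "x \<in> carrier T" "y \<in> carrier T" shows "ext_det (x \<oplus>\<^bsub>T\<^esub> y) = ext_det x \<oplus> ext_det y"
proof -
  have "ext_det (x \<oplus>\<^bsub>T\<^esub> y) = (\<Oplus>p\<in>perms n. psign R p \<otimes> entry x p id \<oplus> psign R p \<otimes> entry y p id)"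
    unfolding ext_det_def alt_entry_def using assms
    by (intro R.finsum_cong') (auto simp: entry_add entry_closed R.r_distr)
  also have "\<dots> = ext_det x \<oplus> ext_det y"
    unfolding ext_det_def alt_entry_def using assms by (intro R.finsum_addf) (auto intro!: entry_closed)
  finally show ?thesis .
qed

lemma ext_det_smult:
  assumes "a \<in> carrier R" "x \<in> carrier T" shows "ext_det (a \<odot>\<^bsub>T\<^esub> x) = a \<otimes> ext_det x"
proof -
  have "ext_det (a \<odot>\<^bsub>T\<^esub> x) = (\<Oplus>p\<in>perms n. a \<otimes> (psign R p \<otimes> entry x p id))"
    unfolding ext_det_def alt_entry_def using assms
    by (intro R.finsum_cong') (auto simp: entry_smult entry_closed R.m_lcomm)
  also have "\<dots> = a \<otimes> ext_det x"
    unfolding ext_det_def alt_entry_def using assms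
    by (intro R.finsum_rdistr[symmetric]) (auto intro!: entry_closed)
  finally show ?thesis .
qed

lemma ext_det_pure: "t \<in> tuples \<Longrightarrow> ext_det (pure t) = alt (\<lambda>j. t j \<otimes>\<^bsub>P\<^esub> X (j - 1))"
  unfolding ext_det_def alt_entry_def alt_def by (simp add: entry_pure)

definition diagonal where "diagonal f = pure (\<lambda>j\<in>{1..n}. f)"

lemma diagonal_tuple: "f \<in> carrier P \<Longrightarrow> (\<lambda>j\<in>{1..n}. f) \<in> tuples"
  by (simp add: tuples_iff)

lemma diagonal_symmetric: assumes f: "f \<in> carrier P" shows "diagonal f \<in> S"
  unfolding S_iff
proof (intro conjI ballI)
  show "diagonal f \<in> carrier T" unfolding diagonal_def by (intro pure_closed diagonal_tuple f)
  fix p assume p: "p \<in> perms n"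
  then show "act p (diagonal f) = diagonal f"
    unfolding diagonal_def
    by (simp add: act_pure diagonal_tuple f restrict_perm pinv_perms del: restrict_apply)
qed

lemma diagonal_mult:
  assumes "f \<in> carrier P" "g \<in> carrier P"
  shows "diagonal f \<otimes>\<^bsub>T\<^esub> diagonal g = diagonal (f \<otimes>\<^bsub>P\<^esub> g)"
proof -
  have "tmult (\<lambda>j\<in>{1..n}. f) (\<lambda>j\<in>{1..n}. g) = (\<lambda>j\<in>{1..n}. f \<otimes>\<^bsub>P\<^esub> g)" by (intro restrict_ext) simp
  then show ?thesis
    unfolding diagonal_def pure_mult[OF diagonal_tuple[OF assms(1)] diagonal_tuple[OF assms(2)]] by (simp only:)
qed

lemma ext_det_diagonal: "f \<in> carrier P \<Longrightarrow> ext_det (diagonal f) = mult_det f"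
  unfolding diagonal_def mult_det_def ext_det_pure[OF diagonal_tuple]
  by (intro alt_cong) auto

lemma mult_det_mult:
  "f \<in> carrier P \<Longrightarrow> g \<in> carrier P \<Longrightarrow> mult_det (f \<otimes>\<^bsub>P\<^esub> g) = mult_det f \<otimes> mult_det g"
  using ext_det_mult[OF diagonal_symmetric diagonal_symmetric, of f g]
  by (simp add: diagonal_mult ext_det_diagonal)

lemma ext_det_one: "ext_det \<one>\<^bsub>T\<^esub> = \<one>"
  using ext_det_diagonal[of "\<one>\<^bsub>P\<^esub>"] mult_det_one by (simp add: diagonal_def pure_one del: restrict_apply)

lemma ext_det_elem_sym:
  assumes i: "i \<in> {1..n}"
  shows "ext_det (elem_sym_tensor R n i) = signed_coeff R F n i"
proof -
  let ?K = "{I. I \<subseteq> {1..n} \<and> card I = i}"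
  let ?top = "{n - i + 1..n}"
  have top: "?top \<in> ?K" using i by auto
  have sc: "signed_coeff R F n i \<in> carrier R"
    unfolding signed_coeff_def P_def[symmetric] by simp
  have mono: "ext_det (mono (indic I)) = (if I = ?top then signed_coeff R F n i else \<zero>)" if I: "I \<in> ?K" for I
  proof -
    have "ext_det (mono (indic I)) = alt (\<lambda>j. (\<lambda>j\<in>{1..n}. X (indic I j)) j \<otimes>\<^bsub>P\<^esub> X (j - 1))"
      unfolding mono_def by (rule ext_det_pure[OF mono_tuple])
    also have "\<dots> = alt (\<lambda>j. X (j - 1 + (if j \<in> I then 1 else 0)))"
    proof (rule alt_cong)
      fix j k assume j: "j \<in> {1..n}"
      have "X (indic I j) \<otimes>\<^bsub>P\<^esub> X (j - 1) = X (j - 1 + (if j \<in> I then 1 else 0))"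
        unfolding monom_one_mult[symmetric] indic_def by (simp add: add.commute)
      with j show "coord k ((\<lambda>j\<in>{1..n}. X (indic I j)) j \<otimes>\<^bsub>P\<^esub> X (j - 1))
          = coord k (X (j - 1 + (if j \<in> I then 1 else 0)))" by simp
    qed simp
    also have "\<dots> = (if I = ?top then signed_coeff R F n i else \<zero>)"
      using I i by (intro alt_shift) auto
    finally show ?thesis .
  qed
  have fin: "finite ?K" by simp
  have "ext_det (\<Oplus>\<^bsub>T\<^esub>I\<in>K. mono (indic I)) = (\<Oplus>I\<in>K. ext_det (mono (indic I)))" if "finite K" for K
    using that
  proof (induction K rule: finite_induct)
    case empty
    have "ext_det (\<zero> \<odot>\<^bsub>T\<^esub> \<one>\<^bsub>T\<^esub>) = \<zero> \<otimes> ext_det \<one>\<^bsub>T\<^esub>" by (intro ext_det_smult) auto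
    then show ?case by (simp add: ext_det_one)
  next
    case (insert I K)
    then show ?case
      using mono_closed by (simp add: ext_det_add ext_det_closed Pi_iff T.M.finsum_closed)
  qed
  from this[OF fin] have "ext_det (elem_sym_tensor R n i) = (\<Oplus>I\<in>?K. ext_det (mono (indic I)))"
    by (simp only: finsum_elem_sym)
  also have "\<dots> = ext_det (mono (indic ?top))"
    using top fin mono sc by (intro R.finsum_single ext_det_closed mono_closed) auto
  also have "\<dots> = signed_coeff R F n i" using mono[OF top] by simp
  finally show ?thesis .
qed

text \<open>The conditions on \<open>u\<^sub>F\<close> hold for \<open>ext_det\<close>. They determine it, because two solutions agree on a set
  that contains the elementary symmetric functions and is closed under the algebra operations.\<close>

lemma norm_hom_eq: "norm_hom R F n = restrict ext_det S"
proof -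
  let ?Q = "\<lambda>u. u \<in> extensional S \<and> u \<in> ring_hom (T\<lparr>carrier := S\<rparr>) R \<and>
       (\<forall>a\<in>carrier R. \<forall>x\<in>S. u (a \<odot>\<^bsub>T\<^esub> x) = a \<otimes> u x) \<and>
       (\<forall>i\<in>{1..n}. u (elem_sym_tensor R n i) = signed_coeff R F n i)"
  have one: "\<one>\<^bsub>T\<^esub> \<in> S" by (rule one_symmetric)
  have "?Q (restrict ext_det S)"
    using one S_mult S_add S_smult elem_sym_symmetric
    by (auto intro!: ring_hom_memI ext_det_closed
      simp: ext_det_mult ext_det_add ext_det_one ext_det_smult ext_det_elem_sym S_closed)
  moreover have "u = restrict ext_det S" if u: "?Q u" for u
  proof -
    have hom: "u \<in> ring_hom (T\<lparr>carrier := S\<rparr>) R" using u by blast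
    have ua: "u (x \<oplus>\<^bsub>T\<^esub> y) = u x \<oplus> u y" "u (x \<otimes>\<^bsub>T\<^esub> y) = u x \<otimes> u y" if "x \<in> S" "y \<in> S" for x y
      using ring_hom_add[OF hom] ring_hom_mult[OF hom] that by simp_all
    have u1: "u \<one>\<^bsub>T\<^esub> = \<one>" using ring_hom_one[OF hom] by simp
    have "S \<subseteq> {x \<in> S. u x = ext_det x}"
    proof (rule symmetric_generated)
      show "\<one>\<^bsub>T\<^esub> \<in> {x \<in> S. u x = ext_det x}" using one u1 ext_det_one by simp
      show "elem_sym_tensor R n i \<in> {x \<in> S. u x = ext_det x}" if "i \<in> {1..n}" for i
        using that u elem_sym_symmetric ext_det_elem_sym by simp
    qed (use ua u in \<open>auto simp: S_add S_mult S_smult ext_det_add ext_det_mult ext_det_smult S_closed\<close>)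
    then show ?thesis
      using u by (intro extensionalityI[of _ S]) auto
  qed
  ultimately have "(THE u. ?Q u) = restrict ext_det S" by (rule the_equality)
  then show ?thesis unfolding norm_hom_def Let_def P_def .
qed

lemma poly_norm_eq:
  assumes "f \<in> carrier P" shows "poly_norm R F n f = mult_det f"
proof -
  have "poly_norm R F n f = restrict ext_det S (diagonal f)"
    unfolding poly_norm_def norm_hom_eq diagonal_def P_def ..
  then show ?thesis using diagonal_symmetric[OF assms] ext_det_diagonal[OF assms] by simp
qed

lemma poly_norm_unit_iff:
  assumes f: "f \<in> carrier P" and n: "n > 0"
  shows "poly_norm R F n f \<in> Units R \<longleftrightarrow> unit_mod f"
proof
  assume "poly_norm R F n f \<in> Units R"
  then show "unit_mod f" using unit_mod_of_mult_det[OF f n] poly_norm_eq[OF f] by simp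
next
  assume "unit_mod f"
  then obtain g where g: "g \<in> carrier P" "f \<otimes>\<^bsub>P\<^esub> g \<ominus>\<^bsub>P\<^esub> \<one>\<^bsub>P\<^esub> \<in> PIdl\<^bsub>P\<^esub> F" by (auto simp: unit_mod_def)
  have "mult_det f \<otimes> mult_det g = \<one>"
    using mult_det_mult[OF f g(1)] mult_det_cong[OF _ _ g(2)] f g(1) mult_det_one by simp
  then show "poly_norm R F n f \<in> Units R"
    unfolding poly_norm_eq[OF f] Units_def
    using mult_det_closed[OF f] mult_det_closed[OF g(1)] R.m_comm by force
qed

end

theorem theorem4p2:
  fixes A :: "('a, 'm) ring_scheme"
    and F :: "nat \<Rightarrow> 'a"
    and U :: "(nat \<Rightarrow> 'a) set"
    and n :: nat
  assumes "cring A"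
    and "n > 0"
    and "monic_of_degree A F n"
    and "submonoid U (UP A)"
  shows "(canonical_map A U F \<in> ring_iso (UP A Quot PIdl\<^bsub>UP A\<^esub> F) (loc_residue_ring A U F) \<longleftrightarrow>
          module_basis A (loc_residue_ring A U F) {..<n}
            (\<lambda>i. loc_residue A U F (monom (UP A) \<one>\<^bsub>A\<^esub> i)))
       \<and> (module_basis A (loc_residue_ring A U F) {..<n}
            (\<lambda>i. loc_residue A U F (monom (UP A) \<one>\<^bsub>A\<^esub> i)) \<longleftrightarrow>
          (\<forall>f\<in>U. poly_norm A F n f \<in> Units A))"
proof -
  interpret UP_cring A "UP A" by (intro UP_cring.intro assms(1))
  interpret monic_polynomial A "UP A" F n
    using assms(3) by unfold_locales (auto simp: monic_of_degree_def)
  have "U \<subseteq> carrier (UP A)" using assms(4) by (rule submonoid.subset)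
  then have "(\<forall>f\<in>U. poly_norm A F n f \<in> Units A) \<longleftrightarrow> (\<forall>f\<in>U. unit_mod f)"
    using poly_norm_unit_iff[OF _ assms(2)] by blast
  then show ?thesis
    using canonical_iso_iff_unit_mod[OF assms(4)] basis_iff_unit_mod[OF assms(4)] by blast
qed

end
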